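(* Let $M=\Omega/\Gamma$ be a convex real projective manifold, where $\Omega\subset\mathbb{RP}^n$ is a properly convex open set and $\Gamma\subset PGL_{n+1}(\mathbb{R})$ is a subgroup acting freely and properly discontinuously on $\Omega$. Then the Kobayashi metric on the complexification $M^e=\Omega^e/\Gamma$ is complete.
   Context: A set $E\subset\mathbb{RP}^n$ is convex if it contains no projective line and its intersection with every projective line is connected. A convex set $E\subset\mathbb{RP}^n$ is properly convex if it is not contained in a projective hyperplane and contains no affine line (a projective line minus a point). Elliptic tubes: regard $\mathbb{RP}^n\subset\mathbb{CP}^n$ and write $\pi$ for the projections $\mathbb{R}^{n+1}\setminus\{0\}\to\mathbb{RP}^n$, $\mathbb{C}^{n+1}\setminus\{0\}\to\mathbb{CP}^n$. A closed segment $I\subset\mathbb{RP}^n$ with endpoints $a_0,a_1$ can be written as $I=\pi(\{c_0v_0+c_1v_1\neq 0 : c_0,c_1\in\mathbb{R},\ c_0c_1\ge 0\})$ for suitable $v_0,v_1\in\mathbb{R}^{n+1}$ with $\pi(v_i)=a_i$; put $I^e=\pi(\{c_0v_0+c_1v_1\neq 0 : c_0,c_1\in\mathbb{C},\ \mathrm{Re}(c_0\overline{c_1})\ge 0\})$. For $\Omega\subset\mathbb{RP}^n$, the elliptic tube is $\Omega^e=\bigcup\{I^e : I\subset \Omega \text{ a closed segment}\}\subset\mathbb{CP}^n$; it is open when $\Omega$ is. The construction is projectively invariant, so $\Gamma$ acts on $\Omega^e$ through $PGL_{n+1}(\mathbb{R})\subset PGL_{n+1}(\mathbb{C})$. When $\Omega$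 is properly convex and open and $\Gamma$ acts freely and properly discontinuously on $\Omega$, this action on $\Omega^e$ is also free and properly discontinuous, and the complexification of $M=\Omega/\Gamma$ is the complex manifold $M^e=\Omega^e/\Gamma$ (with its induced complex projective structure). *)

theory Defs
  imports "HOL-Analysis.Analysis" "HOL-Algebra.Coset"
begin

section \<open>Quotient topologies\<close>

definition quot_top :: "'a topology \<Rightarrow> ('a \<Rightarrow> 'b) \<Rightarrow> 'b topology" where
  "quot_top X f = topology (\<lambda>U. U \<subseteq> f ` topspace X \<and> openin X {x \<in> topspace X. f x \<in> U})"

lemma openin_quot_top:
  "openin (quot_top X f) U \<longleftrightarrow> U \<subseteq> f ` topspace X \<and> openin X {x \<in> topspace X. f x \<in> U}"
proof -
  have "istopology (\<lambda>U. U \<subseteq> f ` topspace X \<and> openin X {x \<in> topspace X. f x \<in> U})"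
    unfolding istopology_def
  proof (intro conjI allI impI; (elim conjE)?)
    fix S T
    assume "S \<subseteq> f ` topspace X" then show "S \<inter> T \<subseteq> f ` topspace X" by blast
  next
    fix S T
    assume *: "openin X {x \<in> topspace X. f x \<in> S}" "openin X {x \<in> topspace X. f x \<in> T}"
    have "{x \<in> topspace X. f x \<in> S \<inter> T} = {x \<in> topspace X. f x \<in> S} \<inter> {x \<in> topspace X. f x \<in> T}"
      by blast
    then show "openin X {x \<in> topspace X. f x \<in> S \<inter> T}" using * by (simp add: openin_Int)
  next
    fix \<K>
    assume "\<forall>K\<in>\<K>. K \<subseteq> f ` topspace X \<and> openin X {x \<in> topspace X. f x \<in> K}"
    then show "\<Union>\<K> \<subseteq> f ` topspace X" by blast
  next
    fix \<K>
    assume "\<forall>K\<in>\<K>. K \<subseteq> f ` topspace X \<and> openin X {x \<in> topspace X. f x \<in> K}"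
    moreover have "{x \<in> topspace X. f x \<in> \<Union>\<K>} = (\<Union>K\<in>\<K>. {x \<in> topspace X. f x \<in> K})"
      by blast
    ultimately show "openin X {x \<in> topspace X. f x \<in> \<Union>\<K>}" by (simp add: openin_clauses(3) image_iff)
  qed
  then show ?thesis by (simp add: quot_top_def topology_inverse')
qed

lemma topspace_quot_top: "topspace (quot_top X f) = f ` topspace X"
proof (rule antisym)
  show "topspace (quot_top X f) \<subseteq> f ` topspace X"
    using openin_topspace[of "quot_top X f"] by (simp only: openin_quot_top)
  have "{x \<in> topspace X. f x \<in> f ` topspace X} = topspace X" by blast
  then have "openin (quot_top X f) (f ` topspace X)" by (simp add: openin_quot_top)
  then show "f ` topspace X \<subseteq> topspace (quot_top X f)" by (rule openin_subset)
qed

lemma quotient_map_quot_top: "quotient_map X (quot_top X f) f"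
  by (auto simp: quotient_map_def topspace_quot_top openin_quot_top)

section \<open>Projective space\<close>

text \<open>Both real and complex projective \<open>n\<close>-space are the set of lines through \<open>0\<close> in
  \<open>'k ^ 'n\<close>, where \<open>CARD('n) = n + 1\<close>.\<close>

definition proj_point :: "'k::field ^ 'n \<Rightarrow> ('k ^ 'n) set" where
  "proj_point v = vec.span {v}"

definition proj_space :: "('k::field ^ 'n) set set" where
  "proj_space = proj_point ` (- {0})"

definition proj_topology :: "('k::{field, topological_space} ^ 'n) set topology" where
  "proj_topology = quot_top (top_of_set (- {0})) proj_point"

lemma topspace_proj_topology: "topspace proj_topology = proj_space"
  by (simp add: proj_topology_def topspace_quot_top proj_space_def)

definition proj_subspace :: "('k::field ^ 'n) set \<Rightarrow> ('k ^ 'n) set set" where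
  "proj_subspace W = {p \<in> proj_space. p \<subseteq> W}"

definition proj_line :: "('k::field ^ 'n) set set \<Rightarrow> bool" where
  "proj_line L \<longleftrightarrow> (\<exists>W. vec.subspace W \<and> vec.dim W = 2 \<and> L = proj_subspace W)"

definition proj_hyperplane :: "('k::field ^ 'n) set set \<Rightarrow> bool" where
  "proj_hyperplane H \<longleftrightarrow>
     (\<exists>W. vec.subspace W \<and> Suc (vec.dim W) = CARD('n) \<and> H = proj_subspace W)"

section \<open>Convexity in real projective space\<close>

definition proj_convex :: "(real ^ 'n) set set \<Rightarrow> bool" where
  "proj_convex E \<longleftrightarrow> E \<subseteq> proj_space \<and>
     (\<forall>L. proj_line L \<longrightarrow> \<not> L \<subseteq> E \<and> connectedin proj_topology (E \<inter> L))"

definition properly_convex :: "(real ^ 'n) set set \<Rightarrow> bool" where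
  "properly_convex E \<longleftrightarrow> proj_convex E \<and>
     (\<forall>H. proj_hyperplane H \<longrightarrow> \<not> E \<subseteq> H) \<and>
     (\<forall>L. \<forall>p \<in> L. proj_line L \<longrightarrow> \<not> L - {p} \<subseteq> E)"

section \<open>Elliptic tubes\<close>

definition cvec :: "real ^ 'n \<Rightarrow> complex ^ 'n" where
  "cvec v = (\<chi> i. complex_of_real (v $ i))"

text \<open>For fixed distinct endpoints, replacing \<open>v\<^sub>1\<close> by \<open>- v\<^sub>1\<close> exchanges the two
  closed segments joining them; other real rescalings change nothing. The same rescalings
  leave the elliptic segment unchanged, so it depends only on the real segment.\<close>

definition closed_segment_proj :: "real ^ 'n \<Rightarrow> real ^ 'n \<Rightarrow> (real ^ 'n) set set" where
  "closed_segment_proj v0 v1 =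
     proj_point ` {w. w \<noteq> 0 \<and> (\<exists>c0 c1 :: real. c0 * c1 \<ge> 0 \<and> w = c0 *s v0 + c1 *s v1)}"

definition elliptic_segment :: "real ^ 'n \<Rightarrow> real ^ 'n \<Rightarrow> (complex ^ 'n) set set" where
  "elliptic_segment v0 v1 =
     proj_point ` {w. w \<noteq> 0 \<and>
       (\<exists>c0 c1 :: complex. Re (c0 * cnj c1) \<ge> 0 \<and> w = c0 *s cvec v0 + c1 *s cvec v1)}"

definition elliptic_tube :: "(real ^ 'n) set set \<Rightarrow> (complex ^ 'n) set set" where
  "elliptic_tube \<Omega> = \<Union> {elliptic_segment v0 v1 | v0 v1.
     v0 \<noteq> 0 \<and> v1 \<noteq> 0 \<and> proj_point v0 \<noteq> proj_point v1 \<and> closed_segment_proj v0 v1 \<subseteq> \<Omega>}"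

section \<open>The projective linear group and its action\<close>

definition GL :: "('k::field ^ 'n ^ 'n) monoid" where
  "GL = \<lparr>carrier = {A. invertible A}, mult = (**), one = mat 1\<rparr>"

definition scalars :: "('k::field ^ 'n ^ 'n) set" where
  "scalars = {mat c | c. c \<noteq> 0}"

definition PGL :: "('k::field ^ 'n ^ 'n) set monoid" where
  "PGL = GL Mod scalars"

lemma mat_mult_eq: "mat c ** A = (\<chi> i j. c * A $ i $ j)" for A :: "'k::field ^ 'n ^ 'n"
  by (simp add: vec_eq_iff matrix_matrix_mult_def mat_def if_distrib[of "\<lambda>x. x * _"] cong: if_cong)

lemma mult_mat_eq: "A ** mat c = (\<chi> i j. c * A $ i $ j)" for A :: "'k::field ^ 'n ^ 'n"
  by (simp add: vec_eq_iff matrix_matrix_mult_def mat_def if_distrib[of "\<lambda>x. _ * x"] mult.commute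
      cong: if_cong)

lemma mat_mult_mat: "mat c ** mat d = (mat (c * d) :: 'k::field ^ 'n ^ 'n)"
  by (simp add: mat_mult_eq) (simp add: vec_eq_iff mat_def)

lemma group_GL: "group (GL :: ('k::field ^ 'n ^ 'n) monoid)"
proof (rule groupI; unfold GL_def; simp)
  show "invertible (A ** B)" if "invertible A" "invertible B" for A B :: "'k ^ 'n ^ 'n"
    using that by (simp add: invertible_mult)
  show "invertible (mat 1 :: 'k ^ 'n ^ 'n)"
    unfolding invertible_def by (auto intro: exI[of _ "mat 1"])
  show "A ** B ** C = A ** (B ** C)" for A B C :: "'k ^ 'n ^ 'n"
    by (simp add: matrix_mul_assoc)
  show "\<exists>B. invertible B \<and> B ** A = mat 1" if "invertible A" for A :: "'k ^ 'n ^ 'n"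
    using that unfolding invertible_def by auto
qed

lemma normal_scalars: "scalars \<lhd> (GL :: ('k::field ^ 'n ^ 'n) monoid)"
proof -
  interpret group "GL :: ('k ^ 'n ^ 'n) monoid" by (rule group_GL)
  have inv: "invertible (mat c :: 'k ^ 'n ^ 'n)" if "c \<noteq> 0" for c
    unfolding invertible_def
    by (rule exI[of _ "mat (1 / c)"]) (use that in \<open>simp add: mat_mult_mat\<close>)
  have "subgroup scalars (GL :: ('k ^ 'n ^ 'n) monoid)"
  proof (rule subgroupI)
    show "scalars \<subseteq> carrier (GL :: ('k ^ 'n ^ 'n) monoid)"
      using inv by (auto simp: scalars_def GL_def)
    show "(scalars :: ('k ^ 'n ^ 'n) set) \<noteq> {}"
      by (auto simp: scalars_def intro: exI[of _ 1])
  next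
    fix A :: "'k ^ 'n ^ 'n" assume "A \<in> scalars"
    then obtain c where c: "c \<noteq> 0" "A = mat c" by (auto simp: scalars_def)
    have "inv\<^bsub>GL\<^esub> A = mat (1 / c)"
      by (rule inv_equality) (use c inv in \<open>auto simp: GL_def mat_mult_mat\<close>)
    with c show "inv\<^bsub>GL\<^esub> A \<in> scalars" by (auto simp: scalars_def intro!: exI[of _ "1 / c"])
  next
    fix A B :: "'k ^ 'n ^ 'n" assume "A \<in> scalars" "B \<in> scalars"
    then obtain c d where "c \<noteq> 0" "A = mat c" "d \<noteq> 0" "B = mat d" by (auto simp: scalars_def)
    then show "A \<otimes>\<^bsub>GL\<^esub> B \<in> scalars"
      by (auto simp: scalars_def GL_def mat_mult_mat intro!: exI[of _ "c * d"])
  qed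
  moreover have "normal_axioms scalars (GL :: ('k ^ 'n ^ 'n) monoid)"
    by (auto simp: normal_axioms_def r_coset_def l_coset_def GL_def scalars_def
        mat_mult_eq mult_mat_eq)
  ultimately show ?thesis
    by (simp add: normal_def group_GL)
qed

lemma group_PGL: "group (PGL :: ('k::field ^ 'n ^ 'n) set monoid)"
  unfolding PGL_def by (rule normal.factorgroup_is_group[OF normal_scalars])

text \<open>An element of \<open>PGL\<close> is a class of matrices, and all of them map a line through \<open>0\<close>
  to the same line, so the union below is the image under any representative.\<close>

definition pgl_act :: "('k::field ^ 'n ^ 'n) set \<Rightarrow> ('k ^ 'n) set \<Rightarrow> ('k ^ 'n) set" where
  "pgl_act g p = (\<Union>A\<in>g. (*v) A ` p)"

lemma pgl_act_class:
  "pgl_act (scalars #>\<^bsub>GL\<^esub> A) (proj_point v) = proj_point (A *v v)"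
proof -
  have s: "(mat c ** A) *v (d *s v) = (c * d) *s (A *v v)" for c d
    by (simp add: vec_eq_iff matrix_vector_mult_def mat_mult_eq sum_distrib_left mult_ac)
  show ?thesis
  proof
    show "pgl_act (scalars #>\<^bsub>GL\<^esub> A) (proj_point v) \<subseteq> proj_point (A *v v)"
      by (auto simp: pgl_act_def r_coset_def scalars_def GL_def proj_point_def
          vec.span_singleton s)
    show "proj_point (A *v v) \<subseteq> pgl_act (scalars #>\<^bsub>GL\<^esub> A) (proj_point v)"
    proof
      fix x assume "x \<in> proj_point (A *v v)"
      then obtain d where "x = d *s (A *v v)" by (auto simp: proj_point_def vec.span_singleton)
      then have "x = (mat 1 ** A) *v (d *s v)" by (simp add: s del: matrix_mul_lid)
      moreover have "mat 1 ** A \<in> scalars #>\<^bsub>GL\<^esub> A"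
        unfolding r_coset_def scalars_def GL_def by simp (metis matrix_mul_lid one_neq_zero)
      moreover have "d *s v \<in> proj_point v" by (auto simp: proj_point_def vec.span_singleton)
      ultimately show "x \<in> pgl_act (scalars #>\<^bsub>GL\<^esub> A) (proj_point v)"
        unfolding pgl_act_def by blast
    qed
  qed
qed

definition pgl_orbit :: "('k::field ^ 'n ^ 'n) set set \<Rightarrow> ('k ^ 'n) set \<Rightarrow> ('k ^ 'n) set set" where
  "pgl_orbit \<Gamma> p = (\<lambda>g. pgl_act g p) ` \<Gamma>"

definition acts_on :: "('k::field ^ 'n ^ 'n) set set \<Rightarrow> ('k ^ 'n) set set \<Rightarrow> bool" where
  "acts_on \<Gamma> X \<longleftrightarrow> (\<forall>g\<in>\<Gamma>. pgl_act g ` X = X)"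

definition acts_freely :: "('k::field ^ 'n ^ 'n) set set \<Rightarrow> ('k ^ 'n) set set \<Rightarrow> bool" where
  "acts_freely \<Gamma> X \<longleftrightarrow> (\<forall>g\<in>\<Gamma>. \<forall>p\<in>X. pgl_act g p = p \<longrightarrow> g = \<one>\<^bsub>PGL\<^esub>)"

definition acts_properly_discontinuously ::
    "('k::{field, topological_space} ^ 'n ^ 'n) set set \<Rightarrow> ('k ^ 'n) set set \<Rightarrow> bool" where
  "acts_properly_discontinuously \<Gamma> X \<longleftrightarrow>
     (\<forall>K. K \<subseteq> X \<and> compactin proj_topology K \<longrightarrow> finite {g \<in> \<Gamma>. pgl_act g ` K \<inter> K \<noteq> {}})"

text \<open>The inclusion of the real into the complex projective linear group.\<close>

definition pgl_complexify :: "(real ^ 'n ^ 'n) set \<Rightarrow> (complex ^ 'n ^ 'n) set" where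
  "pgl_complexify g = {mat c ** (\<chi> i. cvec (A $ i)) | c A. c \<noteq> 0 \<and> A \<in> g}"

section \<open>The complexification as a complex manifold\<close>

definition cx_orbit :: "(real ^ 'n ^ 'n) set set \<Rightarrow> (complex ^ 'n) set \<Rightarrow> (complex ^ 'n) set set" where
  "cx_orbit \<Gamma> = pgl_orbit (pgl_complexify ` \<Gamma>)"

definition complexification ::
    "(real ^ 'n) set set \<Rightarrow> (real ^ 'n ^ 'n) set set \<Rightarrow> (complex ^ 'n) set set set" where
  "complexification \<Omega> \<Gamma> = cx_orbit \<Gamma> ` elliptic_tube \<Omega>"

definition complexification_topology ::
    "(real ^ 'n) set set \<Rightarrow> (real ^ 'n ^ 'n) set set \<Rightarrow> (complex ^ 'n) set set topology" where
  "complexification_topology \<Omega> \<Gamma> =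
     quot_top (subtopology proj_topology (elliptic_tube \<Omega>)) (cx_orbit \<Gamma>)"

text \<open>The \<open>i\<close>-th affine chart takes values in the affine hyperplane where the \<open>i\<close>-th
  coordinate is \<open>1\<close>, a copy of complex affine \<open>n\<close>-space inside \<open>complex ^ 'n\<close>.\<close>

definition affine_domain :: "'n \<Rightarrow> (complex ^ 'n) set set" where
  "affine_domain i = {proj_point v | v. v $ i \<noteq> 0}"

definition affine_chart :: "'n \<Rightarrow> (complex ^ 'n) set \<Rightarrow> complex ^ 'n" where
  "affine_chart i p = (THE v. v \<in> p \<and> v $ i = 1)"

lemma affine_chart_proj_point:
  assumes "v $ i \<noteq> 0"
  shows "affine_chart i (proj_point v) = (\<chi> j. v $ j / v $ i)"
  unfolding affine_chart_def
proof (rule the_equality)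
  show "(\<chi> j. v $ j / v $ i) \<in> proj_point v \<and> (\<chi> j. v $ j / v $ i) $ i = 1"
    using assms by (auto simp: proj_point_def vec.span_singleton vec_eq_iff image_iff
        intro!: exI[of _ "1 / v $ i"])
  show "w = (\<chi> j. v $ j / v $ i)" if "w \<in> proj_point v \<and> w $ i = 1" for w
    using that assms by (auto simp: proj_point_def vec.span_singleton vec_eq_iff field_simps)
qed

text \<open>Charts of the quotient: affine charts composed with local inverses of the covering map.\<close>

definition complexification_atlas ::
    "(real ^ 'n) set set \<Rightarrow> (real ^ 'n ^ 'n) set set \<Rightarrow>
       ((complex ^ 'n) set set set \<times> ((complex ^ 'n) set set \<Rightarrow> complex ^ 'n)) set" where
  "complexification_atlas \<Omega> \<Gamma> =
     {(cx_orbit \<Gamma> ` V, affine_chart i \<circ> inv_into V (cx_orbit \<Gamma>)) | V i.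
        openin proj_topology V \<and> V \<subseteq> elliptic_tube \<Omega> \<inter> affine_domain i \<and>
        inj_on (cx_orbit \<Gamma>) V}"

section \<open>The Kobayashi pseudo-distance\<close>

text \<open>A complex manifold is given by a topology \<open>X\<close> and an atlas \<open>\<A>\<close> of pairs (domain, chart).\<close>

definition holomorphic_disc ::
    "'p topology \<Rightarrow> ('p set \<times> ('p \<Rightarrow> complex ^ 'n)) set \<Rightarrow> (complex \<Rightarrow> 'p) \<Rightarrow> bool" where
  "holomorphic_disc X \<A> f \<longleftrightarrow>
     continuous_map (top_of_set (ball 0 1)) X f \<and>
     (\<forall>(U, \<phi>) \<in> \<A>. \<forall>j. (\<lambda>z. \<phi> (f z) $ j) holomorphic_on {z \<in> ball 0 1. f z \<in> U})"

text \<open>Normalised to curvature \<open>-1\<close>.\<close>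

definition poincare_distance :: "complex \<Rightarrow> complex \<Rightarrow> real" where
  "poincare_distance a b = 2 * artanh (cmod ((a - b) / (1 - cnj a * b)))"

inductive kobayashi_chain ::
    "'p topology \<Rightarrow> ('p set \<times> ('p \<Rightarrow> complex ^ 'n)) set \<Rightarrow> 'p \<Rightarrow> 'p \<Rightarrow> real \<Rightarrow> bool"
  for X \<A> where
  trivial: "p \<in> topspace X \<Longrightarrow> kobayashi_chain X \<A> p p 0"
| extend: "\<lbrakk>kobayashi_chain X \<A> p (f a) l; holomorphic_disc X \<A> f; a \<in> ball 0 1; b \<in> ball 0 1\<rbrakk>
     \<Longrightarrow> kobayashi_chain X \<A> p (f b) (l + poincare_distance a b)"

text \<open>Points not joined by a chain of discs do not occur on a connected manifold, such as the
  complexification of a convex projective manifold. The value \<open>0\<close> for them only serves to make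
  the function total: it must be nonnegative also outside the manifold to meet the
  requirements of \<open>Metric_space\<close>, and on a disconnected manifold the
  resulting function is not a metric.\<close>

definition kobayashi_distance ::
    "'p topology \<Rightarrow> ('p set \<times> ('p \<Rightarrow> complex ^ 'n)) set \<Rightarrow> 'p \<Rightarrow> 'p \<Rightarrow> real" where
  "kobayashi_distance X \<A> p q =
     (if \<exists>l. kobayashi_chain X \<A> p q l then Inf {l. kobayashi_chain X \<A> p q l} else 0)"

end

theory Submission
  imports Defs "HOL-Complex_Analysis.Complex_Analysis"
begin

text \<open>
  Write \<open>\<Omega>\<close> as the image of a pointed open convex cone \<open>C\<close>. The elliptic tube is the image of
  \<open>C + \<i> C\<close> and, dually, of the set of all \<open>z\<close> such that \<open>f z / g z\<close> lies in the right half plane for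
  all \<open>f\<close> and \<open>g\<close> in the dual cone of \<open>C\<close>. By Harnack's inequality the real parts of these
  holomorphic functions (and of their composites with translations and inversion of the half plane)
  change at most by the factor \<open>exp l\<close> along a chain of discs of length \<open>l\<close>. This bounds the Kobayashi
  distance from below by an invariant distance on the tube whose bounded sets are relatively
  compact. Such compactness transfers proper discontinuity from \<open>\<Omega>\<close> to the tube, so the quotient is
  covered by the tube and discs in the quotient lift; hence bounded sets of the quotient are
  relatively compact for the Kobayashi distance as well.
\<close>

section \<open>Projective points\<close>

text \<open>The functional \<psi> vanishes nowhere on the tube, so the slice
  \<open>cdot \<psi> v = 1\<close> contains exactly one vector of each line of the tube. Lifts,
  limits and compactness are therefore treated for vectors on this slice instead of points of
  projective space.

  Two obstacles shape the argument. The group is assumed to act freely and properly discontinuously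
  only on \<Omega>, so statements about the tube must be traced back to real points: a complex fixed
  point has to yield a real one, and an orbit in the tube is compared with the orbit of a real base
  point at finite distance from it. Moreover the half plane functions exist only on the tube and do
  not descend to the quotient, so every estimate in the quotient is made along a lifted chain. It
  compares a chosen lift of the first point with some lift of the last one, which depends on the
  chain.\<close>

lemma proj_point_eq_range: "proj_point v = range (\<lambda>c. c *s v)"
  by (simp add: proj_point_def vec.span_singleton)

lemma proj_point_self: "v \<in> proj_point v"
  by (simp add: proj_point_def vec.span_base)

lemma proj_point_scale:
  assumes "c \<noteq> 0" shows "proj_point (c *s v) = proj_point v"
proof -
  have "x *s v \<in> range (\<lambda>d. d *s (c *s v))" for x
    using assms by (intro image_eqI[of _ _ "x / c"]) auto
  then show ?thesis by (auto simp: proj_point_eq_range)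
qed

lemma proj_point_eq_iff:
  assumes "w \<noteq> 0"
  shows "proj_point v = proj_point w \<longleftrightarrow> (\<exists>c. c \<noteq> 0 \<and> w = c *s v)"
proof
  assume "proj_point v = proj_point w"
  then have "w \<in> proj_point v" using proj_point_self by metis
  then obtain c where "w = c *s v" by (auto simp: proj_point_eq_range)
  with assms show "\<exists>c. c \<noteq> 0 \<and> w = c *s v" by (metis vec.scale_eq_0_iff)
qed (auto simp: proj_point_scale)

lemma openin_proj_topology:
  fixes U :: "('k::real_normed_field ^ 'n) set set"
  shows "openin proj_topology U \<longleftrightarrow> U \<subseteq> proj_space \<and> open {v. v \<noteq> 0 \<and> proj_point v \<in> U}"
proof -
  have "{x. x \<noteq> 0 \<and> proj_point x \<in> U} = {x \<in> - {0}. proj_point x \<in> U}" by auto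
  moreover have "open (- {0 :: 'k ^ 'n})" by (intro open_Compl closed_singleton)
  ultimately show ?thesis
    by (simp add: proj_topology_def openin_quot_top proj_space_def openin_open_eq Collect_mono_iff)
qed

text \<open>Invariance under scaling makes \<open>V\<close> a union of punctured lines, hence the
  full preimage of its image in the quotient.\<close>

lemma openin_proj_point_image:
  fixes V :: "('k::real_normed_field ^ 'n) set"
  assumes "open V" "0 \<notin> V" "\<And>c v. c \<noteq> 0 \<Longrightarrow> v \<in> V \<Longrightarrow> c *s v \<in> V"
  shows "openin proj_topology (proj_point ` V)"
proof -
  have "{v. v \<noteq> 0 \<and> proj_point v \<in> proj_point ` V} = V"
  proof (intro Set.set_eqI iffI)
    fix v assume "v \<in> {v. v \<noteq> 0 \<and> proj_point v \<in> proj_point ` V}"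
    then obtain w where w: "v \<noteq> 0" "w \<in> V" "proj_point w = proj_point v" by auto
    then obtain c where "c \<noteq> 0" "v = c *s w" using proj_point_eq_iff by metis
    then show "v \<in> V" using assms w by auto
  qed (use assms in auto)
  with assms show ?thesis
    by (auto simp: openin_proj_topology proj_space_def)
qed

section \<open>The cone over a properly convex set\<close>

text \<open>The punctured double cone over \<open>E\<close>. Over a nonempty open properly convex
  set it falls into two opposite convex cones.\<close>

definition lines_union :: "('k::field ^ 'n) set set \<Rightarrow> ('k ^ 'n) set" where
  "lines_union E = {v. v \<noteq> 0 \<and> proj_point v \<in> E}"

lemma lines_union_scale: "c \<noteq> 0 \<Longrightarrow> v \<in> lines_union E \<Longrightarrow> c *s v \<in> lines_union E"
  by (simp add: lines_union_def proj_point_scale)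

lemma lines_union_scaleR:
  fixes v :: "real ^ 'n"
  shows "c \<noteq> 0 \<Longrightarrow> v \<in> lines_union E \<Longrightarrow> c *\<^sub>R v \<in> lines_union E"
  using lines_union_scale by (metis scalar_mult_eq_scaleR)

lemma lines_union_minus:
  fixes v :: "real ^ 'n"
  shows "v \<in> lines_union E \<Longrightarrow> - v \<in> lines_union E"
  using lines_union_scaleR[of "-1" v] by simp

text \<open>Inverting the Gram matrix of \<open>v\<close> and \<open>w\<close> gives the dual basis
  of the plane they span; \<open>D\<close> is the Gram determinant.\<close>

lemma dual_functionals:
  fixes v w :: "'a::real_inner"
  assumes "v \<noteq> 0" and indep: "\<And>c. w \<noteq> c *\<^sub>R v"
  obtains a b where "a \<bullet> v = 1" "a \<bullet> w = 0" "b \<bullet> v = 0" "b \<bullet> w = 1"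
proof -
  define D where "D = (v \<bullet> v) * (w \<bullet> w) - (v \<bullet> w)^2"
  \<comment> \<open>\<open>D / (v \<bullet> v)\<close> is the squared length of the part of
    \<open>w\<close> orthogonal to \<open>v\<close>, which independence makes nonzero.\<close>
  have "w - ((v \<bullet> w) / (v \<bullet> v)) *\<^sub>R v \<noteq> 0" using indep by auto
  then have "0 < (w - ((v \<bullet> w) / (v \<bullet> v)) *\<^sub>R v) \<bullet> (w - ((v \<bullet> w) / (v \<bullet> v)) *\<^sub>R v)"
    by simp
  also have "\<dots> = D / (v \<bullet> v)"
    using assms(1) by (simp add: D_def inner_diff_left inner_diff_right inner_commute field_simps power2_eq_square)
  finally have D: "D > 0" using inner_ge_zero[of v] by (auto simp: zero_less_divide_iff simp del: inner_ge_zero)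
  show ?thesis
  proof
    show "((1/D) *\<^sub>R ((w \<bullet> w) *\<^sub>R v - (v \<bullet> w) *\<^sub>R w)) \<bullet> v = 1"
      "((1/D) *\<^sub>R ((v \<bullet> v) *\<^sub>R w - (v \<bullet> w) *\<^sub>R v)) \<bullet> w = 1"
      using D by (simp_all add: D_def inner_diff_left inner_diff_right inner_commute power2_eq_square flip: diff_divide_distrib)
    show "((1/D) *\<^sub>R ((w \<bullet> w) *\<^sub>R v - (v \<bullet> w) *\<^sub>R w)) \<bullet> w = 0"
      "((1/D) *\<^sub>R ((v \<bullet> v) *\<^sub>R w - (v \<bullet> w) *\<^sub>R v)) \<bullet> v = 0"
      by (simp_all add: D_def inner_diff_right inner_diff_left inner_commute)
  qed
qed

lemma proj_line_span:
  fixes v w :: "real ^ 'n"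
  assumes "v \<noteq> 0" and indep: "\<And>c. w \<noteq> c *\<^sub>R v"
  shows "proj_line (proj_subspace (span {w, v}))"
proof -
  have "w \<notin> span {v}" using indep by (auto simp: span_singleton)
  then have "independent {w, v}" using assms(1) by (intro independent_insertI) (auto simp: independent_empty)
  moreover have "w \<noteq> v" using indep[of 1] by auto
  ultimately have "dim (span {w, v}) = 2" by (simp add: dim_eq_card_independent)
  then show ?thesis
    unfolding proj_line_def by (metis dim_vec_eq subspace_span subspace_vec_eq)
qed

lemma proj_subspace_span:
  fixes v w :: "real ^ 'n"
  assumes "p \<in> proj_subspace (span {w, v})"
  obtains x y where "x *\<^sub>R v + y *\<^sub>R w \<noteq> 0" "p = proj_point (x *\<^sub>R v + y *\<^sub>R w)"
proof -
  from assms obtain u where u: "u \<noteq> 0" "p = proj_point u" "proj_point u \<subseteq> span {w, v}"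
    by (auto simp: proj_subspace_def proj_space_def)
  then have "u \<in> span {w, v}" using proj_point_self by blast
  then obtain y x where "u = y *\<^sub>R w + x *\<^sub>R v"
    by (auto simp: span_insert span_singleton algebra_simps)
  with u that[of x y] show ?thesis by (simp add: add.commute)
qed

lemma proj_point_in_subspace_span:
  fixes v w :: "real ^ 'n"
  assumes "x *\<^sub>R v + y *\<^sub>R w \<noteq> 0"
  shows "proj_point (x *\<^sub>R v + y *\<^sub>R w) \<in> proj_subspace (span {w, v})"
proof -
  have "x *\<^sub>R v + y *\<^sub>R w \<in> span {w, v}"
    by (intro span_add span_mul span_base) auto
  then show ?thesis
    using assms unfolding proj_subspace_def
    by (auto simp: proj_space_def proj_point_eq_range scalar_mult_eq_scaleR intro: span_mul)
qed

lemma lines_union_plane: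
  fixes v w :: "real ^ 'n"
  assumes s1: "closed_segment v w \<subseteq> lines_union E" and xy: "x * y \<ge> 0" "x \<noteq> 0 \<or> y \<noteq> 0"
  shows "x *\<^sub>R v + y *\<^sub>R w \<in> lines_union E"
proof -
  have s: "x + y \<noteq> 0" using xy by (auto simp: zero_le_mult_iff)
  have "x / (x + y) \<ge> 0" "y / (x + y) \<ge> 0" "x / (x + y) = 1 - y / (x + y)"
    using xy s by (auto simp: zero_le_mult_iff zero_le_divide_iff field_simps)
  then have "(x / (x + y)) *\<^sub>R v + (y / (x + y)) *\<^sub>R w \<in> lines_union E"
    using s1 by (intro subsetD[OF s1]) (auto simp: in_segment intro!: exI[of _ "y / (x + y)"])
  then have "(x + y) *\<^sub>R ((x / (x + y)) *\<^sub>R v + (y / (x + y)) *\<^sub>R w) \<in> lines_union E"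
    using s by (intro lines_union_scaleR)
  then show ?thesis using s by (simp add: scaleR_right_distrib)
qed

text \<open>The segments from \<open>v\<close> to \<open>w\<close> and from \<open>v\<close> to
  \<open>- w\<close> lift the two projective segments with the same endpoints. Both inside
  \<open>E\<close> would give a whole projective line; neither inside would let two missing points
  disconnect \<open>E\<close> on that line. The sign chosen in this way is the origin of the cone
  \<open>C\<close>. If \<open>w\<close> is a multiple of \<open>v\<close>, the segment runs through
  \<open>0\<close> exactly for a negative factor.\<close>

lemma closed_segment_lines_union_iff:
  fixes v w :: "real ^ 'n"
  assumes E: "proj_convex E" and v: "v \<in> lines_union E" and w: "w \<in> lines_union E"
  shows "closed_segment v (- w) \<subseteq> lines_union E \<longleftrightarrow> \<not> closed_segment v w \<subseteq> lines_union E"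
proof (cases "\<exists>c. w = c *\<^sub>R v")
  case True
  then obtain c where c: "w = c *\<^sub>R v" by auto
  have nz: "v \<noteq> 0" "c \<noteq> 0" using v w c by (auto simp: lines_union_def)
  have pos: "closed_segment v (a *\<^sub>R v) \<subseteq> lines_union E" if "a > 0" for a
  proof
    fix x assume "x \<in> closed_segment v (a *\<^sub>R v)"
    then obtain t where t: "0 \<le> t" "t \<le> 1" "x = ((1 - t) + t * a) *\<^sub>R v"
      by (auto simp: closed_segment_def algebra_simps)
    have "(1 - t) + t * a > 0" using t that
      by (cases "t = 0") (auto intro!: add_nonneg_pos)
    then show "x \<in> lines_union E" unfolding t(3) using v by (intro lines_union_scaleR) auto
  qed
  have neg: "\<not> closed_segment v (a *\<^sub>R v) \<subseteq> lines_union E" if "a < 0" for a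
  proof -
    have "1 - 1 / (1 - a) + a / (1 - a) = 0" using that by (simp add: field_simps)
    then have "(1 - 1 / (1 - a)) *\<^sub>R v + (1 / (1 - a)) *\<^sub>R a *\<^sub>R v = 0"
      by (metis (no_types, lifting) scaleR_left.add scaleR_scaleR scaleR_zero_left times_divide_eq_left mult_1)
    then have "0 \<in> closed_segment v (a *\<^sub>R v)"
      unfolding closed_segment_def using that by (force simp: field_simps intro!: exI[of _ "1 / (1 - a)"])
    then show ?thesis by (auto simp: lines_union_def)
  qed
  have "- w = (- c) *\<^sub>R v" using c by simp
  then show ?thesis using pos[of c] pos[of "-c"] neg[of c] neg[of "-c"] c nz
    by (cases "c > 0") auto
next
  case False
  then have ind: "w \<noteq> c *\<^sub>R v" for c by auto
  have v0: "v \<noteq> 0" using v by (auto simp: lines_union_def)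
  define L where "L = proj_subspace (span {w, v})"
  have L: "proj_line L" unfolding L_def using proj_line_span[OF v0 ind] by simp
  have notboth: False
    if a1: "closed_segment v w \<subseteq> lines_union E" and a2: "closed_segment v (- w) \<subseteq> lines_union E"
  proof -
    have "L \<subseteq> E"
    proof
      fix p assume "p \<in> L"
      then obtain x y where xy: "x *\<^sub>R v + y *\<^sub>R w \<noteq> 0" "p = proj_point (x *\<^sub>R v + y *\<^sub>R w)"
        unfolding L_def using proj_subspace_span by metis
      then have nz: "x \<noteq> 0 \<or> y \<noteq> 0" by auto
      have "x *\<^sub>R v + y *\<^sub>R w \<in> lines_union E"
      proof (cases "x * y \<ge> 0")
        case True then show ?thesis using lines_union_plane[OF a1] nz by auto
      next
        case False
        then show ?thesis using lines_union_plane[OF a2, of x "-y"] nz by auto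
      qed
      then show "p \<in> E" using xy by (simp add: lines_union_def)
    qed
    with E L show False by (auto simp: proj_convex_def)
  qed
  have one: False
    if a1: "\<not> closed_segment v w \<subseteq> lines_union E" and a2: "\<not> closed_segment v (- w) \<subseteq> lines_union E"
  proof -
    obtain a where a: "0 \<le> a" "a \<le> 1" "(1 - a) *\<^sub>R v + a *\<^sub>R w \<notin> lines_union E"
      using a1 by (auto simp: closed_segment_def)
    obtain b where b: "0 \<le> b" "b \<le> 1" "(1 - b) *\<^sub>R v - b *\<^sub>R w \<notin> lines_union E"
      using a2 by (auto simp: closed_segment_def)
    have "a \<noteq> 0" "a \<noteq> 1" using a v w by auto
    then have a': "a > 0" "a < 1" using a by auto
    have "b \<noteq> 0" "b \<noteq> 1" using b v lines_union_minus[OF w] by auto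
    then have b': "b > 0" "b < 1" using b by auto
    obtain f g where fg: "f \<bullet> v = 1" "f \<bullet> w = 0" "g \<bullet> v = 0" "g \<bullet> w = 1"
      using dual_functionals[OF v0 ind] by blast
    \<comment> \<open>A product of two linear forms that vanish at the missing points
      \<open>(1 - a) v + a w\<close> and \<open>(1 - b) v - b w\<close>. Being quadratic it has a
      well-defined sign on projective points, positive at \<open>v\<close> and negative at
      \<open>w\<close>.\<close>
    define h where "h u = (a * (f \<bullet> u) - (1 - a) * (g \<bullet> u)) * (b * (f \<bullet> u) + (1 - b) * (g \<bullet> u))" for u
    have hc: "h (c *s u) = c^2 * h u" for c u
      by (simp add: h_def scalar_mult_eq_scaleR power2_eq_square algebra_simps)
    have conth: "continuous_on UNIV h" unfolding h_def by (intro continuous_intros)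
    define U1 U2 where "U1 = proj_point ` {u. h u > 0}" and "U2 = proj_point ` {u. h u < 0}"
    have "openin proj_topology U1" unfolding U1_def
      by (rule openin_proj_point_image) (auto simp: hc intro!: open_Collect_less conth, simp add: h_def)
    moreover have "openin proj_topology U2" unfolding U2_def
      by (rule openin_proj_point_image) (auto simp: hc intro!: open_Collect_less conth mult_pos_neg, simp add: h_def)
    moreover have "E \<inter> L \<subseteq> U1 \<union> U2"
    proof
      fix p assume p: "p \<in> E \<inter> L"
      then obtain x y where xy: "x *\<^sub>R v + y *\<^sub>R w \<noteq> 0" "p = proj_point (x *\<^sub>R v + y *\<^sub>R w)"
        unfolding L_def using proj_subspace_span by (metis Int_iff)
      then have in_E: "x *\<^sub>R v + y *\<^sub>R w \<in> lines_union E" using p by (simp add: lines_union_def)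
      have h: "h (x *\<^sub>R v + y *\<^sub>R w) = (a * x - (1 - a) * y) * (b * x + (1 - b) * y)"
        by (simp add: h_def inner_add_right fg)
      have "a * x - (1 - a) * y \<noteq> 0"
      proof
        assume *: "a * x - (1 - a) * y = 0"
        then have y: "y = a * (x + y)" and x: "x = (1 - a) * (x + y)" by (auto simp: algebra_simps)
        have "x + y \<noteq> 0" using x y xy by auto
        moreover have "x *\<^sub>R v + y *\<^sub>R w = ((1 - a) * (x + y)) *\<^sub>R v + (a * (x + y)) *\<^sub>R w"
          using x y by simp
        then have "x *\<^sub>R v + y *\<^sub>R w = (x + y) *\<^sub>R ((1 - a) *\<^sub>R v + a *\<^sub>R w)"
          by (simp add: scaleR_right_distrib mult.commute)
        ultimately show False using a in_E lines_union_scaleR[of "1 / (x + y)" "x *\<^sub>R v + y *\<^sub>R w" E] by auto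
      qed
      moreover have "b * x + (1 - b) * y \<noteq> 0"
      proof
        assume *: "b * x + (1 - b) * y = 0"
        then have y: "- y = b * (x - y)" and x: "x = (1 - b) * (x - y)" by (auto simp: algebra_simps)
        have "x - y \<noteq> 0" using x y xy by auto
        moreover have "x *\<^sub>R v + y *\<^sub>R w = x *\<^sub>R v - (- y) *\<^sub>R w" by simp
        then have "x *\<^sub>R v + y *\<^sub>R w = ((1 - b) * (x - y)) *\<^sub>R v - (b * (x - y)) *\<^sub>R w"
          using x y by simp
        then have "x *\<^sub>R v + y *\<^sub>R w = (x - y) *\<^sub>R ((1 - b) *\<^sub>R v - b *\<^sub>R w)"
          by (simp add: scaleR_right_diff_distrib mult.commute)
        ultimately show False using b in_E lines_union_scaleR[of "1 / (x - y)" "x *\<^sub>R v + y *\<^sub>R w" E] by auto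
      qed
      ultimately have "h (x *\<^sub>R v + y *\<^sub>R w) \<noteq> 0" using h by simp
      then show "p \<in> U1 \<union> U2" unfolding U1_def U2_def using xy by (auto simp: neq_iff)
    qed
    moreover have "U1 \<inter> U2 \<inter> (E \<inter> L) = {}"
    proof -
      have False if "h u > 0" "h u' < 0" and eq: "proj_point u = proj_point u'" for u u'
      proof -
        have u': "u' \<noteq> 0" using that by (auto simp: h_def)
        obtain c where "u' = c *s u" using eq u' proj_point_eq_iff[of u' u] by metis
        then have "h u' = c^2 * h u" using hc by metis
        moreover have "c^2 * h u \<ge> 0" using that by simp
        ultimately show False using that by linarith
      qed
      then show ?thesis unfolding U1_def U2_def by blast
    qed
    moreover have "proj_point v \<in> U1 \<inter> (E \<inter> L)"
    proof -
      have "proj_point (1 *\<^sub>R v + 0 *\<^sub>R w) \<in> L" unfolding L_def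
        by (rule proj_point_in_subspace_span) (use v0 in auto)
      then show ?thesis using v a' b' by (auto simp: U1_def h_def fg lines_union_def)
    qed
    moreover have "proj_point w \<in> U2 \<inter> (E \<inter> L)"
    proof -
      have "proj_point (0 *\<^sub>R v + 1 *\<^sub>R w) \<in> L" unfolding L_def
        by (rule proj_point_in_subspace_span) (use w in \<open>auto simp: lines_union_def\<close>)
      then show ?thesis using w a' b' by (auto simp: U2_def h_def fg lines_union_def mult_neg_pos)
    qed
    ultimately have "\<not> connectedin proj_topology (E \<inter> L)"
      unfolding connectedin by (metis (no_types, lifting) Int_iff Int_commute empty_iff)
    with E L show False by (auto simp: proj_convex_def)
  qed
  from notboth one show ?thesis by blast
qed

text \<open>\<open>R\<close> compares the signs of representatives. By the dichotomy for
  \<open>w\<close> and \<open>- w\<close> it is an equivalence relation on the double cone, negation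
  exchanges its two classes, and \<open>C\<close> is the class of \<open>v0\<close>. The absence of
  affine lines in \<open>E\<close> is what makes the closure of \<open>C\<close> pointed.\<close>

lemma lines_union_cone:
  fixes E :: "(real ^ 'n) set set"
  assumes E: "properly_convex E" and opn: "openin proj_topology E" and v0: "v0 \<in> lines_union E"
  obtains C where "open C" "convex C" "v0 \<in> C" "\<And>c x. c > 0 \<Longrightarrow> x \<in> C \<Longrightarrow> c *\<^sub>R x \<in> C"
    "lines_union E = C \<union> uminus ` C" "\<And>u. u \<in> closure C \<Longrightarrow> - u \<in> closure C \<Longrightarrow> u = 0"
proof -
  have pE: "proj_convex E" using E by (simp add: properly_convex_def)
  have opO: "open (lines_union E)" using opn by (simp add: openin_proj_topology lines_union_def)
  note dich = closed_segment_lines_union_iff[OF pE]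
  define R where "R v w \<longleftrightarrow> closed_segment v w \<subseteq> lines_union E" for v w
  have R_in: "v \<in> lines_union E" "w \<in> lines_union E" if "R v w" for v w
    using that by (auto simp: R_def)
  have R_sym: "R v w \<Longrightarrow> R w v" for v w by (simp add: R_def closed_segment_commute)
  have R_open: "open {p. R p u}" for u
  proof (rule openI)
    fix p assume "p \<in> {p. R p u}"
    then have "closed_segment p u \<subseteq> lines_union E" by (simp add: R_def)
    then obtain e where e: "e > 0" "(\<Union>x\<in>closed_segment p u. ball x e) \<subseteq> lines_union E"
      using compact_subset_open_imp_ball_epsilon_subset[OF compact_segment opO] by metis
    have "R q u" if q: "q \<in> ball p e" for q
      unfolding R_def
    proof
      fix x assume "x \<in> closed_segment q u"
      then obtain t where t: "0 \<le> t" "t \<le> 1" "x = (1 - t) *\<^sub>R q + t *\<^sub>R u"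
        by (auto simp: closed_segment_def)
      define y where "y = (1 - t) *\<^sub>R p + t *\<^sub>R u"
      have "y \<in> closed_segment p u" using t by (auto simp: closed_segment_def y_def)
      moreover have "dist y x \<le> dist p q"
      proof -
        have "y - x = (1 - t) *\<^sub>R (p - q)" by (simp add: y_def t algebra_simps)
        then show ?thesis using t by (simp add: dist_norm mult_left_le_one_le)
      qed
      ultimately show "x \<in> lines_union E" using e q by fastforce
    qed
    then show "\<exists>e>0. ball p e \<subseteq> {p. R p u}" using e by auto
  qed
  \<comment> \<open>On the segment from \<open>v\<close> to \<open>w\<close> the points related to
    \<open>u\<close> and those related to \<open>- u\<close> form two relatively open sets that
    partition it; connectedness leaves only one of them.\<close>
  have R_trans: "R v u" if vw: "R v w" and wu: "R w u" for v w u
  proof (rule ccontr)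
    assume n: "\<not> R v u"
    define S where "S = closed_segment v w"
    have inO: "p \<in> lines_union E" if "p \<in> S" for p using vw that by (auto simp: R_def S_def)
    have u: "u \<in> lines_union E" using R_in wu by blast
    have ii: "R p (- u) \<longleftrightarrow> \<not> R p u" if "p \<in> S" for p
      using dich[OF inO[OF that] u] by (simp add: R_def)
    have "connected S" by (simp add: S_def)
    moreover have "S \<subseteq> {p. R p u} \<union> {p. R p (- u)}" "{p. R p u} \<inter> {p. R p (- u)} \<inter> S = {}"
      using ii by auto
    moreover have "w \<in> {p. R p u} \<inter> S" "v \<in> {p. R p (- u)} \<inter> S"
      using ii[of v] n wu by (auto simp: S_def)
    ultimately show False using connectedD[OF _ R_open R_open, of S u "- u"] by blast
  qed
  define C where "C = {v. R v v0}"
  have Rv0: "R v0 v0" using v0 by (simp add: R_def)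
  have opC: "open C" using R_open by (simp add: C_def)
  have convC: "convex C"
    unfolding convex_contains_segment
  proof (intro ballI subsetI)
    fix a b p assume a: "a \<in> C" and b: "b \<in> C" and p: "p \<in> closed_segment a b"
    have "R a b" using R_trans[of a v0 b] a b R_sym by (simp add: C_def)
    then have "R p a" using p unfolding R_def
      by (metis ends_in_segment(1) subset_closed_segment subset_trans)
    then show "p \<in> C" using a R_trans[of p a v0] by (simp add: C_def)
  qed
  have coneC: "c *\<^sub>R x \<in> C" if c: "c > 0" and x: "x \<in> C" for c x
  proof -
    have s: "closed_segment x x \<subseteq> lines_union E" using x R_in by (auto simp: C_def)
    have "R (c *\<^sub>R x) x" unfolding R_def
    proof
      fix y assume "y \<in> closed_segment (c *\<^sub>R x) x"
      then obtain t where t: "0 \<le> t" "t \<le> 1" "y = ((1 - t) * c) *\<^sub>R x + t *\<^sub>R x"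
        by (auto simp: closed_segment_def)
      show "y \<in> lines_union E" unfolding t using c t
        by (intro lines_union_plane[OF s]) auto
    qed
    then show ?thesis using x R_trans[of _ x v0] by (simp add: C_def)
  qed
  have un: "lines_union E = C \<union> uminus ` C"
  proof (intro Set.set_eqI iffI)
    fix x assume x: "x \<in> lines_union E"
    have "R v0 x \<or> R v0 (- x)" using dich[OF v0 x] by (auto simp: R_def)
    then have "x \<in> C \<or> - x \<in> C" using R_sym unfolding C_def by blast
    then show "x \<in> C \<union> uminus ` C" by (metis UnCI imageI minus_minus)
  next
    fix x assume "x \<in> C \<union> uminus ` C"
    then show "x \<in> lines_union E" using R_in(1)[of _ v0] lines_union_minus[of _ E] unfolding C_def by blast
  qed
  have zC: "0 \<notin> C" using R_in by (auto simp: C_def lines_union_def)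
  have pointed: "u = 0" if u: "u \<in> closure C" "- u \<in> closure C" for u
  proof (rule ccontr)
    assume u0: "u \<noteq> 0"
    \<comment> \<open>The error made in replacing \<open>x\<close> by a nearby point of
      \<open>C\<close> is absorbed by a ball around \<open>y\<close>.\<close>
    have add: "x + y \<in> C" if x: "x \<in> closure C" and y: "y \<in> C" for x y
    proof -
      obtain e where e: "e > 0" "ball y e \<subseteq> C" using opC y open_contains_ball by blast
      obtain x' where x': "x' \<in> C" "dist x' x < e" using x e closure_approachable by blast
      have "y + (x - x') \<in> ball y e" using x' by (simp add: dist_norm)
      then have "y + (x - x') \<in> C" using e by blast
      then have "(1/2) *\<^sub>R x' + (1/2) *\<^sub>R (y + (x - x')) \<in> C" using x' convC by (intro convexD) auto
      then have "2 *\<^sub>R ((1/2) *\<^sub>R x' + (1/2) *\<^sub>R (y + (x - x'))) \<in> C" by (intro coneC) auto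
      then show ?thesis by (simp add: scaleR_right_distrib add.commute)
    qed
    have clc: "c *\<^sub>R x \<in> closure C" if "c > 0" "x \<in> closure C" for c x
    proof -
      have "(*\<^sub>R) c ` C \<subseteq> C" using coneC that by auto
      then have "(*\<^sub>R) c ` closure C \<subseteq> closure C" by (metis closure_mono closure_scaleR)
      then show ?thesis using that by auto
    qed
    have line: "v0 + t *\<^sub>R u \<in> C" for t
    proof -
      consider "t > 0" | "t < 0" | "t = 0" by linarith
      then show ?thesis
      proof cases
        case 1 then show ?thesis using add[of "t *\<^sub>R u" v0] clc[OF _ u(1)] Rv0 by (auto simp: C_def add.commute)
      next
        case 2 then show ?thesis using add[of "(-t) *\<^sub>R (- u)" v0] clc[of "-t", OF _ u(2)] Rv0 by (auto simp: C_def add.commute)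
      next
        case 3 then show ?thesis using Rv0 by (auto simp: C_def)
      qed
    qed
    have ind: "v0 \<noteq> c *\<^sub>R u" for c using line[of "- c"] zC by auto
    define L where "L = proj_subspace (span {v0, u})"
    have L: "proj_line L" unfolding L_def using proj_line_span[OF u0 ind] by simp
    have uL: "proj_point u \<in> L"
      unfolding L_def using proj_point_in_subspace_span[of 1 u 0 v0] u0 by simp
    \<comment> \<open>Each point of \<open>L\<close> other than that of \<open>u\<close> has a
      representative \<open>v0 + t u\<close>, and all of these lie in \<open>C\<close>.\<close>
    have "L - {proj_point u} \<subseteq> E"
    proof
      fix p assume p: "p \<in> L - {proj_point u}"
      then obtain x y where xy: "x *\<^sub>R u + y *\<^sub>R v0 \<noteq> 0" "p = proj_point (x *\<^sub>R u + y *\<^sub>R v0)"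
        unfolding L_def using proj_subspace_span by (metis DiffD1)
      have "y \<noteq> 0"
      proof
        assume "y = 0"
        then have "x \<noteq> 0" "p = proj_point (x *s u)" using xy by (auto simp: scalar_mult_eq_scaleR)
        then show False using p by (auto simp: proj_point_scale)
      qed
      then have "x *\<^sub>R u + y *\<^sub>R v0 = y *\<^sub>R (v0 + (x / y) *\<^sub>R u)"
        by (simp add: scaleR_right_distrib add.commute)
      then have "x *\<^sub>R u + y *\<^sub>R v0 \<in> lines_union E"
        using line[of "x / y"] un lines_union_scaleR[of y "v0 + (x / y) *\<^sub>R u" E] \<open>y \<noteq> 0\<close> by simp
      then show "p \<in> E" using xy by (simp add: lines_union_def)
    qed
    then show False using E L uL by (auto simp: properly_convex_def)
  qed
  show ?thesis
    using that[OF opC convC _ coneC un pointed] Rv0 by (auto simp: C_def)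
qed

section \<open>Real functionals on complex vectors\<close>

text \<open>The complex linear extension of the real functional given by the inner product with
  \<open>f\<close>.\<close>

definition cdot :: "real ^ 'n \<Rightarrow> complex ^ 'n \<Rightarrow> complex" where
  "cdot f z = (\<Sum>i\<in>UNIV. complex_of_real (f $ i) * z $ i)"

definition re_vec :: "complex ^ 'n \<Rightarrow> real ^ 'n" where "re_vec z = (\<chi> i. Re (z $ i))"

definition im_vec :: "complex ^ 'n \<Rightarrow> real ^ 'n" where "im_vec z = (\<chi> i. Im (z $ i))"

lemma cdot_add_left: "cdot (f + g) z = cdot f z + cdot g z"
  by (simp add: cdot_def algebra_simps sum.distrib)

lemma cdot_scale: "cdot f (c *s z) = c * cdot f z"
  by (simp add: cdot_def sum_distrib_left mult_ac)

lemma cdot_scale_left: "cdot (c *\<^sub>R f) z = of_real c * cdot f z"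
  by (simp add: cdot_def sum_distrib_left mult_ac)

lemma cdot_minus_left: "cdot (- f) z = - cdot f z"
  by (simp add: cdot_def sum_negf)

lemma cdot_cvec: "cdot f (cvec x) = of_real (f \<bullet> x)"
  by (simp add: cdot_def cvec_def inner_vec_def)

lemma cdot_zero [simp]: "cdot f 0 = 0"
  by (simp add: cdot_def)

lemma cdot_axis: "cdot (axis i 1) z = z $ i"
  by (simp add: cdot_def axis_def if_distrib[of "\<lambda>x. of_real x * _"] cong: if_cong)

lemma Re_cdot: "Re (cdot f z) = f \<bullet> re_vec z"
  by (simp add: cdot_def inner_vec_def re_vec_def)

lemma Im_cdot: "Im (cdot f z) = f \<bullet> im_vec z"
  by (simp add: cdot_def inner_vec_def im_vec_def)

lemma cvec_re_im: "cvec (re_vec z) + \<i> *s cvec (im_vec z) = z"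
  by (simp add: vec_eq_iff cvec_def re_vec_def im_vec_def complex_eq_iff)

lemma re_vec_cvec [simp]: "re_vec (cvec x) = x" and im_vec_cvec [simp]: "im_vec (cvec x) = 0"
  by (simp_all add: vec_eq_iff cvec_def re_vec_def im_vec_def)

lemma re_vec_i [simp]: "re_vec (cvec x + \<i> *s cvec y) = x" and im_vec_i [simp]: "im_vec (cvec x + \<i> *s cvec y) = y"
  by (simp_all add: vec_eq_iff cvec_def re_vec_def im_vec_def)

lemma cvec_eq_0_iff [simp]: "cvec x = 0 \<longleftrightarrow> x = 0"
  by (simp add: vec_eq_iff cvec_def)

lemma cvec_add: "cvec (x + y) = cvec x + cvec y"
  by (simp add: vec_eq_iff cvec_def)

lemma cvec_minus: "cvec (- x) = - cvec x"
  by (simp add: vec_eq_iff cvec_def)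

lemma cvec_scale: "cvec (c *\<^sub>R x) = of_real c *s cvec x"
  by (simp add: vec_eq_iff cvec_def)

lemma continuous_on_cdot [continuous_intros]:
  "continuous_on S g \<Longrightarrow> continuous_on S (\<lambda>x. cdot f (g x))"
  unfolding cdot_def by (intro continuous_intros)

lemma continuous_on_smult [continuous_intros]:
  fixes g :: "'a::topological_space \<Rightarrow> complex ^ 'n"
  shows "continuous_on S c \<Longrightarrow> continuous_on S g \<Longrightarrow> continuous_on S (\<lambda>x. c x *s g x)"
  unfolding vector_scalar_mult_def by (intro continuous_intros)

lemma continuous_on_re_vec [continuous_intros]:
  "continuous_on S g \<Longrightarrow> continuous_on S (\<lambda>x. re_vec (g x))"
  unfolding re_vec_def by (intro continuous_intros)

lemma continuous_on_im_vec [continuous_intros]: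
  "continuous_on S g \<Longrightarrow> continuous_on S (\<lambda>x. im_vec (g x))"
  unfolding im_vec_def by (intro continuous_intros)

lemma continuous_on_cvec [continuous_intros]:
  "continuous_on S g \<Longrightarrow> continuous_on S (\<lambda>x. cvec (g x))"
  unfolding cvec_def by (intro continuous_intros)

lemma holomorphic_on_cdot [holomorphic_intros]:
  fixes F :: "complex \<Rightarrow> complex ^ 'n"
  assumes "\<And>j. (\<lambda>z. F z $ j) holomorphic_on S" shows "(\<lambda>z. cdot f (F z)) holomorphic_on S"
  unfolding cdot_def using assms by (intro holomorphic_intros)

text \<open>Has the sign of the real part of \<open>cdot f z / cdot g z\<close>, but is polynomial
  in real and imaginary parts and has no denominator.\<close>

definition cone_pair :: "real ^ 'n \<Rightarrow> real ^ 'n \<Rightarrow> complex ^ 'n \<Rightarrow> real" where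
  "cone_pair f g z = Re (cdot f z * cnj (cdot g z))"

lemma cone_pair_eq: "cone_pair f g z = (f \<bullet> re_vec z) * (g \<bullet> re_vec z) + (f \<bullet> im_vec z) * (g \<bullet> im_vec z)"
  by (simp add: cone_pair_def Re_cdot Im_cdot)

lemma cone_pair_scale: "cone_pair f g (c *s z) = (cmod c)^2 * cone_pair f g z"
proof -
  have "cone_pair f g (c *s z) = Re ((c * cnj c) * (cdot f z * cnj (cdot g z)))"
    by (simp only: cone_pair_def cdot_scale complex_cnj_mult mult_ac)
  also have "\<dots> = (cmod c)^2 * cone_pair f g z"
    by (simp add: complex_norm_square[symmetric] cone_pair_def del: of_real_power)
  finally show ?thesis .
qed

section \<open>Proper cones and their tubes\<close>

locale proper_cone =
  fixes C :: "(real ^ 'n) set"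
  assumes open_C: "open C" and convex_C: "convex C" and nonempty_C: "C \<noteq> {}"
    and cone_C: "\<And>c x. c > 0 \<Longrightarrow> x \<in> C \<Longrightarrow> c *\<^sub>R x \<in> C"
    and pointed_C: "\<And>u. u \<in> closure C \<Longrightarrow> - u \<in> closure C \<Longrightarrow> u = 0"
begin

text \<open>The weak inequality makes the unit vectors of \<open>dual\<close> a compact set; on the
  open cone \<open>C\<close> it is automatically strict by \<open>dual_pos\<close>.\<close>

definition dual :: "(real ^ 'n) set" where
  "dual = {f. f \<noteq> 0 \<and> (\<forall>x\<in>C. f \<bullet> x \<ge> 0)}"

lemma dual_nz: "f \<in> dual \<Longrightarrow> f \<noteq> 0" by (simp add: dual_def)

lemma dual_scale: "c > 0 \<Longrightarrow> f \<in> dual \<Longrightarrow> c *\<^sub>R f \<in> dual"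
  by (simp add: dual_def)

text \<open>A value \<open>0\<close> would be a minimum at an interior point: moving from
  \<open>x\<close> against \<open>f\<close> stays in \<open>C\<close> and lowers the value.\<close>

lemma dual_pos:
  assumes f: "f \<in> dual" and x: "x \<in> C" shows "f \<bullet> x > 0"
proof -
  obtain e where e: "e > 0" "cball x e \<subseteq> C" using open_C x open_contains_cball by blast
  define y where "y = x - (e / norm f) *\<^sub>R f"
  have "y \<in> cball x e" using e dual_nz[OF f] by (simp add: y_def dist_norm)
  then have "f \<bullet> y \<ge> 0" using e f by (auto simp: dual_def)
  then have "(e / norm f) * (f \<bullet> f) \<le> f \<bullet> x" by (simp add: y_def inner_diff_right)
  moreover have "(e / norm f) * (f \<bullet> f) > 0" using e dual_nz[OF f] by simp
  ultimately show ?thesis by linarith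
qed

text \<open>The bipolar theorem for an open cone. Since \<open>C\<close> is invariant under positive
  scaling, a hyperplane that separates \<open>x\<close> from \<open>C\<close> can be shifted to pass
  through \<open>0\<close>.\<close>

lemma mem_C_if_dual_pos:
  assumes "\<And>f. f \<in> dual \<Longrightarrow> f \<bullet> x > 0" shows "x \<in> C"
proof (rule ccontr)
  assume "x \<notin> C"
  then obtain a b where ab: "a \<noteq> 0" "a \<bullet> x \<le> b" "\<And>c. c \<in> C \<Longrightarrow> a \<bullet> c \<ge> b"
    using separating_hyperplane_sets[of "{x}" C] convex_C nonempty_C by auto
  have sc: "t * (a \<bullet> c) \<ge> b" if "t > 0" "c \<in> C" for t c
    using ab(3)[OF cone_C[OF that]] by simp
  have "a \<bullet> c \<ge> 0" if c: "c \<in> C" for c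
  proof (rule ccontr)
    assume n: "\<not> a \<bullet> c \<ge> 0"
    \<comment> \<open>The factor scales \<open>a \<bullet> c\<close> to
      \<open>- (\<bar>b\<bar> + 1)\<close>, which is less than \<open>b\<close>.\<close>
    have "(\<bar>b\<bar> + 1) / (- (a \<bullet> c)) * (a \<bullet> c) \<ge> b"
      by (rule sc) (use n c in \<open>auto intro!: divide_pos_neg add_nonneg_pos\<close>)
    then show False using n by (simp add: divide_simps split: if_splits)
  qed
  then have "a \<in> dual" using ab by (simp add: dual_def)
  moreover have "b \<le> 0"
  proof (rule ccontr)
    assume b: "\<not> b \<le> 0"
    obtain c where c: "c \<in> C" using nonempty_C by blast
    have p: "a \<bullet> c > 0" using dual_pos[OF \<open>a \<in> dual\<close> c] .
    have "b / (2 * (a \<bullet> c)) * (a \<bullet> c) \<ge> b" by (rule sc) (use b c p in auto)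
    then show False using b p by simp
  qed
  ultimately show False using assms ab by fastforce
qed

lemma zero_notin_C: "0 \<notin> C"
proof
  assume "0 \<in> C"
  then obtain e where e: "e > 0" "cball 0 e \<subseteq> C" using open_C open_contains_cball by blast
  obtain u :: "real ^ 'n" where "norm u = e" using e vector_choose_size[of e] by auto
  then have "u \<in> C" "- u \<in> C" using e by auto
  then have "u = 0" using pointed_C closure_subset by blast
  then show False using \<open>norm u = e\<close> e by simp
qed

lemma closure_cone: "c > 0 \<Longrightarrow> x \<in> closure C \<Longrightarrow> c *\<^sub>R x \<in> closure C"
proof -
  assume a: "c > 0" "x \<in> closure C"
  have "(*\<^sub>R) c ` C \<subseteq> C" using cone_C a by auto
  then have "(*\<^sub>R) c ` closure C \<subseteq> closure C" by (metis closure_mono closure_scaleR)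
  then show ?thesis using a by auto
qed

text \<open>Pointedness keeps \<open>0\<close> out of the convex hull of the unit vectors of the
  closed cone. A functional that exceeds some \<open>b > 0\<close> on this compact hull stays
  positive on \<open>C\<close> after any perturbation of norm at most \<open>b\<close>.\<close>

lemma dual_interior:
  obtains p r where "r > 0" "\<And>x. norm x \<le> r \<Longrightarrow> p + x \<in> dual"
proof -
  define S where "S = closure C \<inter> sphere 0 1"
  have cS: "compact S" unfolding S_def by (intro closed_Int_compact) auto
  have conv: "convex (closure C - {0})"
  proof (rule convexI)
    fix x y and u v :: real
    assume x: "x \<in> closure C - {0}" and y: "y \<in> closure C - {0}" and uv: "0 \<le> u" "0 \<le> v" "u + v = 1"
    have "u *\<^sub>R x + v *\<^sub>R y \<in> closure C"
      using convexD[OF convex_closure[OF convex_C]] x y uv by auto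
    moreover have "u *\<^sub>R x + v *\<^sub>R y \<noteq> 0"
    proof
      assume z: "u *\<^sub>R x + v *\<^sub>R y = 0"
      have "u \<noteq> 0" "v \<noteq> 0" using z x y uv by auto
      then have pos: "u > 0" "v > 0" using uv by auto
      have "u *\<^sub>R x \<in> closure C" "v *\<^sub>R y \<in> closure C" using x y pos closure_cone by auto
      moreover have "v *\<^sub>R y = - (u *\<^sub>R x)" using z by (simp add: add_eq_0_iff)
      ultimately have "u *\<^sub>R x = 0" using pointed_C[of "u *\<^sub>R x"] by metis
      then show False using pos x by simp
    qed
    ultimately show "u *\<^sub>R x + v *\<^sub>R y \<in> closure C - {0}" by simp
  qed
  have "convex hull S \<subseteq> closure C - {0}"
    by (rule hull_minimal) (use conv in \<open>auto simp: S_def\<close>)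
  then have "0 \<notin> convex hull S" by blast
  moreover have "closed (convex hull S)" using compact_convex_hull[OF cS] compact_imp_closed by blast
  ultimately obtain a b where ab: "b > 0" "\<And>x. x \<in> convex hull S \<Longrightarrow> a \<bullet> x > b"
    using separating_hyperplane_closed_0[of "convex hull S"] convex_convex_hull by metis
  have pos: "(a + x) \<bullet> c > 0" if x: "norm x \<le> b" and c: "c \<in> C" for x c
  proof -
    have cn: "norm c > 0" using c zero_notin_C by auto
    have "(1 / norm c) *\<^sub>R c \<in> S"
      unfolding S_def using cn c closure_subset[of C] cone_C[of "1 / norm c" c] by auto
    then have "a \<bullet> ((1 / norm c) *\<^sub>R c) > b" by (intro ab(2) hull_inc)
    then have "a \<bullet> c > b * norm c" using cn by (simp add: field_simps)
    moreover have "\<bar>x \<bullet> c\<bar> \<le> norm x * norm c" by (rule Cauchy_Schwarz_ineq2)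
    moreover have "norm x * norm c \<le> b * norm c" using x by (simp add: mult_right_mono)
    ultimately show ?thesis by (simp add: inner_add_left)
  qed
  have "a + x \<in> dual" if x: "norm x \<le> b" for x
  proof -
    obtain c where "c \<in> C" using nonempty_C by blast
    then have "a + x \<noteq> 0" using pos[OF x] by fastforce
    then show ?thesis using pos[OF x] by (auto simp: dual_def less_imp_le)
  qed
  then show ?thesis using that ab by blast
qed

definition tube :: "(complex ^ 'n) set" where
  "tube = {z. \<forall>f\<in>dual. \<forall>g\<in>dual. cone_pair f g z > 0}"

lemma tube_scale_iff: "c \<noteq> 0 \<Longrightarrow> c *s z \<in> tube \<longleftrightarrow> z \<in> tube"
  by (simp add: tube_def cone_pair_scale zero_less_mult_iff)

lemma tubeI: "x \<in> C \<Longrightarrow> y \<in> C \<Longrightarrow> cvec x + \<i> *s cvec y \<in> tube"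
  by (simp add: tube_def cone_pair_eq add_pos_pos dual_pos)

lemma cvec_in_tube: "x \<in> C \<Longrightarrow> cvec x \<in> tube"
  by (simp add: tube_def cone_pair_eq dual_pos)

text \<open>The case \<open>g = f\<close> in the definition of the tube, where
  \<open>cone_pair f f z\<close> is a squared modulus.\<close>

lemma cdot_nz: "z \<in> tube \<Longrightarrow> f \<in> dual \<Longrightarrow> cdot f z \<noteq> 0"
  unfolding tube_def cone_pair_def by force

end

locale based_cone = proper_cone C for C :: "(real ^ 'n) set" +
  fixes \<psi> :: "real ^ 'n" and r :: real
  assumes r_pos: "r > 0" and base: "\<And>x. norm x \<le> r \<Longrightarrow> \<psi> + x \<in> dual"
begin

lemma base_dual: "\<psi> \<in> dual" using base[of 0] r_pos by simp

lemma zero_notin_tube: "0 \<notin> tube"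
  using cdot_nz[OF _ base_dual, of 0] by auto

text \<open>Normalise \<open>\<psi> z = 1\<close>. Then the arguments of the values \<open>f z\<close> for \<open>f\<close> in the dual cone lie in an
  interval around \<open>0\<close>, which by compactness has length less than a right angle, so a rotation moves
  all of these values into the open first quadrant.\<close>

lemma tube_cases:
  assumes z: "z \<in> tube"
  obtains c x y where "c \<noteq> 0" "x \<in> C" "y \<in> C" "z = c *s (cvec x + \<i> *s cvec y)"
proof -
  define z' where "z' = (1 / cdot \<psi> z) *s z"
  have pz: "cdot \<psi> z \<noteq> 0" using cdot_nz[OF z base_dual] .
  have z': "z' \<in> tube" "cdot \<psi> z' = 1" "z = cdot \<psi> z *s z'"
    using pz z by (auto simp: z'_def tube_scale_iff cdot_scale)
  define x y where "x = re_vec z'" and "y = im_vec z'"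
  have \<psi>: "\<psi> \<bullet> x = 1" "\<psi> \<bullet> y = 0" using z'(2) by (simp_all add: x_def y_def flip: Re_cdot Im_cdot)
  have fx: "f \<bullet> x > 0" if "f \<in> dual" for f
    using z'(1) that base_dual \<psi> by (force simp: tube_def cone_pair_eq x_def y_def)
  define S where "S = dual \<inter> sphere 0 1"
  have "S = (\<Inter>x\<in>C. {f. f \<bullet> x \<ge> 0}) \<inter> sphere 0 1" by (auto simp: S_def dual_def)
  moreover have "closed (\<Inter>x\<in>C. {f. f \<bullet> x \<ge> 0})"
    by (intro closed_INT ballI closed_Collect_le continuous_intros)
  ultimately have cS: "compact S" by (simp add: closed_Int_compact)
  have norm_S: "(1 / norm f) *\<^sub>R f \<in> S" if "f \<in> dual" for f
    using that dual_nz[OF that] dual_scale[of "1 / norm f" f] by (simp add: S_def)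
  \<comment> \<open>The tangent of the argument of \<open>cdot f z'\<close>, whose real and
    imaginary parts are \<open>f \<bullet> x\<close> and \<open>f \<bullet> y\<close>.\<close>
  define t where "t f = (f \<bullet> y) / (f \<bullet> x)" for f
  have contt: "continuous_on S t"
    unfolding t_def using fx by (intro continuous_intros) (force simp: S_def)
  have tS: "t ((1 / norm f) *\<^sub>R f) = t f" if "f \<in> dual" for f
    using dual_nz[OF that] by (simp add: t_def)
  have neS: "S \<noteq> {}" using norm_S[OF base_dual] by blast
  obtain f1 where f1: "f1 \<in> S" "\<And>f. f \<in> S \<Longrightarrow> t f \<le> t f1"
    using continuous_attains_sup[OF cS neS contt] by blast
  obtain f2 where f2: "f2 \<in> S" "\<And>f. f \<in> S \<Longrightarrow> t f2 \<le> t f"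
    using continuous_attains_inf[OF cS neS contt] by blast
  have le: "t f \<le> t f1" "t f2 \<le> t f" if "f \<in> dual" for f
    using f1(2)[OF norm_S[OF that]] f2(2)[OF norm_S[OF that]] tS[OF that] by auto
  have d: "f1 \<in> dual" "f2 \<in> dual" using f1 f2 by (auto simp: S_def)
  have "t \<psi> = 0" by (simp add: t_def \<psi>)
  then have t0: "t f2 \<le> 0" "0 \<le> t f1" using le[OF base_dual] by auto
  \<comment> \<open>Up to a positive factor this is the cosine of the difference between the largest
    and the smallest argument, which is therefore less than a right angle.\<close>
  have "0 < (f1 \<bullet> x) * (f2 \<bullet> x) + (f1 \<bullet> y) * (f2 \<bullet> y)"
    using z'(1) d by (auto simp: tube_def cone_pair_eq x_def y_def)
  also have "\<dots> = ((f1 \<bullet> x) * (f2 \<bullet> x)) * (1 + t f1 * t f2)"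
    using fx[OF d(1)] fx[OF d(2)] by (simp add: t_def field_simps)
  finally have key: "1 + t f1 * t f2 > 0"
    using mult_pos_pos[OF fx[OF d(1)] fx[OF d(2)]] zero_less_mult_pos by blast
  \<comment> \<open>Multiplication by \<open>1 + \<i> * q\<close> gives \<open>cdot f z'\<close> the
    real part \<open>(f \<bullet> x) * (1 - q * t f)\<close> and the imaginary part
    \<open>(f \<bullet> x) * (q + t f)\<close>. The two bounds make both positive for every dual
    \<open>f\<close>.\<close>
  obtain q where q: "- t f2 < q" "q * t f1 < 1"
  proof (cases "t f1 = 0")
    case True then show ?thesis using that[of "- t f2 + 1"] by simp
  next
    case False
    then have "- t f2 < 1 / t f1" using key t0 by (simp add: field_simps)
    then obtain q where "- t f2 < q" "q < 1 / t f1" using dense by blast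
    then show ?thesis using that[of q] False t0 by (simp add: field_simps)
  qed
  have q0: "q > 0" using q t0 by linarith
  have "x - q *\<^sub>R y \<in> C"
  proof (rule mem_C_if_dual_pos)
    fix f assume f: "f \<in> dual"
    have "q * t f \<le> q * t f1" using le[OF f] q0 by simp
    then have "0 < (f \<bullet> x) * (1 - q * t f)" using fx[OF f] q by (intro mult_pos_pos) auto
    also have "\<dots> = f \<bullet> (x - q *\<^sub>R y)" using fx[OF f] by (simp add: t_def inner_diff_right field_simps)
    finally show "f \<bullet> (x - q *\<^sub>R y) > 0" .
  qed
  moreover have "q *\<^sub>R x + y \<in> C"
  proof (rule mem_C_if_dual_pos)
    fix f assume f: "f \<in> dual"
    have "0 < (f \<bullet> x) * (q + t f)" using fx[OF f] q le[OF f] by (intro mult_pos_pos) auto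
    also have "\<dots> = f \<bullet> (q *\<^sub>R x + y)" using fx[OF f] by (simp add: t_def inner_add_right field_simps)
    finally show "f \<bullet> (q *\<^sub>R x + y) > 0" .
  qed
  moreover have "cvec (x - q *\<^sub>R y) + \<i> *s cvec (q *\<^sub>R x + y) = (1 + \<i> * of_real q) *s z'"
    by (subst cvec_re_im[of z', symmetric])
       (simp add: x_def y_def vec_eq_iff cvec_def re_vec_def im_vec_def complex_eq_iff)
  moreover have nz: "1 + \<i> * of_real q \<noteq> 0" by (simp add: complex_eq_iff)
  moreover have "z = (cdot \<psi> z / (1 + \<i> * of_real q)) *s ((1 + \<i> * of_real q) *s z')"
  proof -
    have "cdot \<psi> z / (1 + \<i> * of_real q) * (1 + \<i> * of_real q) = cdot \<psi> z" using nz by simp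
    then show ?thesis using z'(3) by (simp only: vec.scale_scale)
  qed
  moreover have "cdot \<psi> z / (1 + \<i> * of_real q) \<noteq> 0" using pz nz by simp
  ultimately show ?thesis using that by metis
qed

text \<open>The definition is an infinite intersection, from which openness is not evident. The
  first quadrant representation turns the tube into a union of open sets.\<close>

lemma open_tube: "open tube"
proof -
  have "tube = (\<Union>c\<in>-{0}. {z. re_vec (c *s z) \<in> C \<and> im_vec (c *s z) \<in> C})"
  proof (intro Set.set_eqI iffI)
    fix z assume "z \<in> tube"
    then obtain c x y where c: "c \<noteq> 0" "x \<in> C" "y \<in> C" "z = c *s (cvec x + \<i> *s cvec y)"
      by (rule tube_cases)
    then have "(1 / c) *s z = cvec x + \<i> *s cvec y" by simp
    with c show "z \<in> (\<Union>c\<in>-{0}. {z. re_vec (c *s z) \<in> C \<and> im_vec (c *s z) \<in> C})"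
      by (auto intro!: bexI[of _ "1 / c"])
  next
    fix z assume "z \<in> (\<Union>c\<in>-{0}. {z. re_vec (c *s z) \<in> C \<and> im_vec (c *s z) \<in> C})"
    then obtain c where c: "c \<noteq> 0" "re_vec (c *s z) \<in> C" "im_vec (c *s z) \<in> C" by auto
    then have "c *s z \<in> tube" using tubeI[OF c(2,3)] by (simp add: cvec_re_im)
    then show "z \<in> tube" using tube_scale_iff c by blast
  qed
  moreover have "open {z. re_vec (c *s z) \<in> C \<and> im_vec (c *s z) \<in> C}" for c
    by (intro open_Collect_conj open_vimage[OF open_C, unfolded vimage_def] continuous_intros)
  ultimately show ?thesis by auto
qed

end

section \<open>Positive real parts on the disc\<close>

lemma cmod_moebius_less_1:
  assumes "cmod a < 1" "cmod b < 1" shows "cmod ((a - b) / (1 - cnj a * b)) < 1"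
  using Moebius_function_norm_lt_1[of a b 0] assms
  by (simp add: Moebius_function_simple norm_divide norm_minus_commute)

text \<open>With the distance normalised as \<open>2 * artanh\<close>, its exponential is exactly
  the Harnack constant of the disc.\<close>

lemma exp_poincare_distance:
  assumes "cmod a < 1" "cmod b < 1"
  shows "exp (poincare_distance a b) =
    (1 + cmod ((a - b) / (1 - cnj a * b))) / (1 - cmod ((a - b) / (1 - cnj a * b)))"
proof -
  define m where "m = cmod ((a - b) / (1 - cnj a * b))"
  have "0 \<le> m" "m < 1" using cmod_moebius_less_1[OF assms] by (auto simp: m_def)
  then show ?thesis by (simp add: poincare_distance_def artanh_def flip: m_def)
qed

lemma poincare_distance_commute: "poincare_distance a b = poincare_distance b a"
proof -
  have "cmod (1 - cnj a * b) = cmod (cnj (1 - cnj a * b))" by (rule complex_mod_cnj[symmetric])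
  then have "cmod (1 - cnj a * b) = cmod (1 - cnj b * a)" by (simp add: mult.commute)
  then show ?thesis by (simp add: poincare_distance_def norm_divide norm_minus_commute)
qed

lemma poincare_distance_nonneg:
  assumes "cmod a < 1" "cmod b < 1" shows "poincare_distance a b \<ge> 0"
proof -
  define m where "m = cmod ((a - b) / (1 - cnj a * b))"
  have "0 \<le> m" "m < 1" using cmod_moebius_less_1[OF assms] by (auto simp: m_def)
  then have "ln ((1 + m) / (1 - m)) \<ge> 0" by (intro ln_ge_zero) auto
  then show ?thesis by (simp add: poincare_distance_def artanh_def flip: m_def)
qed

text \<open>After normalising to \<open>k' 0 = 1\<close>, the Cayley transform \<open>s\<close> maps
  the disc to itself and fixes \<open>0\<close>. The Schwarz lemma bounds \<open>s m\<close>, and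
  undoing the transform bounds \<open>k' m\<close>.\<close>

lemma harnack_at_0:
  assumes holk: "k holomorphic_on ball 0 1" and pos: "\<And>z. cmod z < 1 \<Longrightarrow> Re (k z) > 0"
    and m: "cmod m < 1"
  shows "Re (k m) \<le> (1 + cmod m) / (1 - cmod m) * Re (k 0)"
proof -
  define p where "p = Re (k 0)"
  have p: "p > 0" using pos by (simp add: p_def)
  define k' where "k' z = (k z - \<i> * Im (k 0)) / p" for z
  have k': "Re (k' z) = Re (k z) / p" for z using p by (simp add: k'_def)
  have k'0: "k' 0 = 1" using p by (simp add: k'_def p_def complex_eq_iff)
  have k'pos: "Re (k' z) > 0" if "cmod z < 1" for z using pos[OF that] p by (simp add: k')
  have nz: "k' z + 1 \<noteq> 0" if "cmod z < 1" for z
    using k'pos[OF that] by (auto simp: complex_eq_iff)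
  define s where "s z = (k' z - 1) / (k' z + 1)" for z
  have hols: "s holomorphic_on ball 0 1"
    unfolding s_def k'_def using holk nz p by (intro holomorphic_intros) (auto simp: k'_def)
  have s1: "cmod (s z) < 1" if "cmod z < 1" for z
  proof -
    have "(cmod (k' z - 1))\<^sup>2 < (cmod (k' z + 1))\<^sup>2"
      using k'pos[OF that] unfolding cmod_power2 by (simp add: power2_eq_square algebra_simps)
    then have "cmod (k' z - 1) < cmod (k' z + 1)" by (rule power2_less_imp_less) simp
    then show ?thesis using nz[OF that] by (simp add: s_def norm_divide)
  qed
  have sm: "cmod (s m) \<le> cmod m"
    by (rule Schwarz_Lemma(1)[OF hols _ s1 m]) (simp_all add: s_def k'0)
  have lt: "cmod (s m) < 1" using sm m by simp
  then have nz': "1 - s m \<noteq> 0" by auto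
  have "k' m * (1 - s m) = 1 + s m" using nz[OF m] by (simp add: s_def field_simps)
  then have "k' m = (1 + s m) / (1 - s m)" using nz' by (simp add: field_simps)
  then have "cmod (k' m) = cmod (1 + s m) / cmod (1 - s m)" by (simp add: norm_divide)
  also have "\<dots> \<le> (1 + cmod m) / (1 - cmod m)"
  proof (rule frac_le)
    show "cmod (1 + s m) \<le> 1 + cmod m" using norm_triangle_ineq[of 1 "s m"] sm by simp
    show "1 - cmod m \<le> cmod (1 - s m)" using norm_triangle_ineq2[of 1 "s m"] sm by simp
  qed (use m in auto)
  finally have "Re (k' m) \<le> (1 + cmod m) / (1 - cmod m)"
    using complex_Re_le_cmod[of "k' m"] by linarith
  then show ?thesis using p by (simp add: k' flip: p_def) (simp add: field_simps)
qed

text \<open>The disc automorphism \<open>M\<close> moves \<open>0\<close> to \<open>b\<close> and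
  \<open>m\<close> to \<open>a\<close>, so the estimate at the centre applies; \<open>cmod m\<close>
  is the pseudohyperbolic distance of \<open>a\<close> and \<open>b\<close>.\<close>

lemma harnack:
  assumes holh: "h holomorphic_on ball 0 1" and pos: "\<And>z. cmod z < 1 \<Longrightarrow> Re (h z) > 0"
    and a: "cmod a < 1" and b: "cmod b < 1"
  shows "Re (h a) \<le> exp (poincare_distance a b) * Re (h b)"
proof -
  define M where "M = Moebius_function 0 (- b)"
  define m where "m = Moebius_function 0 b a"
  have Mb: "M 0 = b" by (simp add: M_def Moebius_function_simple)
  have Mm: "M m = a" unfolding M_def m_def using Moebius_function_compose[of "- b" b a] a b by simp
  have M1: "cmod (M z) < 1" if "cmod z < 1" for z
    unfolding M_def using Moebius_function_norm_lt_1[of "-b" z] b that by simp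
  have m1: "cmod m < 1" unfolding m_def using Moebius_function_norm_lt_1 a b by simp
  have holM: "M holomorphic_on ball 0 1" unfolding M_def using Moebius_function_holomorphic b by simp
  have "(h \<circ> M) holomorphic_on ball 0 1"
    by (rule holomorphic_on_compose_gen[OF holM holh]) (use M1 in auto)
  then have "Re ((h \<circ> M) m) \<le> (1 + cmod m) / (1 - cmod m) * Re ((h \<circ> M) 0)"
    by (rule harnack_at_0) (use pos M1 m1 in auto)
  moreover have "(1 + cmod m) / (1 - cmod m) = exp (poincare_distance b a)"
    using exp_poincare_distance[OF b a]
    by (simp add: m_def Moebius_function_simple norm_divide norm_minus_commute)
  ultimately show ?thesis by (simp add: Mm Mb poincare_distance_commute)
qed

section \<open>Closeness of points of the tube\<close>

text \<open>The real parts for \<open>s = 0\<close> do not distinguish a point from its complex conjugate; those for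
  \<open>s = 1\<close> do.\<close>

definition cone_ratio :: "real ^ 'n \<Rightarrow> real ^ 'n \<Rightarrow> real \<Rightarrow> complex ^ 'n \<Rightarrow> complex" where
  "cone_ratio f g s z = cdot f z / (cdot g z + \<i> * of_real s * cdot f z)"

lemma cone_ratio_scale: "c \<noteq> 0 \<Longrightarrow> cone_ratio f g s (c *s z) = cone_ratio f g s z"
  by (simp add: cone_ratio_def cdot_scale mult.left_commute[of _ c] flip: distrib_left)

text \<open>The term with \<open>s\<close> contributes a purely imaginary amount to
  \<open>a * cnj (b + \<i> * s * a)\<close>, so only the denominator depends on
  \<open>s\<close>.\<close>

lemma Re_cone_ratio:
  "Re (cone_ratio f g s z) = cone_pair f g z / (cmod (cdot g z + \<i> * of_real s * cdot f z))\<^sup>2"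
proof -
  have "Re (a * cnj (b + \<i> * of_real s * a)) = Re (a * cnj b)" for a b
    by (simp add: algebra_simps)
  then show ?thesis
    unfolding cone_ratio_def cone_pair_def complex_div_cnj[of "cdot f z"]
    by (simp only: Re_divide_of_real flip: of_real_power)
qed

context proper_cone
begin

lemma cone_denominator_nz:
  assumes "z \<in> tube" "f \<in> dual" "g \<in> dual"
  shows "cdot g z + \<i> * of_real s * cdot f z \<noteq> 0"
proof
  assume "cdot g z + \<i> * of_real s * cdot f z = 0"
  then have "cdot g z = - (\<i> * of_real s * cdot f z)" by (simp add: add_eq_0_iff2)
  then have "cone_pair f g z = 0" by (simp add: cone_pair_def algebra_simps)
  with assms show False by (force simp: tube_def)
qed

lemma Re_cone_ratio_pos:
  assumes "z \<in> tube" "f \<in> dual" "g \<in> dual" shows "Re (cone_ratio f g s z) > 0"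
  using assms cone_denominator_nz[OF assms] by (simp add: Re_cone_ratio tube_def)

text \<open>Says that the invariant distance, the supremum of the absolute logarithms of all ratios
  of these real parts, is at most \<open>e\<close>. As a relation it needs no finiteness of that
  supremum.\<close>

definition close :: "real \<Rightarrow> complex ^ 'n \<Rightarrow> complex ^ 'n \<Rightarrow> bool" where
  "close e z w \<longleftrightarrow> (\<forall>f\<in>dual. \<forall>g\<in>dual. \<forall>s.
     Re (cone_ratio f g s z) \<le> exp e * Re (cone_ratio f g s w) \<and>
     Re (cone_ratio f g s w) \<le> exp e * Re (cone_ratio f g s z))"

lemma close_sym: "close e z w \<Longrightarrow> close e w z"
  by (auto simp: close_def)

lemma close_refl: "z \<in> tube \<Longrightarrow> e \<ge> 0 \<Longrightarrow> close e z z"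
  using Re_cone_ratio_pos by (fastforce simp: close_def)

lemma close_trans:
  assumes "close e z w" "close e' w v" shows "close (e + e') z v"
  unfolding close_def
proof (intro ballI allI conjI)
  fix f g s assume fg: "f \<in> dual" "g \<in> dual"
  let ?R = "\<lambda>z. Re (cone_ratio f g s z)"
  have "?R z \<le> exp e * ?R w" "?R w \<le> exp e' * ?R v" "?R v \<le> exp e' * ?R w" "?R w \<le> exp e * ?R z"
    using assms fg by (auto simp: close_def)
  then show "?R z \<le> exp (e + e') * ?R v" "?R v \<le> exp (e + e') * ?R z"
    by (smt (verit) exp_add mult.assoc mult.commute mult_left_mono exp_ge_zero)+
qed

lemma close_scale_left: "c \<noteq> 0 \<Longrightarrow> close e (c *s z) w \<longleftrightarrow> close e z w"
  and close_scale_right: "c \<noteq> 0 \<Longrightarrow> close e z (c *s w) \<longleftrightarrow> close e z w"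
  by (simp_all add: close_def cone_ratio_scale)

lemma close_mono:
  assumes "close e z w" "e \<le> e'" "z \<in> tube" "w \<in> tube" shows "close e' z w"
proof -
  have "close (e + (e' - e)) z w" using close_trans[OF assms(1) close_refl[of w "e' - e"]] assms by simp
  then show ?thesis by simp
qed

lemma holomorphic_disc_close:
  fixes F :: "complex \<Rightarrow> complex ^ 'n"
  assumes hol: "\<And>j. (\<lambda>z. F z $ j) holomorphic_on ball 0 1"
    and F: "\<And>z. cmod z < 1 \<Longrightarrow> F z \<in> tube" and ab: "cmod a < 1" "cmod b < 1"
  shows "close (poincare_distance a b) (F a) (F b)"
  unfolding close_def
proof (intro ballI allI)
  fix f g s assume fg: "f \<in> dual" "g \<in> dual"
  note [holomorphic_intros] = hol
  let ?h = "\<lambda>z. cone_ratio f g s (F z)"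
  have hol: "?h holomorphic_on ball 0 1"
    unfolding cone_ratio_def
  proof (intro holomorphic_intros)
    show "cdot g (F z) + \<i> * of_real s * cdot f (F z) \<noteq> 0" if "z \<in> ball 0 1" for z
      using cone_denominator_nz F fg that by simp
  qed
  show "Re (?h a) \<le> exp (poincare_distance a b) * Re (?h b) \<and> Re (?h b) \<le> exp (poincare_distance a b) * Re (?h a)"
    using harnack[OF hol _ ab] harnack[OF hol _ ab(2,1)] Re_cone_ratio_pos F fg
    by (simp add: poincare_distance_commute)
qed

end

context based_cone
begin

text \<open>The ball around \<psi> inside the dual cone makes each coordinate a multiple of a
  difference of two dual functionals, so values of dual functionals control the whole
  vector.\<close>

lemma component_eq_base_diff:
  obtains f where "f \<in> dual" "\<And>z. z $ j = of_real (1 / r) * (cdot f z - cdot \<psi> z)"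
proof
  show "\<psi> + r *\<^sub>R axis j 1 \<in> dual" using base[of "r *\<^sub>R axis j 1"] r_pos by simp
  show "z $ j = of_real (1 / r) * (cdot (\<psi> + r *\<^sub>R axis j 1) z - cdot \<psi> z)" for z
    using r_pos by (simp add: cdot_add_left cdot_scale_left cdot_axis)
qed

text \<open>On the slice, comparison with \<psi> bounds \<open>cdot f w\<close> from above and away
  from \<open>0\<close>, and comparison of \<open>f\<close> with \<open>g\<close> then bounds
  \<open>cone_pair f g w\<close> from below. Written as weak inequalities these bounds are closed
  conditions, while the positive lower bounds keep \<open>K\<close> inside the open tube.\<close>

lemma close_ball_compact:
  assumes z: "z \<in> tube"
  obtains K where "compact K" "K \<subseteq> tube" "\<And>w. w \<in> K \<Longrightarrow> cdot \<psi> w = 1"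
    "\<And>w. w \<in> tube \<Longrightarrow> cdot \<psi> w = 1 \<Longrightarrow> close e z w \<Longrightarrow> w \<in> K"
proof -
  note pd = base_dual
  \<comment> \<open>The lower bound for the ratio at \<open>w\<close> that
    \<open>close e z w\<close> yields from the ratio at \<open>z\<close>.\<close>
  define c where "c f g = exp (- e) * Re (cone_ratio f g 0 z)" for f g
  have cpos: "c f g > 0" if "f \<in> dual" "g \<in> dual" for f g
    using Re_cone_ratio_pos[OF z that] by (simp add: c_def)
  define K where "K = {w. cdot \<psi> w = 1} \<inter> (\<Inter>f\<in>dual. {w. cmod (cdot f w) \<le> 1 / c \<psi> f}) \<inter>
     (\<Inter>f\<in>dual. \<Inter>g\<in>dual. {w. cone_pair f g w \<ge> c f g * (c g \<psi>)\<^sup>2})"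
  have "closed K" unfolding K_def cone_pair_def
    by (intro closed_Int closed_INT ballI closed_Collect_eq closed_Collect_le continuous_intros)
  moreover have "bounded K"
  proof -
    have "\<exists>M. \<forall>w\<in>K. cmod (w $ j) \<le> M" for j
    proof -
      obtain f where f: "f \<in> dual" "\<And>z. z $ j = of_real (1 / r) * (cdot f z - cdot \<psi> z)"
        using component_eq_base_diff by blast
      have "cmod (w $ j) \<le> 1 / r * (1 / c \<psi> f + 1)" if "w \<in> K" for w
      proof -
        have "cmod (cdot f w - cdot \<psi> w) \<le> cmod (cdot f w) + cmod (cdot \<psi> w)" by (rule norm_triangle_ineq4)
        also have "\<dots> \<le> 1 / c \<psi> f + 1" using that f by (auto simp: K_def)
        finally show ?thesis unfolding f(2) norm_mult using r_pos by (simp add: divide_right_mono norm_divide)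
      qed
      then show ?thesis by blast
    qed
    then obtain M where M: "\<And>j w. w \<in> K \<Longrightarrow> cmod (w $ j) \<le> M j" by metis
    have "norm w \<le> (\<Sum>j\<in>UNIV. M j)" if "w \<in> K" for w
      proof -
      have "norm w \<le> (\<Sum>j\<in>UNIV. cmod (w $ j))" unfolding norm_vec_def by (rule L2_set_le_sum) simp
      also have "\<dots> \<le> (\<Sum>j\<in>UNIV. M j)" by (intro sum_mono M that)
      finally show ?thesis .
    qed
    then show ?thesis by (auto simp: bounded_iff)
  qed
  ultimately have "compact K" by (simp add: compact_eq_bounded_closed)
  moreover have "K \<subseteq> tube"
  proof
    fix w assume w: "w \<in> K"
    show "w \<in> tube" unfolding tube_def
    proof (intro CollectI ballI)
      fix f g assume fg: "f \<in> dual" "g \<in> dual"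
      then have "cone_pair f g w \<ge> c f g * (c g \<psi>)\<^sup>2" using w by (auto simp: K_def)
      moreover have "c f g * (c g \<psi>)\<^sup>2 > 0" using cpos fg pd by (simp add: less_imp_neq[symmetric] order_less_imp_not_eq2)
      ultimately show "cone_pair f g w > 0" by linarith
    qed
  qed
  moreover have "w \<in> K" if w: "w \<in> tube" and n: "cdot \<psi> w = 1" and cl: "close e z w" for w
  proof -
    have low: "Re (cone_ratio f g 0 w) \<ge> c f g" if "f \<in> dual" "g \<in> dual" for f g
    proof -
      have "Re (cone_ratio f g 0 z) \<le> exp e * Re (cone_ratio f g 0 w)"
        using cl that by (auto simp: close_def)
      then show ?thesis by (simp add: c_def exp_minus field_simps)
    qed
    have nz: "cmod (cdot f w) > 0" if "f \<in> dual" for f using cdot_nz[OF w that] by simp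
    have up: "cmod (cdot f w) \<le> 1 / c \<psi> f" if f: "f \<in> dual" for f
    proof -
      have "c \<psi> f \<le> Re (cone_ratio \<psi> f 0 w)" using low pd f by blast
      also have "\<dots> \<le> cmod (cone_ratio \<psi> f 0 w)" by (rule complex_Re_le_cmod)
      also have "\<dots> = 1 / cmod (cdot f w)" by (simp add: cone_ratio_def n norm_divide)
      finally show ?thesis using nz[OF f] cpos[OF pd f] by (simp add: field_simps)
    qed
    have lo: "cmod (cdot f w) \<ge> c f \<psi>" if f: "f \<in> dual" for f
    proof -
      have "c f \<psi> \<le> Re (cone_ratio f \<psi> 0 w)" using low pd f by blast
      also have "\<dots> \<le> cmod (cone_ratio f \<psi> 0 w)" by (rule complex_Re_le_cmod)
      finally show ?thesis by (simp add: cone_ratio_def n)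
    qed
    have "cone_pair f g w \<ge> c f g * (c g \<psi>)\<^sup>2" if fg: "f \<in> dual" "g \<in> dual" for f g
    proof -
      have "c f g * (c g \<psi>)\<^sup>2 \<le> c f g * (cmod (cdot g w))\<^sup>2"
        using lo[OF fg(2)] cpos[OF fg] cpos[OF fg(2) pd] by (intro mult_left_mono power_mono) auto
      also have "\<dots> \<le> Re (cone_ratio f g 0 w) * (cmod (cdot g w))\<^sup>2"
        using low[OF fg] by (intro mult_right_mono) auto
      also have "\<dots> = cone_pair f g w" using nz[OF fg(2)] by (simp add: Re_cone_ratio)
      finally show ?thesis .
    qed
    then show ?thesis using up n by (auto simp: K_def)
  qed
  moreover have "cdot \<psi> w = 1" if "w \<in> K" for w using that by (simp add: K_def)
  ultimately show ?thesis using that by blast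
qed

text \<open>All the real parts agree. On the slice the ratio of \<open>f\<close> to \<psi> gives the
  real part of \<open>a = cdot f z\<close>, that of \<psi> to \<open>f\<close> with
  \<open>s = 0\<close> gives the modulus of \<open>a\<close>, and with \<open>s = 1\<close> the
  modulus of \<open>a + \<i>\<close>. The squares of these moduli differ by
  \<open>2 * Im a + 1\<close>, which determines the imaginary part.\<close>

lemma close_limit_eq:
  assumes z: "z \<in> tube" "cdot \<psi> z = 1" and w: "w \<in> tube" "cdot \<psi> w = 1"
    and cl: "\<And>e. e > 0 \<Longrightarrow> close e z w"
  shows "z = w"
proof -
  note pd = base_dual
  have le: "x \<le> y" if "\<And>e. e > 0 \<Longrightarrow> x \<le> exp e * y" for x y :: real
  proof (rule tendsto_le[of "at_right 0"])
    show "((\<lambda>e. exp e * y) \<longlongrightarrow> y) (at_right (0::real))"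
      by (rule tendsto_eq_intros refl | simp)+
    show "\<forall>\<^sub>F e in at_right 0. x \<le> exp e * y"
      using that by (simp add: eventually_at_right_less[THEN eventually_mono])
  qed auto
  have eq: "Re (cone_ratio f g s z) = Re (cone_ratio f g s w)" if "f \<in> dual" "g \<in> dual" for f g s
  proof (rule antisym; rule le)
    fix e :: real assume "e > 0"
    then have "close e z w" by (rule cl)
    then show "Re (cone_ratio f g s z) \<le> exp e * Re (cone_ratio f g s w)"
      and "Re (cone_ratio f g s w) \<le> exp e * Re (cone_ratio f g s z)"
      using that unfolding close_def by blast+
  qed
  have fz: "cdot f z = cdot f w" if f: "f \<in> dual" for f
  proof -
    have nz: "cdot f z \<noteq> 0" "cdot f w \<noteq> 0" using cdot_nz[OF z(1) f] cdot_nz[OF w(1) f] by auto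
    have 1: "Re (cdot f z) = Re (cdot f w)"
      using eq[OF f pd, of 0] by (simp add: cone_ratio_def z w)
    have p: "cone_pair \<psi> f z = Re (cdot f z)" "cone_pair \<psi> f w = Re (cdot f w)"
      by (simp_all add: cone_pair_def z w)
    have pos: "Re (cdot f z) > 0" using z(1) f pd p by (force simp: tube_def)
    have 2: "(cmod (cdot f z))\<^sup>2 = (cmod (cdot f w))\<^sup>2"
      using eq[OF pd f, of 0] pos nz 1 by (simp add: Re_cone_ratio p)
    have den: "cdot f z + \<i> \<noteq> 0" "cdot f w + \<i> \<noteq> 0"
      using cone_denominator_nz[OF z(1) pd f, of 1] cone_denominator_nz[OF w(1) pd f, of 1] z w by auto
    have 3: "(cmod (cdot f z + \<i>))\<^sup>2 = (cmod (cdot f w + \<i>))\<^sup>2"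
      using eq[OF pd f, of 1] pos den 1 by (simp add: Re_cone_ratio p z w)
    have "Im (cdot f z) = Im (cdot f w)"
      using 2 3 unfolding cmod_power2 by (simp add: power2_eq_square algebra_simps)
    with 1 show ?thesis by (simp add: complex_eq_iff)
  qed
  have "z $ j = w $ j" for j
  proof -
    obtain f where f: "f \<in> dual" "\<And>z. z $ j = of_real (1 / r) * (cdot f z - cdot \<psi> z)"
      using component_eq_base_diff by blast
    then show ?thesis using fz[OF f(1)] z w by simp
  qed
  then show ?thesis by (simp add: vec_eq_iff)
qed

end

lemma poincare_distance_0_lt:
  assumes "e > 0"
  obtains \<delta> where "\<delta> > 0" "\<delta> < 1" "\<And>t. 0 \<le> t \<Longrightarrow> t < \<delta> \<Longrightarrow> poincare_distance 0 (of_real t) < e"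
proof -
  define \<delta> where "\<delta> = tanh (e / 2)"
  have d: "\<delta> > 0" "\<delta> < 1" using assms by (auto simp: \<delta>_def tanh_real_lt_1)
  have "poincare_distance 0 (of_real t) < e" if "0 \<le> t" "t < \<delta>" for t
  proof -
    have "(1 + t) / (1 - t) < (1 + \<delta>) / (1 - \<delta>)" using that d by (intro frac_less) auto
    then have "artanh t < artanh \<delta>" unfolding artanh_def using that d by simp
    also have "\<dots> = e / 2" by (simp add: \<delta>_def artanh_tanh_real)
    finally show ?thesis using that by (simp add: poincare_distance_def)
  qed
  with d that show ?thesis by blast
qed

context based_cone
begin

text \<open>A small ball around \<open>z\<close> in the tube is foliated by affine discs through \<open>z\<close>.\<close>

lemma nearby_point_on_disc:
  assumes z: "z \<in> tube" and e: "e > 0"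
  obtains \<delta> where "\<delta> > 0"
    "\<And>w. dist z w < \<delta> \<Longrightarrow> \<exists>F c. (\<forall>j. (\<lambda>z. F z $ j) holomorphic_on ball 0 1) \<and>
       (\<forall>\<zeta>. cmod \<zeta> < 1 \<longrightarrow> F \<zeta> \<in> tube) \<and> F 0 = z \<and> F c = w \<and> cmod c < 1 \<and> poincare_distance 0 c < e"
proof -
  obtain R where R: "R > 0" "cball z R \<subseteq> tube"
    using open_tube z open_contains_cball by blast
  obtain d where d: "d > 0" "d < 1" "\<And>t. 0 \<le> t \<Longrightarrow> t < d \<Longrightarrow> poincare_distance 0 (of_real t) < e"
    using poincare_distance_0_lt[OF e] by metis
  have nrm: "norm (c *s u) = cmod c * norm u" for c :: complex and u :: "complex ^ 'n"
    by (simp add: norm_vec_def norm_mult L2_set_right_distrib)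
  show ?thesis
  proof (rule that[of "R * d"])
    fix w assume w: "dist z w < R * d"
    \<comment> \<open>The direction of \<open>w - z\<close>, scaled to length \<open>R\<close>. For
      \<open>w = z\<close> division by zero makes \<open>u = 0\<close>, and the disc is
      constant.\<close>
    define u where "u = of_real (R / dist z w) *s (w - z)"
    define t where "t = dist z w / R"
    define F where "F \<zeta> = z + \<zeta> *s u" for \<zeta>
    have t: "0 \<le> t" "t < d" using w R by (auto simp: t_def field_simps)
    have nu: "norm u \<le> R" unfolding u_def nrm using R by (simp add: dist_norm norm_minus_commute norm_divide)
    have "F \<zeta> \<in> tube" if "cmod \<zeta> < 1" for \<zeta>
    proof -
      have "norm (\<zeta> *s u) \<le> 1 * R" unfolding nrm using nu that by (intro mult_mono) auto
      then have "F \<zeta> \<in> cball z R" by (simp add: F_def dist_norm)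
      with R show ?thesis by blast
    qed
    moreover have "F (of_real t) = w"
      using R by (cases "z = w") (auto simp: F_def u_def t_def)
    moreover have "(\<lambda>z. F z $ j) holomorphic_on ball 0 1" for j
      unfolding F_def by (simp, intro holomorphic_intros)
    moreover have "F 0 = z" by (simp add: F_def)
    ultimately show "\<exists>F c. (\<forall>j. (\<lambda>z. F z $ j) holomorphic_on ball 0 1) \<and>
       (\<forall>\<zeta>. cmod \<zeta> < 1 \<longrightarrow> F \<zeta> \<in> tube) \<and> F 0 = z \<and> F c = w \<and> cmod c < 1 \<and> poincare_distance 0 c < e"
      using d t by (intro exI[of _ F] exI[of _ "of_real t"]) auto
  qed (use R d in simp)
qed

lemma close_nhd:
  assumes z: "z \<in> tube" and e: "e > 0"
  obtains \<delta> where "\<delta> > 0" "\<And>w. dist z w < \<delta> \<Longrightarrow> w \<in> tube \<and> close e z w"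
proof -
  show ?thesis
  proof (rule nearby_point_on_disc[OF assms], rule that)
    fix \<delta> w
    assume \<delta>: "\<And>w. dist z w < \<delta> \<Longrightarrow> \<exists>F c. (\<forall>j. (\<lambda>z. F z $ j) holomorphic_on ball 0 1) \<and>
       (\<forall>\<zeta>. cmod \<zeta> < 1 \<longrightarrow> F \<zeta> \<in> tube) \<and> F 0 = z \<and> F c = w \<and> cmod c < 1 \<and> poincare_distance 0 c < e"
    assume "dist z w < \<delta>"
    then obtain F :: "complex \<Rightarrow> complex ^ 'n" and c where F: "\<And>j. (\<lambda>z. F z $ j) holomorphic_on ball 0 1"
       "\<And>\<zeta>. cmod \<zeta> < 1 \<Longrightarrow> F \<zeta> \<in> tube" "F 0 = z" "F c = w" "cmod c < 1" "poincare_distance 0 c < e"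
      using \<delta> by blast
    have "close (poincare_distance 0 c) z w" using holomorphic_disc_close[OF F(1,2), of 0 c] F(3-5) by simp
    then show "w \<in> tube \<and> close e z w" using close_mono[OF _ less_imp_le[OF F(6)] z] F(2)[OF F(5)] F(4) by simp
  qed
qed

end

section \<open>The elliptic tube in homogeneous coordinates\<close>

context proper_cone
begin

lemma C_add: "x \<in> C \<Longrightarrow> y \<in> C \<Longrightarrow> x + y \<in> C"
  using convexD[OF convex_C, of x y "1/2" "1/2"] cone_C[of 2 "(1/2) *\<^sub>R x + (1/2) *\<^sub>R y"]
  by (simp add: scaleR_right_distrib)

lemma C_combination:
  assumes "x \<in> C" "y \<in> C" "a \<ge> 0" "b \<ge> 0" "a > 0 \<or> b > 0" shows "a *\<^sub>R x + b *\<^sub>R y \<in> C"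
  using assms cone_C[of a x] cone_C[of b y] C_add[of "a *\<^sub>R x" "b *\<^sub>R y"]
  by (cases "a = 0"; cases "b = 0") auto

lemma C_disjoint_uminus: "x \<in> C \<Longrightarrow> - x \<notin> C"
  using C_add[of x "- x"] zero_notin_C by auto

text \<open>All values \<open>f \<bullet> x\<close> have the sign of \<open>p \<bullet> x\<close>.
  This identifies the real points of the tube, so that a compact part of the tube can be cut down to
  a compact part of \<open>C\<close>.\<close>

lemma cvec_in_tube_cases: "cvec x \<in> tube \<Longrightarrow> x \<in> C \<or> - x \<in> C"
proof -
  assume t: "cvec x \<in> tube"
  obtain p r where "r > 0" and p: "\<And>x. norm x \<le> r \<Longrightarrow> p + x \<in> dual" using dual_interior by metis
  then have pd: "p \<in> dual" using p[of 0] by simp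
  have pos: "(f \<bullet> x) * (p \<bullet> x) > 0" if "f \<in> dual" for f
    using t that pd by (force simp: tube_def cone_pair_eq)
  then have "p \<bullet> x \<noteq> 0" using pd by force
  then consider "p \<bullet> x > 0" | "p \<bullet> x < 0" by linarith
  then show ?thesis
  proof cases
    case 1
    then have "x \<in> C" using pos by (intro mem_C_if_dual_pos) (blast intro: zero_less_mult_pos2)
    then show ?thesis ..
  next
    case 2
    have "(f \<bullet> (- x)) > 0" if "f \<in> dual" for f
      using pos[OF that] 2 by (simp add: zero_less_mult_iff)
    then have "- x \<in> C" by (rule mem_C_if_dual_pos)
    then show ?thesis ..
  qed
qed

end

context based_cone
begin

text \<open>A segment in \<Omega> lifts to one of the cones, and a coefficient quotient in the right
  half plane leads into \<open>C + \<i> C\<close> up to a factor. Conversely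
  \<open>x + \<i> y\<close> lies on the elliptic segment of \<open>x\<close> and \<open>y\<close>,
  provided that these are independent.\<close>

lemma elliptic_tube_eq:
  assumes \<Omega>: "lines_union \<Omega> = C \<union> uminus ` C"
    and nontriv: "(u :: real ^ 'n) \<noteq> 0" "v \<noteq> 0" "proj_point u \<noteq> proj_point v"
  shows "elliptic_tube \<Omega> = proj_point ` tube"
proof (intro Set.set_eqI iffI)
  fix p assume "p \<in> elliptic_tube \<Omega>"
  then obtain v0 v1 where v: "v0 \<noteq> 0" "v1 \<noteq> 0" "proj_point v0 \<noteq> proj_point v1"
      "closed_segment_proj v0 v1 \<subseteq> \<Omega>" and p: "p \<in> elliptic_segment v0 v1"
    by (auto simp: elliptic_tube_def)
  have nz: "a *\<^sub>R v0 + b *\<^sub>R v1 \<noteq> 0" if "a \<noteq> 0 \<or> b \<noteq> 0" for a b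
  proof
    assume z: "a *\<^sub>R v0 + b *\<^sub>R v1 = 0"
    then have ab: "a \<noteq> 0" "b \<noteq> 0" using v that by auto
    from z have "b *\<^sub>R v1 = (- a) *\<^sub>R v0" by (simp add: add_eq_0_iff)
    then have "(1 / b) *\<^sub>R b *\<^sub>R v1 = (1 / b) *\<^sub>R (- a) *\<^sub>R v0" by (rule arg_cong)
    then have "v1 = (- a / b) *s v0" using ab by (simp add: scalar_mult_eq_scaleR)
    then have "proj_point v1 = proj_point v0" using ab by (metis proj_point_scale divide_eq_0_iff neg_equal_0_iff_equal)
    then show False using v by simp
  qed
  have seg: "a *\<^sub>R v0 + b *\<^sub>R v1 \<in> C \<union> uminus ` C" if "a * b \<ge> 0" "a \<noteq> 0 \<or> b \<noteq> 0" for a b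
  proof -
    have "proj_point (a *\<^sub>R v0 + b *\<^sub>R v1) \<in> \<Omega>"
      using v(4) nz[OF that(2)] that(1) unfolding closed_segment_proj_def
      by (force simp: scalar_mult_eq_scaleR)
    then show ?thesis using nz[OF that(2)] by (simp flip: \<Omega> add: lines_union_def)
  qed
  \<comment> \<open>The lifted segment is connected, so both endpoints lie in the same cone. Their
    common sign \<sigma> is absorbed by homogeneity.\<close>
  have "connected (closed_segment v0 v1)" by simp
  moreover have "open C" "open (uminus ` C)" using open_C by (simp_all add: open_negations)
  moreover have "C \<inter> uminus ` C \<inter> closed_segment v0 v1 = {}" using C_disjoint_uminus by auto
  moreover have "closed_segment v0 v1 \<subseteq> C \<union> uminus ` C"
  proof
    fix x assume "x \<in> closed_segment v0 v1"
    then obtain t where "0 \<le> t" "t \<le> 1" "x = (1 - t) *\<^sub>R v0 + t *\<^sub>R v1"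
      by (auto simp: closed_segment_def)
    then show "x \<in> C \<union> uminus ` C" using seg[of "1 - t" t] by auto
  qed
  ultimately have "C \<inter> closed_segment v0 v1 = {} \<or> uminus ` C \<inter> closed_segment v0 v1 = {}"
    by (intro connectedD)
  then have "(v0 \<in> C \<and> v1 \<in> C) \<or> (v0 \<in> uminus ` C \<and> v1 \<in> uminus ` C)"
    using seg[of 1 0] seg[of 0 1] ends_in_segment[of v0 v1] by auto
  then obtain \<sigma> x0 x1 where x: "x0 \<in> C" "x1 \<in> C" "\<sigma> \<noteq> (0::complex)" "cvec v0 = \<sigma> *s cvec x0" "cvec v1 = \<sigma> *s cvec x1"
  proof
    assume "v0 \<in> C \<and> v1 \<in> C" then show ?thesis using that[of v0 v1 1] by simp
  next
    assume "v0 \<in> uminus ` C \<and> v1 \<in> uminus ` C"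
    then obtain x0 x1 where "x0 \<in> C" "x1 \<in> C" "v0 = - x0" "v1 = - x1" by auto
    then show ?thesis using that[of x0 x1 "-1"] by (simp add: cvec_minus)
  qed
  obtain c0 c1 w where c: "w \<noteq> 0" "p = proj_point w" "Re (c0 * cnj c1) \<ge> 0" "w = c0 *s cvec v0 + c1 *s cvec v1"
    using p by (auto simp: elliptic_segment_def)
  have w: "w = \<sigma> *s (c0 *s cvec x0 + c1 *s cvec x1)"
    using c(4) x by (simp add: mult.commute)
  have "c0 *s cvec x0 + c1 *s cvec x1 \<in> tube"
  proof (cases "c1 = 0")
    case True
    then have "c0 \<noteq> 0" using c by auto
    then show ?thesis using True cvec_in_tube[OF x(1)] by (simp add: tube_scale_iff)
  next
    case False
    \<comment> \<open>Dividing by \<open>c1\<close> leaves \<open>W\<close> with real part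
      \<open>a x0 + x1\<close> in \<open>C\<close> and imaginary part \<open>b x0\<close>. For
      \<open>b > 0\<close> it lies in \<open>C + \<i> C\<close>, for \<open>b < 0\<close> this holds
      for \<open>\<i> W\<close>, and for \<open>b = 0\<close> it is a real point of
      \<open>C\<close>.\<close>
    define a b where "a = Re (c0 / c1)" and "b = Im (c0 / c1)"
    have a: "a \<ge> 0" using c(3) by (simp add: a_def complex_div_cnj[of c0] Re_divide_of_real flip: of_real_power)
    have c0: "c0 = c1 * (of_real a + \<i> * of_real b)"
      using False by (simp add: a_def b_def flip: complex_eq)
    have A: "a *\<^sub>R x0 + 1 *\<^sub>R x1 \<in> C" using a x by (intro C_combination) auto
    define W where "W = (of_real a + \<i> * of_real b) *s cvec x0 + cvec x1"
    consider "b = 0" | "b > 0" | "b < 0" by linarith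
    then have "W \<in> tube"
    proof cases
      case 1
      then show ?thesis using cvec_in_tube[OF A] by (simp add: W_def cvec_add cvec_scale)
    next
      case 2
      then have "cvec (a *\<^sub>R x0 + 1 *\<^sub>R x1) + \<i> *s cvec (b *\<^sub>R x0) \<in> tube"
        by (intro tubeI A cone_C x)
      also have "cvec (a *\<^sub>R x0 + 1 *\<^sub>R x1) + \<i> *s cvec (b *\<^sub>R x0) = W"
        by (simp add: W_def vec_eq_iff cvec_def algebra_simps)
      finally show ?thesis .
    next
      case 3
      then have "cvec ((- b) *\<^sub>R x0) + \<i> *s cvec (a *\<^sub>R x0 + 1 *\<^sub>R x1) \<in> tube"
        by (intro tubeI A cone_C x) auto
      also have "cvec ((- b) *\<^sub>R x0) + \<i> *s cvec (a *\<^sub>R x0 + 1 *\<^sub>R x1) = \<i> *s W"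
        by (simp add: W_def vec_eq_iff cvec_def algebra_simps)
      finally show ?thesis by (simp add: tube_scale_iff)
    qed
    then have "c1 *s W \<in> tube" using False by (simp add: tube_scale_iff)
    also have "c1 *s W = c0 *s cvec x0 + c1 *s cvec x1"
      unfolding W_def c0 by (simp only: vec.scale_right_distrib vec.scale_scale)
    finally show ?thesis .
  qed
  then have "w \<in> tube" unfolding w using tube_scale_iff[OF x(3)] by blast
  then show "p \<in> proj_point ` tube" using c(2) by blast
next
  have segI: "proj_point (c0 *s cvec x + c1 *s cvec y) \<in> elliptic_tube \<Omega>"
    if xy: "x \<in> C" "y \<in> C" "\<And>c. y \<noteq> c *\<^sub>R x" and c: "Re (c0 * cnj c1) \<ge> 0" "c0 *s cvec x + c1 *s cvec y \<noteq> 0"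
    for x y c0 c1
  proof -
    have nz: "x \<noteq> 0" "y \<noteq> 0" using xy zero_notin_C by auto
    have "proj_point x \<noteq> proj_point y"
      using xy(3) nz by (subst proj_point_eq_iff) (auto simp: scalar_mult_eq_scaleR)
    moreover have "closed_segment_proj x y \<subseteq> \<Omega>"
    proof
      fix p assume "p \<in> closed_segment_proj x y"
      then obtain a b where ab: "a *\<^sub>R x + b *\<^sub>R y \<noteq> 0" "a * b \<ge> 0" "p = proj_point (a *\<^sub>R x + b *\<^sub>R y)"
        by (auto simp: closed_segment_proj_def scalar_mult_eq_scaleR)
      then have ab0: "a \<noteq> 0 \<or> b \<noteq> 0" by auto
      have "a *\<^sub>R x + b *\<^sub>R y \<in> C \<union> uminus ` C"
      proof (cases "a \<ge> 0 \<and> b \<ge> 0")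
        case True
        then show ?thesis using C_combination[OF xy(1,2), of a b] ab0 by auto
      next
        case False
        then have "(- a) *\<^sub>R x + (- b) *\<^sub>R y \<in> C"
          using ab ab0 by (intro C_combination xy) (auto simp: zero_le_mult_iff)
        then have "- (a *\<^sub>R x + b *\<^sub>R y) \<in> C" by simp
        then have "- (- (a *\<^sub>R x + b *\<^sub>R y)) \<in> uminus ` C" by (rule imageI)
        then show ?thesis unfolding minus_minus by blast
      qed
      then show "p \<in> \<Omega>" using ab by (simp flip: \<Omega> add: lines_union_def)
    qed
    moreover have "proj_point (c0 *s cvec x + c1 *s cvec y) \<in> elliptic_segment x y"
      unfolding elliptic_segment_def using c by blast
    ultimately show ?thesis using nz unfolding elliptic_tube_def by blast
  qed
  fix p assume "p \<in> proj_point ` tube"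
  then obtain z where z: "z \<in> tube" "p = proj_point z" by blast
  obtain c x y where c: "c \<noteq> 0" "x \<in> C" "y \<in> C" "z = c *s (cvec x + \<i> *s cvec y)"
    using tube_cases[OF z(1)] by metis
  show "p \<in> elliptic_tube \<Omega>"
  proof (cases "\<exists>k. y = k *\<^sub>R x")
    case False
    have "proj_point ((1::complex) *s cvec x + \<i> *s cvec y) \<in> elliptic_tube \<Omega>"
      by (rule segI[OF c(2,3)]) (use False tubeI[OF c(2,3)] zero_notin_tube in auto)
    then show ?thesis unfolding z(2) c(4) proj_point_scale[OF c(1)] by simp
  next
    \<comment> \<open>Here \<open>z\<close> is a multiple of the real vector \<open>x\<close>, which
      is already an endpoint of an elliptic segment. The other endpoint must lie off the line of
      \<open>x\<close>; the two distinct points \<open>u\<close> and \<open>v\<close> guarantee a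
      direction \<open>s\<close> for it.\<close>
    case True
    then obtain k where k: "y = k *\<^sub>R x" by blast
    have x0: "x \<noteq> 0" using c zero_notin_C by auto
    have ex: "\<exists>e. e \<noteq> 0 \<and> x + e *\<^sub>R s \<in> C" for s
    proof (cases "s = 0")
      case False
      obtain e where e: "e > 0" "cball x e \<subseteq> C" using open_C c open_contains_cball by blast
      then have "x + (e / norm s) *\<^sub>R s \<in> C" using False by (intro subsetD[OF e(2)]) (simp add: dist_norm)
      then show ?thesis using e False by (intro exI[of _ "e / norm s"]) auto
    qed (use c in \<open>auto intro: exI[of _ 1]\<close>)
    have "\<exists>s. \<forall>a. s \<noteq> a *\<^sub>R x"
    proof (rule ccontr)
      assume "\<not> ?thesis"
      then obtain a b where "u = a *\<^sub>R x" "v = b *\<^sub>R x" by metis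
      then have "a \<noteq> 0" "b \<noteq> 0" "u = a *s x" "v = b *s x" using nontriv by (auto simp: scalar_mult_eq_scaleR)
      then show False using nontriv(3) by (simp add: proj_point_scale)
    qed
    then obtain s e where s: "\<And>a. s \<noteq> a *\<^sub>R x" and e: "e \<noteq> 0" "x + e *\<^sub>R s \<in> C" using ex by metis
    have ind: "x + e *\<^sub>R s \<noteq> a *\<^sub>R x" for a
    proof
      assume "x + e *\<^sub>R s = a *\<^sub>R x"
      then have "e *\<^sub>R s = (a - 1) *\<^sub>R x" by (simp add: algebra_simps)
      then have "(1 / e) *\<^sub>R e *\<^sub>R s = (1 / e) *\<^sub>R (a - 1) *\<^sub>R x" by (rule arg_cong)
      then show False using s[of "(a - 1) / e"] e by simp
    qed
    have "z = (c * (1 + \<i> * of_real k)) *s (1 *s cvec x + 0 *s cvec (x + e *\<^sub>R s))"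
      by (simp add: c(4) k cvec_scale vec_eq_iff algebra_simps)
    moreover have "1 + \<i> * of_real k \<noteq> 0" by (simp add: complex_eq_iff)
    then have "c * (1 + \<i> * of_real k) \<noteq> 0" using c(1) by simp
    moreover have "proj_point ((1::complex) *s cvec x + 0 *s cvec (x + e *\<^sub>R s)) \<in> elliptic_tube \<Omega>"
      by (rule segI[OF c(2) e(2) ind]) (use x0 in auto)
    ultimately show ?thesis using z(2) by (metis proj_point_scale)
  qed
qed

text \<open>Any two points of the tube are joined, up to scaling, by a segment in the convex set \<open>C + \<i> C\<close>.\<close>

lemma tube_relation_total:
  assumes sym: "\<And>z w. z \<in> tube \<Longrightarrow> w \<in> tube \<Longrightarrow> R z w \<Longrightarrow> R w z"
    and trans: "\<And>z w v. z \<in> tube \<Longrightarrow> w \<in> tube \<Longrightarrow> v \<in> tube \<Longrightarrow> R z w \<Longrightarrow> R w v \<Longrightarrow> R z v"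
    and scale: "\<And>z c. z \<in> tube \<Longrightarrow> c \<noteq> 0 \<Longrightarrow> R (c *s z) z"
    and local: "\<And>z. z \<in> tube \<Longrightarrow> \<exists>\<delta>>0. \<forall>w\<in>tube. dist z w < \<delta> \<longrightarrow> R z w"
    and zw: "z \<in> tube" "w \<in> tube"
  shows "R z w"
proof -
  define T where "T = {z. re_vec z \<in> C \<and> im_vec z \<in> C}"
  have TT: "T \<subseteq> tube"
  proof
    fix z assume "z \<in> T"
    then have "cvec (re_vec z) + \<i> *s cvec (im_vec z) \<in> tube" by (intro tubeI) (auto simp: T_def)
    then show "z \<in> tube" by (simp only: cvec_re_im)
  qed
  have "convex T"
  proof (rule convexI)
    fix x y and u v :: real assume "x \<in> T" "y \<in> T" "u \<ge> 0" "v \<ge> 0" "u + v = 1"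
    moreover have "re_vec (u *\<^sub>R x + v *\<^sub>R y) = u *\<^sub>R re_vec x + v *\<^sub>R re_vec y"
      "im_vec (u *\<^sub>R x + v *\<^sub>R y) = u *\<^sub>R im_vec x + v *\<^sub>R im_vec y"
      by (simp_all add: vec_eq_iff re_vec_def im_vec_def)
    ultimately show "u *\<^sub>R x + v *\<^sub>R y \<in> T" by (simp add: T_def convexD[OF convex_C])
  qed
  then have conT: "connected T" by (rule convex_connected)
  have onT: "R a b" if "a \<in> T" "b \<in> T" for a b
  proof -
    \<comment> \<open>\<open>R\<close> is controlled only inside the tube, so membership is built
      into the relation.\<close>
    define S where "S a b \<longleftrightarrow> a \<in> tube \<and> b \<in> tube \<and> R a b" for a b
    have "S a b"
    proof (rule connected_equivalence_relation[OF conT that])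
      show "S x y \<Longrightarrow> S y x" for x y using sym by (auto simp: S_def)
      show "S x y \<Longrightarrow> S y z \<Longrightarrow> S x z" for x y z using trans[of x y z] by (auto simp: S_def)
      fix a assume a: "a \<in> T"
      then obtain \<delta> where "\<delta> > 0" "\<And>w. w \<in> tube \<Longrightarrow> dist a w < \<delta> \<Longrightarrow> R a w" using local TT by blast
      then show "\<exists>U. openin (top_of_set T) U \<and> a \<in> U \<and> (\<forall>x\<in>U. S a x)"
        using TT a by (intro exI[of _ "T \<inter> ball a \<delta>"]) (auto simp: S_def)
    qed
    then show ?thesis by (simp add: S_def)
  qed
  have ex: "\<exists>t\<in>T. R z t \<and> R t z" if z: "z \<in> tube" for z
  proof -
    obtain c x y where c: "c \<noteq> 0" "x \<in> C" "y \<in> C" "z = c *s (cvec x + \<i> *s cvec y)"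
      using tube_cases[OF z] by metis
    have t: "cvec x + \<i> *s cvec y \<in> T" using c by (simp add: T_def)
    have "R z (cvec x + \<i> *s cvec y)" using scale[OF _ c(1), of "cvec x + \<i> *s cvec y"] t TT c(4) by auto
    then show ?thesis using t sym TT z by blast
  qed
  obtain t t' where "t \<in> T" "R z t" "t' \<in> T" "R t' w" using ex zw by blast
  then show ?thesis using onT[of t t'] trans zw TT by blast
qed

lemma close_bounded:
  assumes "z \<in> tube" "w \<in> tube" obtains e where "e \<ge> 0" "close e z w"
proof -
  have "\<exists>e\<ge>0. close e z w"
  proof (rule tube_relation_total[OF _ _ _ _ assms])
    show "\<exists>e\<ge>0. close e z w \<Longrightarrow> \<exists>e\<ge>0. close e w z" for z w using close_sym by blast
    show "\<exists>e\<ge>0. close e z w \<Longrightarrow> \<exists>e\<ge>0. close e w v \<Longrightarrow> \<exists>e\<ge>0. close e z v" for z w v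
      using close_trans by (metis add_nonneg_nonneg)
    show "\<exists>e\<ge>0. close e (c *s z) z" if "z \<in> tube" "c \<noteq> 0" for z c
      using that close_refl close_scale_left by blast
    show "\<exists>\<delta>>0. \<forall>w\<in>tube. dist z w < \<delta> \<longrightarrow> (\<exists>e\<ge>0. close e z w)" if "z \<in> tube" for z
      using close_nhd[OF that, of 1] by (metis zero_less_one zero_le_one)
  qed
  then show ?thesis using that by blast
qed

end

section \<open>Matrix representatives of projective transformations\<close>

definition cmat :: "real ^ 'n ^ 'n \<Rightarrow> complex ^ 'n ^ 'n" where
  "cmat A = (\<chi> i. cvec (A $ i))"

lemma cmat_mult_vec_nth: "(cmat A *v z) $ i = cdot (A $ i) z"
  by (simp add: cmat_def matrix_vector_mult_def cvec_def cdot_def)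

lemma cdot_cmat: "cdot f (cmat A *v z) = cdot (f v* A) z"
  by (simp add: cdot_def matrix_vector_mult_def vector_matrix_mult_def cmat_def cvec_def
      sum_distrib_left sum_distrib_right mult_ac) (rule sum.swap)

lemma cmat_cvec: "cmat A *v cvec x = cvec (A *v x)"
  by (simp add: vec_eq_iff cmat_mult_vec_nth cdot_cvec) (simp add: cvec_def matrix_vector_mult_def inner_vec_def)

lemma cmat_mult: "cmat (A ** B) = cmat A ** cmat B"
  by (simp add: vec_eq_iff cmat_def cvec_def matrix_matrix_mult_def)

lemma cmat_mat: "cmat (mat c) = mat (of_real c)"
  by (simp add: vec_eq_iff cmat_def cvec_def mat_def)

lemma mat_mult_vec: "mat c *v v = c *s v" for v :: "'k::field ^ 'n"
  by (simp add: vec_eq_iff matrix_vector_mult_def mat_def if_distrib[of "\<lambda>x. x * _"] cong: if_cong)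

lemma continuous_on_cmat [continuous_intros]:
  "continuous_on S g \<Longrightarrow> continuous_on S (\<lambda>x. cmat A *v g x)"
  unfolding matrix_vector_mult_def by (intro continuous_intros)

section \<open>Projective transformations as classes of matrices modulo scalars\<close>

lemma scalars_coset: "scalars #>\<^bsub>GL\<^esub> A = {mat c ** A | c. c \<noteq> 0}"
  by (auto simp: r_coset_def scalars_def GL_def)

lemma PGL_carrier_coset:
  fixes g :: "('k::field ^ 'n ^ 'n) set"
  assumes g: "g \<in> carrier PGL" and A: "A \<in> g"
  shows "invertible A" "g = scalars #>\<^bsub>GL\<^esub> A"
proof -
  obtain B where B: "B \<in> carrier GL" "g = scalars #>\<^bsub>GL\<^esub> B"
    using g by (auto simp: PGL_def FactGroup_def RCOSETS_def)
  show "g = scalars #>\<^bsub>GL\<^esub> A"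
    using group.repr_independence[OF group_GL A[unfolded B(2)] B(1) normal_imp_subgroup[OF normal_scalars]] B
    by simp
  obtain c where c: "c \<noteq> 0" "A = mat c ** B" using A B(2) by (auto simp: scalars_coset)
  have "scalars \<subseteq> carrier GL" using normal_imp_subgroup[OF normal_scalars] subgroup.subset by blast
  then have "invertible (mat c :: 'k ^ 'n ^ 'n)" using c(1) by (auto simp: scalars_def GL_def)
  then show "invertible A" using B(1) unfolding c(2) by (auto simp: GL_def intro: invertible_mult)
qed

lemma PGL_carrier_nonempty: "g \<in> carrier PGL \<Longrightarrow> \<exists>A. A \<in> g"
proof -
  assume "g \<in> carrier PGL"
  then obtain B where B: "g = scalars #>\<^bsub>GL\<^esub> B"
    by (auto simp: PGL_def FactGroup_def RCOSETS_def)
  have "mat 1 ** B \<in> g" unfolding B scalars_coset by (intro CollectI exI[of _ 1]) simp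
  then show ?thesis by blast
qed

lemma PGL_mult_coset:
  assumes "invertible A" "invertible B"
  shows "(scalars #>\<^bsub>GL\<^esub> A) \<otimes>\<^bsub>PGL\<^esub> (scalars #>\<^bsub>GL\<^esub> B) = scalars #>\<^bsub>GL\<^esub> (A ** B)"
  using normal.rcos_sum[OF normal_scalars, of A B] assms by (simp add: PGL_def FactGroup_def GL_def)

lemma PGL_one_coset: "\<one>\<^bsub>PGL\<^esub> = scalars #>\<^bsub>GL\<^esub> (mat 1)"
  unfolding scalars_coset by (simp add: PGL_def FactGroup_def scalars_def)

lemma coset_self: "A \<in> scalars #>\<^bsub>GL\<^esub> A"
  unfolding scalars_coset by (intro CollectI exI[of _ 1]) simp

lemma pgl_complexify_coset: "pgl_complexify (scalars #>\<^bsub>GL\<^esub> A) = scalars #>\<^bsub>GL\<^esub> cmat A"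
proof -
  have "pgl_complexify (scalars #>\<^bsub>GL\<^esub> A) = {mat c ** cmat (mat d ** A) | c d. c \<noteq> 0 \<and> d \<noteq> 0}"
    by (auto simp: pgl_complexify_def scalars_coset cmat_def)
  also have "\<dots> = {mat c ** cmat A | c. c \<noteq> 0}"
  proof (intro Set.set_eqI iffI)
    fix x assume "x \<in> {mat c ** cmat (mat d ** A) | c d. c \<noteq> 0 \<and> d \<noteq> 0}"
    then obtain c d where "c \<noteq> 0" "d \<noteq> 0" "x = mat (c * of_real d) ** cmat A"
      by (auto simp: cmat_mult cmat_mat matrix_mul_assoc mat_mult_mat)
    then show "x \<in> {mat c ** cmat A | c. c \<noteq> 0}"
      by (intro CollectI exI[of _ "c * of_real d"]) simp
  next
    fix x assume "x \<in> {mat c ** cmat A | c. c \<noteq> 0}"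
    then obtain c where "c \<noteq> 0" "x = mat c ** cmat (mat 1 ** A)" by auto
    then show "x \<in> {mat c ** cmat (mat d ** A) | c d. c \<noteq> 0 \<and> d \<noteq> 0}" by (metis (mono_tags, lifting) mem_Collect_eq zero_neq_one)
  qed
  finally show ?thesis by (simp add: scalars_coset)
qed

text \<open>For \<open>u\<close> of modulus \<open>1\<close> with argument \<theta>,
  \<open>d k\<close> is \<open>1 - cos (2 ^ k * \<theta>)\<close>. As \<open>1 - cos (2 * \<theta>)
  = 2 * (1 - cos \<theta>) * (1 + cos \<theta>)\<close> and all the cosines are positive,
  \<open>d\<close> at least doubles in each step, yet it stays below \<open>1\<close>. Hence
  \<open>d 0 = 0\<close> and \<open>u = 1\<close>.\<close>

lemma Re_powers_pos_imp_real_pos: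
  fixes c :: complex
  assumes "\<And>k. Re (c ^ k) > 0" shows "Im c = 0" "Re c > 0"
proof -
  show "Re c > 0" using assms[of 1] by simp
  then have c0: "c \<noteq> 0" by auto
  define u where "u = c / of_real (cmod c)"
  have u1: "cmod u = 1" using c0 by (simp add: u_def norm_divide)
  have upos: "Re (u ^ k) > 0" for k
  proof -
    have "u ^ k = c ^ k / of_real (cmod c ^ k)" by (simp add: u_def power_divide)
    then show ?thesis using assms[of k] c0 by (simp only: Re_divide_of_real) simp
  qed
  define d where "d k = 1 - Re (u ^ (2 ^ k))" for k :: nat
  have step: "d (Suc k) \<ge> 2 * d k" for k
  proof -
    define w where "w = u ^ (2 ^ k)"
    have w1: "(Re w)\<^sup>2 + (Im w)\<^sup>2 = 1" using u1 by (simp add: w_def norm_power flip: cmod_power2)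
    have "u ^ (2 ^ Suc k) = w * w" by (simp add: w_def mult_2 flip: power_add)
    then have "d (Suc k) = 2 - 2 * (Re w)\<^sup>2" using w1 by (simp add: d_def power2_eq_square)
    also have "\<dots> = 2 * (1 - Re w) * (1 + Re w)" by (simp add: algebra_simps power2_eq_square)
    also have "\<dots> \<ge> 2 * (1 - Re w) * 1"
    proof (rule mult_left_mono)
      show "1 \<le> 1 + Re w" using upos[of "2 ^ k"] by (simp add: w_def)
      have "Re w \<le> 1" using complex_Re_le_cmod[of w] u1 by (simp add: w_def norm_power)
      then show "0 \<le> 2 * (1 - Re w)" by simp
    qed
    finally show ?thesis by (simp add: d_def w_def)
  qed
  have grow: "d k \<ge> 2 ^ k * d 0" for k
  proof (induction k)
    case (Suc k) then show ?case using step[of k] by simp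
  qed simp
  have "d 0 \<le> 0"
  proof (rule ccontr)
    assume n: "\<not> d 0 \<le> 0"
    obtain k where "1 / d 0 < 2 ^ k" using real_arch_pow[of 2] by auto
    then have "2 ^ k * d 0 > 1" using n by (simp add: field_simps)
    then show False using grow[of k] upos[of "2 ^ k"] by (simp add: d_def)
  qed
  then have "Re u \<ge> 1" by (simp add: d_def)
  moreover have "(Re u)\<^sup>2 + (Im u)\<^sup>2 = 1" using u1 by (simp flip: cmod_power2)
  moreover have "(Re u)\<^sup>2 \<ge> 1" using \<open>Re u \<ge> 1\<close> by (rule one_le_power)
  ultimately have "(Im u)\<^sup>2 \<le> 0" by linarith
  moreover have "Im u = Im c / cmod c" by (simp only: u_def Im_divide_of_real)
  ultimately show "Im c = 0" using c0 by simp
qed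

section \<open>The action on the tube\<close>

locale cone_action = based_cone C \<psi> r for C :: "(real ^ 'n) set" and \<psi> r +
  fixes \<Omega> :: "(real ^ 'n) set set" and \<Gamma> :: "(real ^ 'n ^ 'n) set set"
  assumes subgroup_\<Gamma>: "subgroup \<Gamma> PGL"
    and acts: "acts_on \<Gamma> \<Omega>" and free: "acts_freely \<Gamma> \<Omega>"
    and pd: "acts_properly_discontinuously \<Gamma> \<Omega>"
    and lines_\<Omega>: "lines_union \<Omega> = C \<union> uminus ` C"
    and tube_eq: "elliptic_tube \<Omega> = proj_point ` tube"
begin

text \<open>The full preimage of \<Gamma> in the general linear group, closed under nonzero real
  factors, so that computations use matrices instead of classes.\<close>

definition G :: "(real ^ 'n ^ 'n) set" where "G = \<Union> \<Gamma>"

lemma \<Gamma>_carrier: "g \<in> \<Gamma> \<Longrightarrow> g \<in> carrier PGL"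
  using subgroup.subset[OF subgroup_\<Gamma>] by blast

lemma \<Gamma>_coset: "g \<in> \<Gamma> \<Longrightarrow> A \<in> g \<Longrightarrow> g = scalars #>\<^bsub>GL\<^esub> A"
  and \<Gamma>_invertible: "g \<in> \<Gamma> \<Longrightarrow> A \<in> g \<Longrightarrow> invertible A"
  using PGL_carrier_coset \<Gamma>_carrier by blast+

lemma G_iff: "A \<in> G \<longleftrightarrow> scalars #>\<^bsub>GL\<^esub> A \<in> \<Gamma>"
  using \<Gamma>_coset coset_self unfolding G_def by blast

lemma G_invertible: "A \<in> G \<Longrightarrow> invertible A"
  using \<Gamma>_invertible by (auto simp: G_def)

lemma G_mult: "A \<in> G \<Longrightarrow> B \<in> G \<Longrightarrow> A ** B \<in> G"
  using subgroup.m_closed[OF subgroup_\<Gamma>] PGL_mult_coset[OF G_invertible G_invertible] by (metis G_iff)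

lemma G_one: "mat 1 \<in> G"
  using subgroup.one_closed[OF subgroup_\<Gamma>] by (simp add: G_iff PGL_one_coset)

lemma G_scale: "c \<noteq> 0 \<Longrightarrow> A \<in> G \<Longrightarrow> mat c ** A \<in> G"
proof -
  assume "c \<noteq> 0" "A \<in> G"
  then have "mat c ** A \<in> scalars #>\<^bsub>GL\<^esub> A" "scalars #>\<^bsub>GL\<^esub> A \<in> \<Gamma>"
    by (auto simp: scalars_coset G_iff)
  then show ?thesis unfolding G_def by blast
qed

lemma G_inverse: assumes A: "A \<in> G" obtains B where "B \<in> G" "B ** A = mat 1"
proof -
  define g where "g = scalars #>\<^bsub>GL\<^esub> A"
  have g: "g \<in> \<Gamma>" using A by (simp add: g_def G_iff)
  then have i: "inv\<^bsub>PGL\<^esub> g \<in> \<Gamma>" using subgroup.m_inv_closed[OF subgroup_\<Gamma>] by blast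
  obtain B where B: "B \<in> inv\<^bsub>PGL\<^esub> g" using PGL_carrier_nonempty \<Gamma>_carrier[OF i] by blast
  have "inv\<^bsub>PGL\<^esub> g = scalars #>\<^bsub>GL\<^esub> B" using \<Gamma>_coset[OF i B] .
  then have "scalars #>\<^bsub>GL\<^esub> (B ** A) = \<one>\<^bsub>PGL\<^esub>"
    using group.l_inv[OF group_PGL \<Gamma>_carrier[OF g]] PGL_mult_coset[OF \<Gamma>_invertible[OF i B] G_invertible[OF A]]
    by (simp add: g_def)
  then have "B ** A \<in> scalars #>\<^bsub>GL\<^esub> (mat 1)" using coset_self[of "B ** A"] by (simp add: PGL_one_coset)
  then obtain c where c: "c \<noteq> 0" "B ** A = mat c" by (auto simp: scalars_coset)
  have BG: "B \<in> G" using B i by (auto simp: G_def)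
  \<comment> \<open>A representative of the inverse class inverts \<open>A\<close> only up to a
    scalar, which is divided out.\<close>
  show ?thesis
  proof (rule that[of "mat (1 / c) ** B"])
    show "mat (1 / c) ** B \<in> G" using G_scale BG c by simp
    show "mat (1 / c) ** B ** A = mat 1" using c by (simp add: mat_mult_mat flip: matrix_mul_assoc)
  qed
qed

lemma pgl_act_\<Gamma>: "g \<in> \<Gamma> \<Longrightarrow> A \<in> g \<Longrightarrow> pgl_act g (proj_point v) = proj_point (A *v v)"
  using \<Gamma>_coset pgl_act_class by metis

lemma cx_orbit_proj_point: "cx_orbit \<Gamma> (proj_point v) = {proj_point (cmat A *v v) | A. A \<in> G}"
proof -
  have act: "pgl_act (pgl_complexify g) (proj_point v) = proj_point (cmat A *v v)" if "g \<in> \<Gamma>" "A \<in> g" for g A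
    using \<Gamma>_coset[OF that] pgl_complexify_coset pgl_act_class by metis
  have "\<exists>A. A \<in> g" if "g \<in> \<Gamma>" for g using PGL_carrier_nonempty \<Gamma>_carrier that by blast
  then have "\<exists>A\<in>G. pgl_act (pgl_complexify g) (proj_point v) = proj_point (cmat A *v v)" if "g \<in> \<Gamma>" for g
    using act that unfolding G_def by blast
  then show ?thesis using act unfolding cx_orbit_def pgl_orbit_def G_def by blast
qed

text \<open>The quotient map in homogeneous coordinates: it passes from vectors to lines and from
  lines to orbits at once.\<close>

definition P :: "complex ^ 'n \<Rightarrow> (complex ^ 'n) set set" where
  "P v = cx_orbit \<Gamma> (proj_point v)"

lemma cmat_inverse: "B ** A = mat 1 \<Longrightarrow> cmat B *v (cmat A *v v) = v"
  by (simp add: matrix_vector_mul_assoc cmat_mat flip: cmat_mult)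

lemma P_act: "A \<in> G \<Longrightarrow> P (cmat A *v v) = P v"
proof -
  assume A: "A \<in> G"
  obtain B where B: "B \<in> G" "B ** A = mat 1" using G_inverse[OF A] .
  have 1: "cmat D *v v = cmat (D ** B) *v (cmat A *v v)" for D
    using B by (simp add: matrix_vector_mul_assoc cmat_mat flip: cmat_mult matrix_mul_assoc)
  have 2: "cmat D *v (cmat A *v v) = cmat (D ** A) *v v" for D
    by (simp add: matrix_vector_mul_assoc flip: cmat_mult)
  show ?thesis unfolding P_def cx_orbit_proj_point
  proof (intro Set.set_eqI iffI)
    fix p assume "p \<in> {proj_point (cmat D *v (cmat A *v v)) |D. D \<in> G}"
    then obtain D where D: "D \<in> G" "p = proj_point (cmat D *v (cmat A *v v))" by blast
    then have "p = proj_point (cmat (D ** A) *v v)" by (simp only: 2)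
    then show "p \<in> {proj_point (cmat D *v v) |D. D \<in> G}" using G_mult[OF D(1) A] by blast
  next
    fix p assume "p \<in> {proj_point (cmat D *v v) |D. D \<in> G}"
    then obtain D where D: "D \<in> G" "p = proj_point (cmat D *v v)" by blast
    then have "p = proj_point (cmat (D ** B) *v (cmat A *v v))" by (simp only: 1[of D])
    then show "p \<in> {proj_point (cmat D *v (cmat A *v v)) |D. D \<in> G}" using G_mult[OF D(1) B(1)] by blast
  qed
qed

lemma P_scale: "c \<noteq> 0 \<Longrightarrow> P (c *s v) = P v"
  by (simp add: P_def proj_point_scale)

lemma P_eq_iff:
  assumes "w \<noteq> 0"
  shows "P v = P w \<longleftrightarrow> (\<exists>A\<in>G. \<exists>c. c \<noteq> 0 \<and> w = c *s (cmat A *v v))"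
proof
  assume "P v = P w"
  moreover have "proj_point w \<in> P w"
    unfolding P_def cx_orbit_proj_point using G_one by (auto simp: cmat_mat intro!: exI[of _ "mat 1"])
  ultimately have "proj_point w \<in> P v" by simp
  then obtain A where "A \<in> G" "proj_point (cmat A *v v) = proj_point w"
    unfolding P_def cx_orbit_proj_point by auto
  then show "\<exists>A\<in>G. \<exists>c. c \<noteq> 0 \<and> w = c *s (cmat A *v v)" using assms by (auto simp: proj_point_eq_iff)
qed (auto simp: P_scale P_act)

lemma G_maps_lines: "A \<in> G \<Longrightarrow> x \<in> C \<Longrightarrow> A *v x \<in> C \<union> uminus ` C"
proof -
  assume A: "A \<in> G" and x: "x \<in> C"
  obtain g where g: "g \<in> \<Gamma>" "A \<in> g" using A by (auto simp: G_def)
  have "x \<in> lines_union \<Omega>" using x by (simp add: lines_\<Omega>)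
  then have "proj_point x \<in> \<Omega>" by (simp add: lines_union_def)
  then have "pgl_act g (proj_point x) \<in> \<Omega>" using acts g by (auto simp: acts_on_def)
  then have "proj_point (A *v x) \<in> \<Omega>" using pgl_act_\<Gamma> g by simp
  moreover have "A *v x \<noteq> 0"
    using G_inverse[OF A] x zero_notin_C by (metis matrix_vector_mul_assoc matrix_vector_mul_lid matrix_vector_mult_0_right)
  ultimately show ?thesis by (simp flip: lines_\<Omega> add: lines_union_def)
qed

text \<open>The image of \<open>C\<close> is connected and lies in the disjoint open union of
  \<open>C\<close> and \<open>- C\<close>.\<close>

lemma G_sign:
  assumes A: "A \<in> G"
  obtains \<sigma> where "\<sigma> = 1 \<or> \<sigma> = -1" "\<And>x. x \<in> C \<Longrightarrow> \<sigma> *\<^sub>R (A *v x) \<in> C"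
proof -
  have "connected ((*v) A ` C)"
    by (intro connected_continuous_image convex_connected convex_C matrix_vector_mult_linear_continuous_on)
  moreover have "C \<inter> uminus ` C \<inter> (*v) A ` C = {}" using C_disjoint_uminus by auto
  moreover have "open (uminus ` C)" using open_C by (simp add: open_negations)
  moreover have "(*v) A ` C \<subseteq> C \<union> uminus ` C" using G_maps_lines[OF A] by blast
  ultimately have "C \<inter> (*v) A ` C = {} \<or> uminus ` C \<inter> (*v) A ` C = {}"
    using open_C by (intro connectedD)
  then show ?thesis
  proof
    assume n: "C \<inter> (*v) A ` C = {}"
    have "(-1) *\<^sub>R (A *v x) \<in> C" if "x \<in> C" for x
      using G_maps_lines[OF A that] n that by auto
    then show ?thesis using that by blast
  next
    assume n: "uminus ` C \<inter> (*v) A ` C = {}"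
    have "1 *\<^sub>R (A *v x) \<in> C" if "x \<in> C" for x
      using G_maps_lines[OF A that] n that by auto
    then show ?thesis using that by blast
  qed
qed

lemma dual_act:
  assumes A: "A \<in> G"
  obtains \<sigma> where "\<sigma> = 1 \<or> \<sigma> = -1" "\<And>f. f \<in> dual \<Longrightarrow> \<sigma> *\<^sub>R (f v* A) \<in> dual"
proof -
  obtain \<sigma> where \<sigma>: "\<sigma> = 1 \<or> \<sigma> = -1" "\<And>x. x \<in> C \<Longrightarrow> \<sigma> *\<^sub>R (A *v x) \<in> C" using G_sign[OF A] by metis
  have pos: "(\<sigma> *\<^sub>R (f v* A)) \<bullet> x > 0" if "f \<in> dual" "x \<in> C" for f x
    using dual_pos[OF that(1) \<sigma>(2)[OF that(2)]] by (simp add: dot_lmul_matrix)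
  have "\<sigma> *\<^sub>R (f v* A) \<in> dual" if f: "f \<in> dual" for f
  proof -
    obtain c where "c \<in> C" using nonempty_C by blast
    then have "\<sigma> *\<^sub>R (f v* A) \<noteq> 0" using pos[OF f] by fastforce
    then show ?thesis using pos[OF f] by (auto simp: dual_def less_imp_le)
  qed
  then show ?thesis using that \<sigma> by blast
qed

text \<open>\<open>A\<close> permutes the dual functionals up to a sign \<sigma> that is the same
  for all of them, and this sign cancels in a product or quotient of two of their values.\<close>

lemma tube_act_close_act:
  assumes A: "A \<in> G"
  shows "z \<in> tube \<Longrightarrow> cmat A *v z \<in> tube" and "close e z w \<Longrightarrow> close e (cmat A *v z) (cmat A *v w)"
proof -
  obtain \<sigma> where \<sigma>: "\<sigma> = 1 \<or> \<sigma> = -1" "\<And>f. f \<in> dual \<Longrightarrow> \<sigma> *\<^sub>R (f v* A) \<in> dual" using dual_act[OF A] by metis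
  have sc: "cdot f (cmat A *v z) = of_real \<sigma> * cdot (\<sigma> *\<^sub>R (f v* A)) z" for f z
    using \<sigma>(1) by (auto simp: cdot_cmat cdot_scale_left cdot_minus_left)
  have cp: "cone_pair f g (cmat A *v z) = cone_pair (\<sigma> *\<^sub>R (f v* A)) (\<sigma> *\<^sub>R (g v* A)) z" for f g z
    using \<sigma>(1) unfolding cone_pair_def sc by auto
  have cr: "cone_ratio f g s (cmat A *v z) = cone_ratio (\<sigma> *\<^sub>R (f v* A)) (\<sigma> *\<^sub>R (g v* A)) s z" for f g s z
  proof -
    have nz: "complex_of_real \<sigma> \<noteq> 0" using \<sigma>(1) by auto
    have "of_real \<sigma> * b + \<i> * of_real s * (of_real \<sigma> * a) = of_real \<sigma> * (b + \<i> * of_real s * a)" for a b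
      by (simp add: algebra_simps)
    then show ?thesis unfolding cone_ratio_def sc by (simp only: mult_divide_mult_cancel_left[OF nz])
  qed
  show "z \<in> tube \<Longrightarrow> cmat A *v z \<in> tube" using \<sigma>(2) by (simp add: tube_def cp)
  show "close e z w \<Longrightarrow> close e (cmat A *v z) (cmat A *v w)" using \<sigma>(2) by (simp add: close_def cr)
qed

lemmas tube_act = tube_act_close_act(1) and close_act = tube_act_close_act(2)

text \<open>An eigenvector in \<open>C\<close> is a fixed point of the class of \<open>A\<close> in
  \<Omega>, where the action is free.\<close>

lemma G_fix_imp_scalar:
  assumes A: "A \<in> G" and x: "x \<in> C" and eig: "A *v x = c *\<^sub>R x"
  shows "A \<in> scalars"
proof -
  obtain g where g: "g \<in> \<Gamma>" "A \<in> g" using A by (auto simp: G_def)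
  have x0: "x \<noteq> 0" "x \<in> lines_union \<Omega>" using x zero_notin_C by (auto simp: lines_\<Omega>)
  then have "proj_point x \<in> \<Omega>" by (simp add: lines_union_def)
  have "A *v x \<noteq> 0"
    using G_inverse[OF A] x0 by (metis matrix_vector_mul_assoc matrix_vector_mul_lid matrix_vector_mult_0_right)
  then have "c \<noteq> 0" using eig by auto
  then have "pgl_act g (proj_point x) = proj_point x"
    using pgl_act_\<Gamma>[OF g] eig by (simp add: proj_point_scale flip: scalar_mult_eq_scaleR)
  then have "g = \<one>\<^bsub>PGL\<^esub>" using free g \<open>proj_point x \<in> \<Omega>\<close> by (auto simp: acts_freely_def)
  then show ?thesis using g unfolding PGL_one_coset scalars_coset by (auto simp: scalars_def)
qed

text \<open>If \<open>z\<close> is an eigenvector with eigenvalue \<open>c\<close>, then \<open>c ^ k \<psi> z\<close> is the value at \<open>z\<close> of an element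
  of the dual cone, so all powers of \<open>c\<close> have positive real part and \<open>c\<close> is a positive real.\<close>

lemma tube_fix_imp_scalar_pos:
  assumes A: "A \<in> G" and pos: "\<And>f. f \<in> dual \<Longrightarrow> f v* A \<in> dual"
    and z: "z \<in> tube" and eig: "cmat A *v z = c *s z"
  shows "A \<in> scalars"
proof -
  define F where "F k = ((\<lambda>f. f v* A) ^^ k) \<psi>" for k
  have F: "F k \<in> dual" for k by (induction k) (simp_all add: F_def base_dual pos)
  have cF: "cdot (F k) z = c ^ k * cdot \<psi> z" for k
  proof (induction k)
    case (Suc k)
    have "cdot (F (Suc k)) z = cdot (F k) (cmat A *v z)" by (simp add: F_def cdot_cmat)
    then show ?case using Suc by (simp add: eig cdot_scale)
  qed (simp add: F_def)
  have "Re (c ^ k) > 0" for k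
  proof -
    have "0 < cone_pair (F k) \<psi> z" using z F base_dual by (auto simp: tube_def)
    also have "\<dots> = Re (c ^ k * (cdot \<psi> z * cnj (cdot \<psi> z)))" by (simp add: cone_pair_def cF mult.assoc)
    also have "\<dots> = Re (c ^ k) * (cmod (cdot \<psi> z))\<^sup>2" by (simp flip: complex_norm_square of_real_power)
    finally show ?thesis by (simp add: zero_less_mult_iff)
  qed
  then have c: "Im c = 0" using Re_powers_pos_imp_real_pos by blast
  obtain d x y where d: "d \<noteq> 0" "x \<in> C" "y \<in> C" "z = d *s (cvec x + \<i> *s cvec y)"
    using tube_cases[OF z] by metis
  have "d *s (cmat A *v (cvec x + \<i> *s cvec y)) = cmat A *v z"
    unfolding d(4) by (rule vector_scalar_commute[symmetric])
  also have "\<dots> = d *s (c *s (cvec x + \<i> *s cvec y))"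
    unfolding eig unfolding d(4) by (simp only: vec.scale_scale mult.commute)
  finally have "d *s (cmat A *v (cvec x + \<i> *s cvec y)) = d *s (c *s (cvec x + \<i> *s cvec y))" .
  then have "cmat A *v (cvec x + \<i> *s cvec y) = c *s (cvec x + \<i> *s cvec y)"
    using d(1) by (simp only: vec.scale_cancel_left) simp
  \<comment> \<open>The eigenvalue is real, so real parts can be compared; they give a real
    eigenvector \<open>x\<close> in \<open>C\<close>.\<close>
  then have "re_vec (cvec (A *v x) + \<i> *s cvec (A *v y)) = re_vec (c *s (cvec x + \<i> *s cvec y))"
    by (simp only: matrix_vector_right_distrib vector_scalar_commute cmat_cvec)
  then have "A *v x = Re c *\<^sub>R x"
    using c by (simp add: vec_eq_iff re_vec_def cvec_def)
  then show ?thesis using G_fix_imp_scalar[OF A d(2)] by blast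
qed

text \<open>Multiplying \<open>A\<close> by its sign \<sigma> reduces the claim to a matrix that
  preserves the dual cone, without changing the projective class.\<close>

lemma tube_fix_imp_scalar:
  assumes A: "A \<in> G" and z: "z \<in> tube" and eig: "cmat A *v z = c *s z"
  shows "A \<in> scalars"
proof -
  obtain \<sigma> where \<sigma>: "\<sigma> = 1 \<or> \<sigma> = -1" "\<And>f. f \<in> dual \<Longrightarrow> \<sigma> *\<^sub>R (f v* A) \<in> dual" using dual_act[OF A] by metis
  have \<sigma>0: "\<sigma> \<noteq> 0" using \<sigma> by auto
  have "mat \<sigma> ** A \<in> scalars"
  proof (rule tube_fix_imp_scalar_pos)
    show "mat \<sigma> ** A \<in> G" using A \<sigma>0 G_scale by blast
    have "f v* (mat \<sigma> ** A) = \<sigma> *\<^sub>R (f v* A)" for f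
      by (simp add: vec_eq_iff vector_matrix_mult_def mat_mult_eq sum_distrib_left mult_ac)
    then show "f v* (mat \<sigma> ** A) \<in> dual" if "f \<in> dual" for f using \<sigma>(2)[OF that] by simp
    show "cmat (mat \<sigma> ** A) *v z = (of_real \<sigma> * c) *s z"
      by (simp add: cmat_mult cmat_mat eig mat_mult_vec flip: matrix_vector_mul_assoc)
  qed (rule z)
  then obtain k where "k \<noteq> 0" "mat \<sigma> ** A = mat k" by (auto simp: scalars_def)
  then have "mat (1 / \<sigma>) ** (mat \<sigma> ** A) = mat (k / \<sigma>)" by (simp add: mat_mult_mat)
  then have "A = mat (k / \<sigma>)" using \<sigma>0 by (simp add: matrix_mul_assoc mat_mult_mat)
  then show ?thesis using \<open>k \<noteq> 0\<close> \<sigma>0 by (auto simp: scalars_def)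
qed

text \<open>Transfer of proper discontinuity from \<Omega>. If \<open>z\<close> and its translate
  are close, then so are a real point \<open>x1\<close> and its translate, with twice the distance
  from \<open>x1\<close> to \<open>z\<close> added. The translate then lies in a fixed compact set
  of real points.\<close>

lemma finite_close_translates:
  assumes z: "z \<in> tube"
  shows "finite {g \<in> \<Gamma>. \<exists>A\<in>g. close e z (cmat A *v z)}"
proof -
  obtain x0 where x0: "x0 \<in> C" using nonempty_C by blast
  define x1 where "x1 = (1 / (\<psi> \<bullet> x0)) *\<^sub>R x0"
  have px: "\<psi> \<bullet> x0 > 0" using dual_pos[OF base_dual x0] .
  have x1: "x1 \<in> C" using cone_C x0 px by (simp add: x1_def)
  have x1t: "cvec x1 \<in> tube" using cvec_in_tube x1 .
  obtain e1 where e1: "close e1 (cvec x1) z" using close_bounded[OF x1t z] .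
  obtain K where K: "compact K" "K \<subseteq> tube" "\<And>w. w \<in> K \<Longrightarrow> cdot \<psi> w = 1"
    "\<And>w. w \<in> tube \<Longrightarrow> cdot \<psi> w = 1 \<Longrightarrow> close (e1 + e + e1) (cvec x1) w \<Longrightarrow> w \<in> K"
    using close_ball_compact[OF x1t] by metis
  \<comment> \<open>With \<open>x1\<close> itself in \<open>L\<close>, every class counted here
    carries a point of \<open>L\<close> to a point of \<open>L\<close>.\<close>
  define L where "L = insert x1 {x. cvec x \<in> K}"
  have "closed {x. cvec x \<in> K}"
    using closed_vimage[OF compact_imp_closed[OF K(1)], of cvec] continuous_on_cvec[OF continuous_on_id, of UNIV]
    by (simp add: vimage_def)
  moreover have "bounded {x. cvec x \<in> K}"
  proof -
    obtain b where b: "\<And>w. w \<in> K \<Longrightarrow> norm w \<le> b" using compact_imp_bounded[OF K(1)] by (auto simp: bounded_iff)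
    have "norm (cvec x) = norm x" for x :: "real ^ 'n" by (simp add: norm_vec_def cvec_def)
    then show ?thesis using b by (auto simp: bounded_iff intro!: exI[of _ b]) metis
  qed
  ultimately have cL: "compact L" unfolding L_def by (intro compact_insert) (simp add: compact_eq_bounded_closed)
  have LC: "L \<subseteq> C"
  proof
    fix x assume "x \<in> L"
    then consider "x = x1" | "cvec x \<in> K" by (auto simp: L_def)
    then show "x \<in> C"
    proof cases
      case 2
      \<comment> \<open>The normalisation on the slice excludes the case of \<open>- x\<close> in
        \<open>C\<close>.\<close>
      then have "x \<in> C \<or> - x \<in> C" "\<psi> \<bullet> x = 1" using cvec_in_tube_cases K(2) K(3)[OF 2] by (auto simp: cdot_cvec)
      then show ?thesis using dual_pos[OF base_dual, of "- x"] by auto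
    qed (use x1 in simp)
  qed
  have sub: "proj_point ` L \<subseteq> \<Omega>"
  proof
    fix p assume "p \<in> proj_point ` L"
    then obtain x where "x \<in> C" "p = proj_point x" using LC by blast
    moreover have "x \<in> lines_union \<Omega>" using \<open>x \<in> C\<close> by (simp add: lines_\<Omega>)
    ultimately show "p \<in> \<Omega>" by (simp add: lines_union_def)
  qed
  have "compactin (top_of_set (- {0})) L"
    using cL LC zero_notin_C by (auto simp: compactin_subtopology)
  then have "compactin proj_topology (proj_point ` L)"
    unfolding proj_topology_def
    by (rule image_compactin) (rule quotient_imp_continuous_map[OF quotient_map_quot_top])
  then have fin: "finite {g \<in> \<Gamma>. pgl_act g ` (proj_point ` L) \<inter> proj_point ` L \<noteq> {}}"
    using pd sub unfolding acts_properly_discontinuously_def by blast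
  have "pgl_act g ` (proj_point ` L) \<inter> proj_point ` L \<noteq> {}"
    if g: "g \<in> \<Gamma>" "A \<in> g" and cl: "close e z (cmat A *v z)" for g A
  proof -
    have A: "A \<in> G" using g by (auto simp: G_def)
    have "close (e1 + e) (cvec x1) (cmat A *v z)" using close_trans[OF e1 cl] .
    moreover have "close e1 (cmat A *v z) (cmat A *v cvec x1)" using close_act[OF A close_sym[OF e1]] .
    ultimately have c2: "close (e1 + e + e1) (cvec x1) (cvec (A *v x1))"
      using close_trans by (metis cmat_cvec)
    have "cvec (A *v x1) \<in> tube" using tube_act[OF A x1t] by (simp add: cmat_cvec)
    define k where "k = \<psi> \<bullet> (A *v x1)"
    have k: "k \<noteq> 0" using cdot_nz[OF \<open>cvec (A *v x1) \<in> tube\<close> base_dual] by (simp add: cdot_cvec k_def)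
    define u where "u = (1 / k) *\<^sub>R (A *v x1)"
    have cu: "cvec u = of_real (1 / k) *s cvec (A *v x1)" by (simp only: u_def cvec_scale)
    have "cvec u \<in> K"
    proof (rule K(4))
      show "cvec u \<in> tube" unfolding cu using \<open>cvec (A *v x1) \<in> tube\<close> k by (subst tube_scale_iff) auto
      show "cdot \<psi> (cvec u) = 1" using k by (simp add: u_def cdot_cvec k_def)
      show "close (e1 + e + e1) (cvec x1) (cvec u)" unfolding cu using c2 k by (subst close_scale_right) auto
    qed
    then have "proj_point u \<in> proj_point ` L" by (simp add: L_def)
    moreover have "pgl_act g (proj_point x1) = proj_point u"
      using pgl_act_\<Gamma>[OF g] k by (simp add: u_def proj_point_scale flip: scalar_mult_eq_scaleR)
    ultimately show ?thesis by (auto simp: L_def)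
  qed
  then show ?thesis by (intro finite_subset[OF _ fin]) blast
qed

end

section \<open>The quotient of the tube\<close>

context based_cone
begin

definition nrm :: "complex ^ 'n \<Rightarrow> complex ^ 'n" where
  "nrm v = (1 / cdot \<psi> v) *s v"

lemma base_nz: "v \<in> tube \<Longrightarrow> cdot \<psi> v \<noteq> 0"
  using cdot_nz base_dual by blast

lemma nrm_scale: "c \<noteq> 0 \<Longrightarrow> nrm (c *s v) = nrm v"
  by (simp add: nrm_def cdot_scale)

lemma nrm_tube: "v \<in> tube \<Longrightarrow> nrm v \<in> tube"
  using base_nz by (simp add: nrm_def tube_scale_iff)

lemma cdot_nrm: "v \<in> tube \<Longrightarrow> cdot \<psi> (nrm v) = 1"
  using base_nz by (simp add: nrm_def cdot_scale)

lemma nrm_id: "cdot \<psi> v = 1 \<Longrightarrow> nrm v = v"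
  by (simp add: nrm_def)

lemma nrm_eq: "v \<in> tube \<Longrightarrow> v = cdot \<psi> v *s nrm v"
  using base_nz by (simp add: nrm_def)

lemma continuous_on_nrm [continuous_intros]:
  assumes "continuous_on S g" "\<And>x. x \<in> S \<Longrightarrow> g x \<in> tube"
  shows "continuous_on S (\<lambda>x. nrm (g x))"
  unfolding nrm_def using assms base_nz by (intro continuous_intros) auto

lemma close_nrm_right: "w \<in> tube \<Longrightarrow> close e z (nrm w) \<longleftrightarrow> close e z w"
  unfolding nrm_def using base_nz by (intro close_scale_right) auto

end

context cone_action
begin

lemma P_nrm: "v \<in> tube \<Longrightarrow> P (nrm v) = P v"
  unfolding nrm_def using base_nz by (intro P_scale) auto

lemma tube_nz: "v \<in> tube \<Longrightarrow> v \<noteq> 0"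
  using zero_notin_tube by auto

lemma P_eqE:
  assumes "P v = P w" "w \<in> tube"
  obtains A c where "A \<in> G" "c \<noteq> 0" "w = c *s (cmat A *v v)"
  using assms P_eq_iff[OF tube_nz[OF assms(2)], of v] by blast

lemma scalars_G: "A \<in> scalars \<Longrightarrow> \<exists>c. c \<noteq> 0 \<and> (\<forall>v. cmat A *v v = of_real c *s v)"
  by (auto simp: scalars_def cmat_mat mat_mult_vec)

text \<open>If a class moves a point of the ball of radius \<open>1\<close> around \<open>z1\<close>
  into that ball, it moves \<open>z1\<close> by at most \<open>2\<close>, so only finitely many
  classes do. The nontrivial ones move the line of \<open>z1\<close>, and shrinking the ball
  excludes them. \<open>V\<close> is a cone, so it also describes an open set of lines.\<close>

lemma injective_nhd:
  assumes z0: "z0 \<in> tube"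
  obtains V where "open V" "z0 \<in> V" "V \<subseteq> tube" "\<And>c v. c \<noteq> 0 \<Longrightarrow> v \<in> V \<Longrightarrow> c *s v \<in> V"
    "\<And>A v. A \<in> G \<Longrightarrow> v \<in> V \<Longrightarrow> cmat A *v v \<in> V \<Longrightarrow> A \<in> scalars"
proof -
  define z1 where "z1 = nrm z0"
  have z1: "z1 \<in> tube" "cdot \<psi> z1 = 1" "nrm z1 = z1" "nrm z0 = z1"
    using nrm_tube[OF z0] cdot_nrm[OF z0] by (auto simp: z1_def nrm_id)
  obtain \<delta> where \<delta>: "\<delta> > 0" "\<And>w. dist z1 w < \<delta> \<Longrightarrow> w \<in> tube \<and> close 1 z1 w"
    using close_nhd[OF z1(1), of 1] by (metis zero_less_one)
  define S where "S = {g \<in> \<Gamma>. \<exists>A\<in>g. close 2 z1 (cmat A *v z1)}"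
  define S' where "S' = {g \<in> S. \<exists>A\<in>g. A \<notin> scalars}"
  have finS': "finite S'" using finite_close_translates[OF z1(1), of 2] by (rule rev_finite_subset) (auto simp: S'_def S_def)
  define R where "R g = (SOME A. A \<in> g \<and> A \<notin> scalars)" for g :: "(real ^ 'n ^ 'n) set"
  have R: "R g \<in> g \<and> R g \<notin> scalars" if "g \<in> S'" for g
    unfolding R_def by (rule someI_ex) (use that in \<open>auto simp: S'_def\<close>)
  have RG: "R g \<in> G" if "g \<in> S'" for g using R[OF that] that by (auto simp: S'_def S_def G_def)
  \<comment> \<open>Half the displacement of \<open>z1\<close>: the balls of this radius around
    \<open>z1\<close> and around its normalised translate are disjoint.\<close>
  define e where "e g = dist (nrm (cmat (R g) *v z1)) z1 / 2" for g
  have e: "e g > 0" if g: "g \<in> S'" for g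
  proof (rule ccontr)
    assume "\<not> e g > 0"
    then have "nrm (cmat (R g) *v z1) = z1" by (simp add: e_def)
    then have "cmat (R g) *v z1 = cdot \<psi> (cmat (R g) *v z1) *s z1"
      using nrm_eq[OF tube_act[OF RG[OF g] z1(1)]] by simp
    then have "R g \<in> scalars" using tube_fix_imp_scalar RG[OF g] z1(1) by blast
    then show False using R[OF g] by blast
  qed
  define V where "V = (tube \<inter> nrm -` ball z1 \<delta>) \<inter>
     (\<Inter>g\<in>S'. (tube \<inter> nrm -` ball z1 (e g)) \<inter>
        (tube \<inter> (\<lambda>v. nrm (cmat (R g) *v v)) -` ball (nrm (cmat (R g) *v z1)) (e g)))"
  have "open V" unfolding V_def
    by (intro open_Int open_INT finS' ballI continuous_open_preimage open_tube open_ball continuous_intros)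
       (auto intro: tube_act RG)
  moreover have "z0 \<in> V"
  proof -
    have "nrm (cmat (R g) *v z0) = nrm (cmat (R g) *v z1)" for g
      by (subst nrm_eq[OF z0]) (simp add: z1 vector_scalar_commute nrm_scale base_nz z0)
    then show ?thesis using z0 z1 \<delta> e by (simp add: V_def)
  qed
  moreover have "V \<subseteq> tube" by (auto simp: V_def)
  moreover have "c *s v \<in> V" if "c \<noteq> 0" "v \<in> V" for c v
    using that by (simp add: V_def tube_scale_iff nrm_scale vector_scalar_commute)
  moreover have "A \<in> scalars" if A: "A \<in> G" and v: "v \<in> V" and Av: "cmat A *v v \<in> V" for A v
  proof (rule ccontr)
    assume nA: "A \<notin> scalars"
    obtain g where g: "g \<in> \<Gamma>" "A \<in> g" using A by (auto simp: G_def)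
    have vt: "v \<in> tube" "cmat A *v v \<in> tube" using v Av by (auto simp: V_def)
    have "close 1 z1 (nrm v)" "close 1 z1 (nrm (cmat A *v v))" using v Av \<delta> by (auto simp: V_def)
    then have c: "close 1 z1 v" "close 1 z1 (cmat A *v v)" using vt by (simp_all add: close_nrm_right)
    have "close (1 + 1) z1 (cmat A *v z1)"
      using close_trans[OF c(2) close_sym[OF close_act[OF A c(1)]]] .
    then have gS: "g \<in> S'" using g nA by (auto simp: S'_def S_def)
    have "A \<in> scalars #>\<^bsub>GL\<^esub> R g" using \<Gamma>_coset[OF g(1)] R[OF gS] g(2) by metis
    then obtain k where k: "k \<noteq> 0" "A = mat k ** R g" by (auto simp: scalars_coset)
    have "nrm (cmat A *v v) = nrm (cmat (R g) *v v)"
      using k by (simp add: cmat_mult cmat_mat mat_mult_vec nrm_scale flip: matrix_vector_mul_assoc)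
    then have "dist z1 (nrm (cmat (R g) *v v)) < e g" "dist (nrm (cmat (R g) *v z1)) (nrm (cmat (R g) *v v)) < e g"
      using v Av gS by (auto simp: V_def)
    then have "dist (nrm (cmat (R g) *v z1)) z1 < e g + e g"
      using dist_triangle2[of "nrm (cmat (R g) *v z1)" z1 "nrm (cmat (R g) *v v)"] by linarith
    then show False by (simp add: e_def)
  qed
  ultimately show ?thesis using that by blast
qed

section \<open>Topology and holomorphic discs of the quotient\<close>

definition X :: "(complex ^ 'n) set set topology" where "X = complexification_topology \<Omega> \<Gamma>"

lemma proj_point_in_tube_iff: "v \<noteq> 0 \<Longrightarrow> proj_point v \<in> proj_point ` tube \<longleftrightarrow> v \<in> tube"
proof
  assume v: "v \<noteq> 0" and "proj_point v \<in> proj_point ` tube"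
  then obtain w where "w \<in> tube" "proj_point w = proj_point v" by auto
  then show "v \<in> tube" using v proj_point_eq_iff[OF v] tube_scale_iff by metis
qed simp

lemma P_image_tube: "complexification \<Omega> \<Gamma> = P ` tube"
  by (simp add: complexification_def tube_eq image_image P_def)

text \<open>The two successive quotient topologies combine into one condition on vectors, because
  the tube is open and saturated with respect to lines.\<close>

lemma openin_X_iff: "openin X U \<longleftrightarrow> U \<subseteq> P ` tube \<and> open {v \<in> tube. P v \<in> U}"
proof -
  let ?E = "proj_point ` tube"
  have Esub: "?E \<subseteq> proj_space" using tube_nz by (auto simp: proj_space_def)
  have opE: "openin proj_topology ?E"
    by (rule openin_proj_point_image[OF open_tube zero_notin_tube]) (simp add: tube_scale_iff)
  have ts: "topspace (subtopology proj_topology ?E) = ?E"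
    using Esub by (simp add: topspace_proj_topology Int_absorb1)
  have "{v. v \<noteq> 0 \<and> proj_point v \<in> {x \<in> ?E. cx_orbit \<Gamma> x \<in> U}} = {v \<in> tube. P v \<in> U}"
    using proj_point_in_tube_iff tube_nz by (auto simp: P_def)
  then have "openin proj_topology {x \<in> ?E. cx_orbit \<Gamma> x \<in> U} \<longleftrightarrow> open {v \<in> tube. P v \<in> U}"
    using Esub by (auto simp: openin_proj_topology)
  then show ?thesis
    unfolding X_def complexification_topology_def openin_quot_top tube_eq ts
    using openin_open_subtopology[OF opE] by (auto simp: image_image P_def)
qed

lemma topspace_X: "topspace X = P ` tube"
proof -
  have "{v \<in> tube. P v \<in> P ` tube} = tube" by blast
  then have "openin X (P ` tube)" using open_tube by (simp add: openin_X_iff)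
  then show ?thesis using openin_X_iff openin_subset openin_topspace by blast
qed

text \<open>The saturation of \<open>V\<close> is the union of its preimages under the matrices of
  \<open>G\<close> and the nonzero scalars.\<close>

lemma openin_P_image:
  assumes V: "open V" "V \<subseteq> tube" shows "openin X (P ` V)"
proof -
  have "{v \<in> tube. P v \<in> P ` V} = (\<Union>A\<in>G. \<Union>c\<in>-{0}. tube \<inter> (\<lambda>v. c *s (cmat A *v v)) -` V)"
  proof (intro Set.set_eqI iffI)
    fix v assume "v \<in> {v \<in> tube. P v \<in> P ` V}"
    then obtain w where w: "v \<in> tube" "w \<in> V" "P v = P w" by auto
    then obtain A c where "A \<in> G" "c \<noteq> 0" "w = c *s (cmat A *v v)"
      using P_eqE[OF w(3)] V(2) by blast
    then show "v \<in> (\<Union>A\<in>G. \<Union>c\<in>-{0}. tube \<inter> (\<lambda>v. c *s (cmat A *v v)) -` V)" using w by blast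
  next
    fix v assume "v \<in> (\<Union>A\<in>G. \<Union>c\<in>-{0}. tube \<inter> (\<lambda>v. c *s (cmat A *v v)) -` V)"
    then obtain A c where "A \<in> G" "c \<noteq> 0" "v \<in> tube" "c *s (cmat A *v v) \<in> V" by auto
    moreover from this have "P (c *s (cmat A *v v)) = P v" by (simp add: P_scale P_act)
    ultimately show "v \<in> {v \<in> tube. P v \<in> P ` V}" by (metis (mono_tags, lifting) image_eqI mem_Collect_eq)
  qed
  moreover have "open (\<Union>A\<in>G. \<Union>c\<in>-{0}. tube \<inter> (\<lambda>v. c *s (cmat A *v v)) -` V)"
    by (intro open_UN ballI continuous_open_preimage open_tube V continuous_intros)
  ultimately show ?thesis using V by (auto simp: openin_X_iff)
qed

definition atl :: "((complex ^ 'n) set set set \<times> ((complex ^ 'n) set set \<Rightarrow> complex ^ 'n)) set" where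
  "atl = complexification_atlas \<Omega> \<Gamma>"

text \<open>A chart of the quotient inverts the orbit map only on \<open>V\<close>, which
  \<open>F\<close> need not meet. Near a given parameter a fixed \<open>A\<close> from
  \<open>G\<close> moves \<open>F\<close> into the cone over \<open>V\<close>, and the chart then
  returns quotients of coordinates of \<open>cmat A *v F z\<close>.\<close>

lemma holomorphic_disc_P:
  fixes F :: "complex \<Rightarrow> complex ^ 'n"
  assumes hol: "\<And>j. (\<lambda>z. F z $ j) holomorphic_on ball 0 1"
    and F: "\<And>z. cmod z < 1 \<Longrightarrow> F z \<in> tube"
  shows "holomorphic_disc X atl (\<lambda>z. P (F z))"
proof -
  have contF: "continuous_on (ball 0 1) F"
  proof -
    have "continuous_on (ball 0 1) (\<lambda>z. \<chi> j. F z $ j)"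
      using hol holomorphic_on_imp_continuous_on by (intro continuous_on_vec_lambda) blast
    then show ?thesis by simp
  qed
  have "continuous_map (top_of_set (ball 0 1)) X (\<lambda>z. P (F z))"
    unfolding continuous_map_def
  proof (intro conjI allI impI)
    show "(\<lambda>z. P (F z)) \<in> topspace (top_of_set (ball 0 1)) \<rightarrow> topspace X"
      using F by (auto simp: topspace_X)
    fix U assume "openin X U"
    then have op: "open {v \<in> tube. P v \<in> U}" by (simp add: openin_X_iff)
    have "{x \<in> topspace (top_of_set (ball 0 1)). P (F x) \<in> U} = ball 0 1 \<inter> F -` {v \<in> tube. P v \<in> U}"
      using F by auto
    moreover have "open (ball 0 1 \<inter> F -` {v \<in> tube. P v \<in> U})"
      by (intro continuous_open_preimage contF open_ball op)
    ultimately show "openin (top_of_set (ball 0 1)) {x \<in> topspace (top_of_set (ball 0 1)). P (F x) \<in> U}"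
      by (simp add: openin_open_eq)
  qed
  moreover have "(\<lambda>z. affine_chart i (inv_into V (cx_orbit \<Gamma>) (P (F z))) $ j) holomorphic_on
       {z \<in> ball 0 1. P (F z) \<in> cx_orbit \<Gamma> ` V}"
    if V: "openin proj_topology V" "V \<subseteq> proj_point ` tube \<inter> affine_domain i" "inj_on (cx_orbit \<Gamma>) V" for V i j
    unfolding holomorphic_on_def
  proof
    let ?h = "\<lambda>z. affine_chart i (inv_into V (cx_orbit \<Gamma>) (P (F z))) $ j"
    fix z0 assume "z0 \<in> {z \<in> ball 0 1. P (F z) \<in> cx_orbit \<Gamma> ` V}"
    then obtain p where z0: "z0 \<in> ball 0 1" and p: "p \<in> V" "P (F z0) = cx_orbit \<Gamma> p" by auto
    obtain v where v: "v \<in> tube" "p = proj_point v" using p V by blast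
    have "P (F z0) = P v" using p v by (simp add: P_def)
    then obtain A c where A: "A \<in> G" "c \<noteq> 0" "v = c *s (cmat A *v F z0)"
      using v(1) by (rule P_eqE)
    define N where "N = ball 0 1 \<inter> (\<lambda>z. cmat A *v F z) -` lines_union V"
    have "open (lines_union V)" using V(1) by (simp add: openin_proj_topology lines_union_def)
    then have "open N" unfolding N_def by (intro continuous_open_preimage contF open_ball continuous_intros)
    have "cmat A *v F z0 \<in> lines_union V"
    proof -
      have "proj_point (cmat A *v F z0) \<in> V" using p v A by (simp add: proj_point_scale)
      moreover have "cmat A *v F z0 \<noteq> 0" using A tube_nz[OF v(1)] by auto
      ultimately show ?thesis by (simp add: lines_union_def)
    qed
    then have z0N: "z0 \<in> N" using z0 by (simp add: N_def)
    have nzi: "(cmat A *v F z) $ i \<noteq> 0" and val: "?h z = (cmat A *v F z) $ j / (cmat A *v F z) $ i" if z: "z \<in> N" for z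
    proof -
      have q: "cmat A *v F z \<noteq> 0" "proj_point (cmat A *v F z) \<in> V" using z by (auto simp: N_def lines_union_def)
      then obtain w where w: "proj_point (cmat A *v F z) = proj_point w" "w $ i \<noteq> 0"
        using V(2) by (auto simp: affine_domain_def)
      then have "w \<noteq> 0" by auto
      then obtain k where "w = k *s (cmat A *v F z)" using w proj_point_eq_iff by metis
      then show ni: "(cmat A *v F z) $ i \<noteq> 0" using w by auto
      have "P (F z) = cx_orbit \<Gamma> (proj_point (cmat A *v F z))" using P_act[OF A(1)] by (simp add: P_def)
      then have "inv_into V (cx_orbit \<Gamma>) (P (F z)) = proj_point (cmat A *v F z)"
        using inv_into_f_f[OF V(3) q(2)] by simp
      then show "?h z = (cmat A *v F z) $ j / (cmat A *v F z) $ i"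
        using affine_chart_proj_point[OF ni] by simp
    qed
    have "(\<lambda>z. (cmat A *v F z) $ j / (cmat A *v F z) $ i) holomorphic_on N"
    proof (rule holomorphic_on_divide)
      have "N \<subseteq> ball 0 1" by (auto simp: N_def)
      then have "(\<lambda>z. (cmat A *v F z) $ k) holomorphic_on N" for k
        unfolding cmat_mult_vec_nth using hol holomorphic_on_subset by (intro holomorphic_on_cdot) blast
      then show "(\<lambda>z. (cmat A *v F z) $ j) holomorphic_on N" "(\<lambda>z. (cmat A *v F z) $ i) holomorphic_on N"
        by blast+
    qed (rule nzi)
    then have "?h holomorphic_on N" using val by (simp cong: holomorphic_cong)
    then have "?h field_differentiable at z0" using \<open>open N\<close> z0N holomorphic_on_imp_differentiable_at by blast
    then show "?h field_differentiable at z0 within {z \<in> ball 0 1. P (F z) \<in> cx_orbit \<Gamma> ` V}"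
      by (rule field_differentiable_at_within)
  qed
  ultimately show ?thesis
    unfolding holomorphic_disc_def atl_def complexification_atlas_def tube_eq by auto
qed

text \<open>The sheets of the pulled back covering over the disc are indexed by \<open>G\<close>: the sheet of \<open>A\<close>
  consists of the lifts that \<open>A\<close> moves into a fixed evenly covered open set.\<close>

lemma covering_pullback:
  assumes cont: "continuous_map (top_of_set (ball 0 1)) X f"
  shows "covering_space {(z, v). z \<in> ball 0 1 \<and> v \<in> tube \<and> cdot \<psi> v = 1 \<and> f z = P v} fst (ball (0::complex) 1)"
    (is "covering_space ?E fst ?B")
proof
  show "continuous_on ?E fst" by (intro continuous_intros)
  have fX: "f z \<in> P ` tube" if "z \<in> ?B" for z
    using cont that by (auto simp: continuous_map_def topspace_X Pi_iff)
  have lift: "\<exists>v\<in>tube. cdot \<psi> v = 1 \<and> P v = f z" if z: "z \<in> ?B" for z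
  proof -
    obtain v where "v \<in> tube" "f z = P v" using fX[OF z] by blast
    then show ?thesis using nrm_tube cdot_nrm P_nrm by (intro bexI[of _ "nrm v"]) auto
  qed
  show "fst ` ?E = ?B"
  proof
    show "?B \<subseteq> fst ` ?E"
    proof
      fix z assume z: "z \<in> ?B"
      then obtain v where "v \<in> tube" "cdot \<psi> v = 1" "P v = f z" using lift by blast
      then have "(z, v) \<in> ?E" using z by simp
      then show "z \<in> fst ` ?E" by (rule image_eqI[rotated]) simp
    qed
  qed auto
  have preim: "open {z \<in> ?B. f z \<in> U}" if "openin X U" for U
    using openin_continuous_map_preimage[OF cont that] by (simp add: openin_open_eq)
  fix z0 assume z0: "z0 \<in> ?B"
  obtain v0 where v0: "v0 \<in> tube" "cdot \<psi> v0 = 1" "P v0 = f z0" using lift[OF z0] by blast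
  obtain V where V: "open V" "v0 \<in> V" "V \<subseteq> tube" "\<And>c v. c \<noteq> 0 \<Longrightarrow> v \<in> V \<Longrightarrow> c *s v \<in> V"
    "\<And>A v. A \<in> G \<Longrightarrow> v \<in> V \<Longrightarrow> cmat A *v v \<in> V \<Longrightarrow> A \<in> scalars"
    using injective_nhd[OF v0(1)] by metis
  define N where "N = {z \<in> ?B. f z \<in> P ` V}"
  have opN: "open N" unfolding N_def by (intro preim openin_P_image V)
  have NB: "N \<subseteq> ?B" by (auto simp: N_def)
  have z0N: "z0 \<in> N" using z0 v0 V(2) by (auto simp: N_def intro!: image_eqI[of _ P v0])
  define sheet where "sheet A = {(z, v). (z, v) \<in> ?E \<and> z \<in> N \<and> cmat A *v v \<in> V}" for A
  have un: "\<Union> (sheet ` G) = ?E \<inter> fst -` N"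
  proof (intro Set.set_eqI iffI)
    fix x assume x: "x \<in> ?E \<inter> fst -` N"
    obtain z v where zv: "x = (z, v)" "v \<in> tube" "f z = P v" "z \<in> N" using x by auto
    have "f z \<in> P ` V" using zv(4) by (simp add: N_def)
    then obtain w where w: "w \<in> V" "P v = P w" using zv(3) by auto
    have "w \<in> tube" using w(1) V(3) by blast
    with w(2) obtain A c where A: "A \<in> G" "c \<noteq> 0" "w = c *s (cmat A *v v)" by (rule P_eqE)
    have "(1 / c) *s w \<in> V" using V(4)[of "1 / c" w] w(1) A(2) by simp
    then have "cmat A *v v \<in> V" using A(2,3) by simp
    then show "x \<in> \<Union> (sheet ` G)" using x zv A by (auto simp: sheet_def)
  qed (auto simp: sheet_def)
  have op: "openin (top_of_set ?E) (sheet A)" for A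
  proof -
    have eq: "sheet A = ?E \<inter> (N \<times> ((\<lambda>v. cmat A *v v) -` V))" by (auto simp: sheet_def)
    have "open (N \<times> ((\<lambda>v. cmat A *v v) -` V))"
      by (intro open_Times opN open_vimage V continuous_intros)
    then show ?thesis unfolding eq by (rule openin_open_Int)
  qed
  \<comment> \<open>A common point forces \<open>A\<close> and \<open>A'\<close> to differ by a
    scalar factor; as \<open>V\<close> is a cone, they then define the same sheet.\<close>
  have dj: "sheet A = sheet A' \<or> disjnt (sheet A) (sheet A')" if A: "A \<in> G" "A' \<in> G" for A A'
  proof (cases "disjnt (sheet A) (sheet A')")
    case False
    then obtain x where "x \<in> sheet A" "x \<in> sheet A'" unfolding disjnt_def by blast
    then obtain v where zv: "cmat A *v v \<in> V" "cmat A' *v v \<in> V" by (auto simp: sheet_def)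
    obtain B where B: "B \<in> G" "B ** A' = mat 1" using G_inverse[OF A(2)] by metis
    have "cmat (A ** B) *v (cmat A' *v v) = cmat A *v v"
      using B by (simp add: matrix_vector_mul_assoc flip: cmat_mult matrix_mul_assoc)
    then have "A ** B \<in> scalars" using V(5)[OF G_mult[OF A(1) B(1)] zv(2)] zv(1) by simp
    then obtain c where c: "c \<noteq> 0" "A ** B = mat c" by (auto simp: scalars_def)
    have "A = mat c ** A'"
      using B c by (metis matrix_mul_assoc matrix_mul_rid)
    then have e: "cmat A *v v = of_real c *s (cmat A' *v v)" for v
      by (simp add: cmat_mult cmat_mat mat_mult_vec flip: matrix_vector_mul_assoc)
    have "cmat A *v v \<in> V \<longleftrightarrow> cmat A' *v v \<in> V" for v
    proof
      assume "cmat A *v v \<in> V"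
      then have "(1 / of_real c) *s (cmat A *v v) \<in> V" using V(4) c by simp
      then show "cmat A' *v v \<in> V" using c by (simp add: e)
    next
      assume "cmat A' *v v \<in> V" then show "cmat A *v v \<in> V" using V(4) c by (simp add: e)
    qed
    then show ?thesis by (simp add: sheet_def)
  qed simp
  have hom: "\<exists>q. homeomorphism (sheet A) N fst q" if A: "A \<in> G" for A
  proof -
    obtain B where B: "B \<in> G" "B ** A = mat 1" using G_inverse[OF A] by metis
    then have AB: "A ** B = mat 1" using matrix_left_right_inverse by blast
    have cont: "continuous_on (sheet A) fst" by (intro continuous_intros)
    have img: "fst ` sheet A = N"
    proof
      show "N \<subseteq> fst ` sheet A"
      proof
        fix z assume z: "z \<in> N"
        then obtain w where w: "w \<in> V" "f z = P w" "z \<in> ?B" by (auto simp: N_def)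
        define v where "v = cmat B *v w"
        have v: "v \<in> tube" "cmat A *v v = w"
          using w V tube_act[OF B(1)] cmat_inverse[OF AB] by (auto simp: v_def)
        have Pv: "P (nrm v) = f z" using P_nrm[OF v(1)] P_act[OF B(1)] w by (simp add: v_def)
        have "cmat A *v nrm v = (1 / cdot \<psi> v) *s w" by (simp add: nrm_def vector_scalar_commute v)
        then have "cmat A *v nrm v \<in> V" using V(4) w base_nz[OF v(1)] by simp
        then have "(z, nrm v) \<in> sheet A" using z w Pv nrm_tube[OF v(1)] cdot_nrm[OF v(1)] by (simp add: sheet_def)
        then show "z \<in> fst ` sheet A" by (rule image_eqI[rotated]) simp
      qed
    qed (auto simp: sheet_def)
    have inj: "inj_on fst (sheet A)"
    proof (rule inj_onI)
      fix x y assume x: "x \<in> sheet A" and y: "y \<in> sheet A" and xy: "fst x = fst y"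
      obtain z v w where zv: "x = (z, v)" "y = (z, w)" using xy by (metis prod.collapse)
      have v: "v \<in> tube" "cdot \<psi> v = 1" "cmat A *v v \<in> V" "w \<in> tube" "cdot \<psi> w = 1" "cmat A *v w \<in> V" "P v = P w"
        using x y zv by (auto simp: sheet_def)
      obtain D c where D: "D \<in> G" "c \<noteq> 0" "w = c *s (cmat D *v v)" using v(7,4) by (rule P_eqE)
      \<comment> \<open>If \<open>D\<close> relates two points of a sheet over the same parameter,
        its conjugate by \<open>A\<close> sends \<open>cmat A *v v\<close> back into
        \<open>V\<close> and so is scalar. Then \<open>D\<close> is scalar as well, and the slice
        condition makes the points equal.\<close>
      have "cmat (A ** D ** B) *v (cmat A *v v) = cmat A *v (cmat D *v v)"
        using B(2) by (simp add: matrix_vector_mul_assoc flip: cmat_mult matrix_mul_assoc)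
      also have "\<dots> = (1 / c) *s (cmat A *v w)" using D by (simp add: vector_scalar_commute)
      also have "\<dots> \<in> V" using V(4) D v by simp
      finally have "A ** D ** B \<in> scalars"
        by (rule V(5)[OF G_mult[OF G_mult[OF A D(1)] B(1)] v(3)])
      then obtain k where k: "k \<noteq> 0" "A ** D ** B = mat k" by (auto simp: scalars_def)
      have "D = (B ** A) ** D ** (B ** A)" using B by simp
      also have "\<dots> = B ** (A ** D ** B) ** A" by (simp only: matrix_mul_assoc)
      also have "\<dots> = mat k ** (B ** A)"
        unfolding k(2) by (simp only: mult_mat_eq[of B] mat_mult_eq[of k B, symmetric] matrix_mul_assoc)
      also have "\<dots> = mat k" using B by simp
      finally have "w = (c * of_real k) *s v" using D(3) by (simp add: cmat_mat mat_mult_vec)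
      then have "nrm w = nrm v" using nrm_scale[of "c * of_real k" v] D(2) k(1) by simp
      then show "x = y" using zv v by (simp add: nrm_id)
    qed
    have "openin (top_of_set N) (fst ` W)" if W: "openin (top_of_set (sheet A)) W" for W
    proof -
      have "openin (top_of_set ?E) W" using op W openin_trans by blast
      then obtain O' where O': "open O'" "W = ?E \<inter> O'" by (auto simp: openin_open)
      have Wsub: "W \<subseteq> sheet A" using W openin_imp_subset by blast
      have "open (fst ` W)"
      proof (subst open_subopen, intro ballI)
        fix z1 assume "z1 \<in> fst ` W"
        then obtain v1 where zv: "(z1, v1) \<in> W" by auto
        then have s: "z1 \<in> N" "v1 \<in> tube" "cdot \<psi> v1 = 1" "f z1 = P v1" "cmat A *v v1 \<in> V"
          using Wsub by (auto simp: sheet_def)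
        have "(z1, v1) \<in> O'" using zv O'(2) by blast
        with O'(1) obtain O1 O2 where O: "open O1" "open O2" "(z1, v1) \<in> O1 \<times> O2" "O1 \<times> O2 \<subseteq> O'"
          by (rule open_prod_elim)
        \<comment> \<open>Vectors whose normalised form is close to \<open>v1\<close>. Where
          \<open>f\<close> takes a value in the image of \<open>D\<close>, the normalised vector
          provides a point of \<open>W\<close> over the parameter, so these parameters form a
          neighbourhood inside the projection of \<open>W\<close>.\<close>
        define D where "D = tube \<inter> nrm -` O2 \<inter> (\<lambda>v. cmat A *v v) -` V"
        have "open D" unfolding D_def
          by (intro open_Int continuous_open_preimage open_vimage open_tube O V continuous_intros) auto
        define M where "M = O1 \<inter> N \<inter> {z \<in> ?B. f z \<in> P ` D}"
        have "open M" unfolding M_def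
          by (intro open_Int O opN preim openin_P_image \<open>open D\<close>) (auto simp: D_def)
        moreover have "v1 \<in> D" using s O nrm_id by (auto simp: D_def)
        then have "z1 \<in> M" using s O NB by (auto simp: M_def)
        moreover have "M \<subseteq> fst ` W"
        proof
          fix z assume "z \<in> M"
          then obtain v where z: "z \<in> O1" "z \<in> ?B" "v \<in> D" "f z = P v" by (auto simp: M_def)
          then have v: "v \<in> tube" "nrm v \<in> O2" by (auto simp: D_def)
          then have "(z, nrm v) \<in> W"
            using z O nrm_tube[OF v(1)] cdot_nrm[OF v(1)] P_nrm[OF v(1)] by (auto simp: O'(2))
          then show "z \<in> fst ` W" by (rule image_eqI[rotated]) simp
        qed
        ultimately show "\<exists>T. open T \<and> z1 \<in> T \<and> T \<subseteq> fst ` W" by blast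
      qed
      moreover have "fst ` W \<subseteq> N" using Wsub img by blast
      ultimately show ?thesis using opN by (simp add: openin_open_eq)
    qed
    then show ?thesis using homeomorphism_injective_open_map[OF cont img inj] by metis
  qed
  show "\<exists>T. z0 \<in> T \<and> openin (top_of_set ?B) T \<and>
     (\<exists>v. \<Union>v = ?E \<inter> fst -` T \<and> (\<forall>u\<in>v. openin (top_of_set ?E) u) \<and> pairwise disjnt v \<and>
        (\<forall>u\<in>v. \<exists>q. homeomorphism u T fst q))"
  proof (intro exI[of _ N] conjI exI[of _ "sheet ` G"])
    show "openin (top_of_set ?B) N" using opN NB by (simp add: openin_open_eq)
    show "pairwise disjnt (sheet ` G)"
    proof (rule pairwiseI)
      fix S T assume "S \<in> sheet ` G" "T \<in> sheet ` G" "S \<noteq> T"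
      then show "disjnt S T" using dj by fast
    qed
    show "z0 \<in> N" by (rule z0N)
    show "\<Union> (sheet ` G) = ?E \<inter> fst -` N" by (rule un)
    show "\<forall>u\<in>sheet ` G. openin (top_of_set ?E) u" using op by fast
    show "\<forall>u\<in>sheet ` G. \<exists>q. homeomorphism u N fst q" using hom by fast
  qed
qed

text \<open>Simple connectedness of the disc gives a continuous lift. Charts see only quotients of
  coordinates of \<open>F\<close>, which are holomorphic because \<open>f\<close> is; the
  normalisation by \<psi> recovers \<open>F\<close> from them.\<close>

lemma holomorphic_disc_lift:
  assumes disc: "holomorphic_disc X atl f" and a: "cmod a < 1"
    and x: "x \<in> tube" "cdot \<psi> x = 1" "P x = f a"
  obtains F :: "complex \<Rightarrow> complex ^ 'n" where
    "\<And>j. (\<lambda>z. F z $ j) holomorphic_on ball 0 1"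
    "\<And>z. cmod z < 1 \<Longrightarrow> F z \<in> tube \<and> cdot \<psi> (F z) = 1 \<and> P (F z) = f z" "F a = x"
proof -
  \<comment> \<open>Fixing \<open>cdot \<psi> v = 1\<close> makes the fibres discrete; otherwise
    they would contain whole punctured lines.\<close>
  define E where "E = {(z, v). z \<in> ball 0 1 \<and> v \<in> tube \<and> cdot \<psi> v = 1 \<and> f z = P v}"
  have cov: "covering_space E fst (ball 0 1)"
    unfolding E_def using disc by (intro covering_pullback) (simp add: holomorphic_disc_def)
  have aE: "(a, x) \<in> E" using a x by (simp add: E_def)
  obtain g where g: "continuous_on (ball 0 1) g" "g \<in> ball 0 1 \<rightarrow> E" "g a = (a, x)" "\<And>y. y \<in> ball 0 1 \<Longrightarrow> fst (g y) = y"
  proof (rule covering_space_lift_strong[OF cov aE, of a "ball 0 1" "\<lambda>z. z"])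
    show "simply_connected (ball (0::complex) 1)" by (simp add: convex_imp_simply_connected)
    show "locally path_connected (ball (0::complex) 1)" by (simp add: convex_imp_locally_path_connected)
  qed (use a in \<open>auto simp: Pi_iff\<close>)
  define F where "F z = snd (g z)" for z
  have contF: "continuous_on (ball 0 1) F" unfolding F_def using g(1) by (intro continuous_intros)
  have F: "F z \<in> tube \<and> cdot \<psi> (F z) = 1 \<and> P (F z) = f z" if "cmod z < 1" for z
  proof -
    have "g z \<in> E" "fst (g z) = z" using g that by auto
    then show ?thesis by (cases "g z") (auto simp: E_def F_def)
  qed
  have Fa: "F a = x" using g by (simp add: F_def)
  have "(\<lambda>z. F z $ j) holomorphic_on ball 0 1" for j
    unfolding holomorphic_on_def
  proof
    fix z0 :: complex assume z0: "z0 \<in> ball 0 1"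
    have Fz0: "F z0 \<in> tube" using F z0 by simp
    obtain V where V: "open V" "F z0 \<in> V" "V \<subseteq> tube" "\<And>c v. c \<noteq> 0 \<Longrightarrow> v \<in> V \<Longrightarrow> c *s v \<in> V"
      "\<And>A v. A \<in> G \<Longrightarrow> v \<in> V \<Longrightarrow> cmat A *v v \<in> V \<Longrightarrow> A \<in> scalars"
      using injective_nhd[OF Fz0] by metis
    obtain i where i: "F z0 $ i \<noteq> 0" using tube_nz[OF Fz0] by (auto simp: vec_eq_iff)
    define V' where "V' = V \<inter> {v. v $ i \<noteq> 0}"
    have "open {v :: complex ^ 'n. v $ i \<noteq> 0}" by (intro open_Collect_neq continuous_intros)
    then have opV': "open V'" unfolding V'_def using V by blast
    have V'c: "c *s v \<in> V'" if "c \<noteq> 0" "v \<in> V'" for c v using that V(4) by (simp add: V'_def)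
    define pV where "pV = proj_point ` V'"
    have 1: "openin proj_topology pV" unfolding pV_def
      by (rule openin_proj_point_image[OF opV' _ V'c]) (auto simp: V'_def)
    have 2: "pV \<subseteq> elliptic_tube \<Omega> \<inter> affine_domain i" using V by (auto simp: pV_def V'_def tube_eq affine_domain_def)
    have 3: "inj_on (cx_orbit \<Gamma>) pV"
    proof (rule inj_onI)
      fix p p' assume "p \<in> pV" "p' \<in> pV" and e: "cx_orbit \<Gamma> p = cx_orbit \<Gamma> p'"
      then obtain v w where v: "v \<in> V" "w \<in> V" "p = proj_point v" "p' = proj_point w" by (auto simp: pV_def V'_def)
      have "P v = P w" using e v by (simp add: P_def)
      moreover have "w \<in> tube" using v(2) V(3) by blast
      ultimately obtain A c where A: "A \<in> G" "c \<noteq> 0" "w = c *s (cmat A *v v)" by (rule P_eqE)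
      have "(1 / c) *s w \<in> V" using V(4)[of "1 / c" w] v(2) A(2) by simp
      then have "cmat A *v v \<in> V" using A(2,3) by simp
      then have "A \<in> scalars" using V(5) A v by blast
      then obtain k where k: "k \<noteq> 0" "cmat A *v v = of_real k *s v" using scalars_G by blast
      then have "w = (c * of_real k) *s v" using A by simp
      moreover have "c * of_real k \<noteq> 0" using A k by simp
      ultimately show "p = p'" unfolding v(3,4) using proj_point_scale by metis
    qed
    have "(cx_orbit \<Gamma> ` pV, affine_chart i \<circ> inv_into pV (cx_orbit \<Gamma>)) \<in> atl"
      unfolding atl_def complexification_atlas_def using 1 2 3 by blast
    then have hol: "(\<lambda>z. affine_chart i (inv_into pV (cx_orbit \<Gamma>) (f z)) $ k) holomorphic_on {z \<in> ball 0 1. f z \<in> cx_orbit \<Gamma> ` pV}" for k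
      using disc unfolding holomorphic_disc_def by fastforce
    define M where "M = ball 0 1 \<inter> F -` V'"
    have opM: "open M" unfolding M_def by (intro continuous_open_preimage contF opV' open_ball)
    have z0M: "z0 \<in> M" using z0 V i by (simp add: M_def V'_def)
    have fP: "f z = cx_orbit \<Gamma> (proj_point (F z))" if "z \<in> M" for z
      using F that by (auto simp: M_def P_def)
    have pM: "proj_point (F z) \<in> pV" "F z $ i \<noteq> 0" if "z \<in> M" for z
      using that by (auto simp: M_def pV_def V'_def)
    have "M \<subseteq> {z \<in> ball 0 1. f z \<in> cx_orbit \<Gamma> ` pV}" using fP pM by (auto simp: M_def)
    then have holM: "(\<lambda>z. affine_chart i (inv_into pV (cx_orbit \<Gamma>) (f z)) $ k) holomorphic_on M" for k
      using hol holomorphic_on_subset by blast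
    have val: "affine_chart i (inv_into pV (cx_orbit \<Gamma>) (f z)) $ k = F z $ k / F z $ i" if z: "z \<in> M" for z k
      using affine_chart_proj_point[OF pM(2)[OF z]] inv_into_f_f[OF 3 pM(1)[OF z]] by (simp add: fP[OF z])
    have holq: "(\<lambda>z. F z $ k / F z $ i) holomorphic_on M" for k
      using holM[of k] val by (simp cong: holomorphic_cong)
    \<comment> \<open>Dividing \<open>cdot \<psi> (F z) = 1\<close> by \<open>F z $ i\<close>
      expresses the missing factor through the chart coordinates.\<close>
    have den: "(\<Sum>k\<in>UNIV. of_real (\<psi> $ k) * (F z $ k / F z $ i)) = 1 / F z $ i" if z: "z \<in> M" for z
    proof -
      have "cdot \<psi> (F z) = 1" using F z by (simp add: M_def)
      then show ?thesis by (simp add: cdot_def flip: sum_divide_distrib)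
    qed
    let ?D = "\<lambda>z. \<Sum>k\<in>UNIV. of_real (\<psi> $ k) * (F z $ k / F z $ i)"
    have "(\<lambda>z. (F z $ j / F z $ i) / ?D z) holomorphic_on M"
    proof (rule holomorphic_on_divide[OF holq])
      show "?D holomorphic_on M"
        by (intro holomorphic_on_sum holomorphic_on_mult holq holomorphic_on_const)
      show "?D z \<noteq> 0" if "z \<in> M" for z
        using pM(2)[OF that] by (subst den[OF that]) simp
    qed
    moreover have "(F z $ j / F z $ i) / ?D z = F z $ j" if "z \<in> M" for z
      using pM(2)[OF that] by (subst den[OF that]) simp
    ultimately have "(\<lambda>z. F z $ j) holomorphic_on M" by (rule holomorphic_transform)
    then have "(\<lambda>z. F z $ j) field_differentiable at z0" using opM z0M holomorphic_on_imp_differentiable_at by blast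
    then show "(\<lambda>z. F z $ j) field_differentiable at z0 within ball 0 1" by (rule field_differentiable_at_within)
  qed
  then show ?thesis using that F Fa by blast
qed

end

section \<open>Chains of discs\<close>

lemma kobayashi_chain_nonneg: "kobayashi_chain X \<A> p q l \<Longrightarrow> l \<ge> 0"
  by (induction rule: kobayashi_chain.induct) (auto intro: poincare_distance_nonneg add_nonneg_nonneg)

lemma holomorphic_disc_topspace: "holomorphic_disc X \<A> f \<Longrightarrow> cmod z < 1 \<Longrightarrow> f z \<in> topspace X"
  by (auto simp: holomorphic_disc_def continuous_map_def Pi_iff)

lemma kobayashi_chain_trans:
  "kobayashi_chain X \<A> q s l' \<Longrightarrow> kobayashi_chain X \<A> p q l \<Longrightarrow> kobayashi_chain X \<A> p s (l + l')"
proof (induction rule: kobayashi_chain.induct)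
  case (extend q f a l' b)
  then have "kobayashi_chain X \<A> p (f b) (l + l' + poincare_distance a b)"
    by (intro kobayashi_chain.extend) auto
  then show ?case by (simp add: add.assoc)
qed simp

lemma kobayashi_chain_disc:
  assumes "holomorphic_disc X \<A> f" "cmod a < 1" "cmod b < 1"
  shows "kobayashi_chain X \<A> (f a) (f b) (poincare_distance a b)"
  using kobayashi_chain.extend[OF kobayashi_chain.trivial[OF holomorphic_disc_topspace[OF assms(1,2)]] assms(1), of b]
    assms by simp

lemma kobayashi_chain_sym:
  "kobayashi_chain X \<A> p q l \<Longrightarrow> kobayashi_chain X \<A> q p l"
proof (induction rule: kobayashi_chain.induct)
  case (extend p f a l b)
  have "kobayashi_chain X \<A> (f b) (f a) (poincare_distance b a)"
    using extend by (intro kobayashi_chain_disc) auto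
  then have "kobayashi_chain X \<A> (f b) p (poincare_distance b a + l)"
    using extend.IH by (rule kobayashi_chain_trans[rotated])
  then show ?case by (simp add: add.commute poincare_distance_commute)
qed (rule kobayashi_chain.trivial)

lemma kobayashi_distance_le:
  assumes "kobayashi_chain X \<A> p q l" shows "kobayashi_distance X \<A> p q \<le> l"
proof -
  have "bdd_below {l. kobayashi_chain X \<A> p q l}"
    using kobayashi_chain_nonneg by (intro bdd_belowI[of _ 0]) auto
  then have "Inf {l. kobayashi_chain X \<A> p q l} \<le> l" using assms by (intro cInf_lower) auto
  then show ?thesis using assms by (auto simp: kobayashi_distance_def)
qed

text \<open>The given chain ensures that the distance is an infimum and not the default value
  \<open>0\<close>.\<close>

lemma kobayashi_distance_less:
  assumes "kobayashi_chain X \<A> p q l" "kobayashi_distance X \<A> p q < e"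
  obtains l' where "kobayashi_chain X \<A> p q l'" "l' < e"
proof -
  have "Inf {l. kobayashi_chain X \<A> p q l} < e" using assms by (auto simp: kobayashi_distance_def split: if_splits)
  then show ?thesis using cInf_lessD[of "{l. kobayashi_chain X \<A> p q l}" e] assms(1) that by blast
qed

lemma kobayashi_distance_nonneg: "kobayashi_distance X \<A> p q \<ge> 0"
  unfolding kobayashi_distance_def using kobayashi_chain_nonneg by (auto intro!: cInf_greatest)

lemma kobayashi_distance_commute: "kobayashi_distance X \<A> p q = kobayashi_distance X \<A> q p"
proof -
  have "kobayashi_chain X \<A> p q = kobayashi_chain X \<A> q p"
    by (rule ext, rule iffI; rule kobayashi_chain_sym)
  then show ?thesis by (simp only: kobayashi_distance_def)
qed

lemma kobayashi_distance_triangle: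
  assumes "kobayashi_chain X \<A> p q l" "kobayashi_chain X \<A> q s l'"
  shows "kobayashi_distance X \<A> p s \<le> kobayashi_distance X \<A> p q + kobayashi_distance X \<A> q s"
proof (rule field_le_epsilon)
  fix e :: real assume e: "e > 0"
  obtain l1 where l1: "kobayashi_chain X \<A> p q l1" "l1 < kobayashi_distance X \<A> p q + e / 2"
    using kobayashi_distance_less[OF assms(1), of "kobayashi_distance X \<A> p q + e / 2"] e by auto
  obtain l2 where l2: "kobayashi_chain X \<A> q s l2" "l2 < kobayashi_distance X \<A> q s + e / 2"
    using kobayashi_distance_less[OF assms(2), of "kobayashi_distance X \<A> q s + e / 2"] e by auto
  have "kobayashi_distance X \<A> p s \<le> l1 + l2"
    by (rule kobayashi_distance_le[OF kobayashi_chain_trans[OF l2(1) l1(1)]])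
  then show "kobayashi_distance X \<A> p s \<le> kobayashi_distance X \<A> p q + kobayashi_distance X \<A> q s + e"
    using l1 l2 by linarith
qed

section \<open>The Kobayashi distance of the quotient\<close>

context cone_action
begin

definition d :: "(complex ^ 'n) set set \<Rightarrow> (complex ^ 'n) set set \<Rightarrow> real" where
  "d = kobayashi_distance X atl"

lemma chain_nearby:
  assumes z: "z \<in> tube" and e: "e > 0"
  obtains \<delta> where "\<delta> > 0" "\<And>w. dist z w < \<delta> \<Longrightarrow> \<exists>l<e. kobayashi_chain X atl (P z) (P w) l"
proof (rule nearby_point_on_disc[OF assms], rule that)
  fix \<delta> w
  assume \<delta>: "\<And>w. dist z w < \<delta> \<Longrightarrow> \<exists>F c. (\<forall>j. (\<lambda>z. F z $ j) holomorphic_on ball 0 1) \<and>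
     (\<forall>\<zeta>. cmod \<zeta> < 1 \<longrightarrow> F \<zeta> \<in> tube) \<and> F 0 = z \<and> F c = w \<and> cmod c < 1 \<and> poincare_distance 0 c < e"
  assume "dist z w < \<delta>"
  then obtain F :: "complex \<Rightarrow> complex ^ 'n" and c where F: "\<And>j. (\<lambda>z. F z $ j) holomorphic_on ball 0 1"
     "\<And>\<zeta>. cmod \<zeta> < 1 \<Longrightarrow> F \<zeta> \<in> tube" "F 0 = z" "F c = w" "cmod c < 1" "poincare_distance 0 c < e"
    using \<delta> by blast
  have "kobayashi_chain X atl (P (F 0)) (P (F c)) (poincare_distance 0 c)"
    by (rule kobayashi_chain_disc[OF holomorphic_disc_P[OF F(1,2)]]) (use F(5) in auto)
  then show "\<exists>l<e. kobayashi_chain X atl (P z) (P w) l" using F by auto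
qed

lemma chain_exists:
  assumes "p \<in> P ` tube" "q \<in> P ` tube" obtains l where "kobayashi_chain X atl p q l"
proof -
  obtain z w where zw: "z \<in> tube" "w \<in> tube" "p = P z" "q = P w" using assms by blast
  have "\<exists>l. kobayashi_chain X atl (P z) (P w) l"
  proof (rule tube_relation_total[OF _ _ _ _ zw(1,2)])
    show "\<exists>l. kobayashi_chain X atl (P z) (P w) l \<Longrightarrow> \<exists>l. kobayashi_chain X atl (P w) (P z) l" for z w
      by (erule exE, rule exI, rule kobayashi_chain_sym)
    show "\<exists>l. kobayashi_chain X atl (P z) (P w) l \<Longrightarrow> \<exists>l. kobayashi_chain X atl (P w) (P v) l \<Longrightarrow>
        \<exists>l. kobayashi_chain X atl (P z) (P v) l" for z w v
      by (elim exE, rule exI, rule kobayashi_chain_trans)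
    show "\<exists>l. kobayashi_chain X atl (P (c *s z)) (P z) l" if "z \<in> tube" "c \<noteq> 0" for z c
      using that kobayashi_chain.trivial[of "P z" X atl] by (auto simp: P_scale topspace_X)
    show "\<exists>\<delta>>0. \<forall>w\<in>tube. dist z w < \<delta> \<longrightarrow> (\<exists>l. kobayashi_chain X atl (P z) (P w) l)" if "z \<in> tube" for z
      using chain_nearby[OF that, of 1] by (metis zero_less_one)
  qed
  then show ?thesis using that zw by blast
qed

text \<open>Each disc is lifted so that it starts where the lift of the preceding part ended; the
  Harnack bounds then add up along the chain.\<close>

lemma chain_lift:
  assumes "kobayashi_chain X atl p q l" "x \<in> tube" "cdot \<psi> x = 1" "P x = p"
  shows "\<exists>y\<in>tube. cdot \<psi> y = 1 \<and> P y = q \<and> close l x y"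
  using assms
proof (induction rule: kobayashi_chain.induct)
  case (trivial p)
  then show ?case using close_refl by auto
next
  case (extend p f a l b)
  obtain y where y: "y \<in> tube" "cdot \<psi> y = 1" "P y = f a" "close l x y"
    using extend.IH[OF extend.prems] by blast
  have ab: "cmod a < 1" "cmod b < 1" using extend.hyps by auto
  obtain F :: "complex \<Rightarrow> complex ^ 'n" where F: "\<And>j. (\<lambda>z. F z $ j) holomorphic_on ball 0 1"
    "\<And>z. cmod z < 1 \<Longrightarrow> F z \<in> tube \<and> cdot \<psi> (F z) = 1 \<and> P (F z) = f z" "F a = y"
    using holomorphic_disc_lift[OF extend.hyps(2) ab(1) y(1-3)] by metis
  have "close (poincare_distance a b) (F a) (F b)"
    by (rule holomorphic_disc_close[OF F(1) _ ab]) (use F(2) in blast)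
  then have "close (l + poincare_distance a b) x (F b)" using close_trans[OF y(4)] F(3) by simp
  then show ?case using F(2)[OF ab(2)] by blast
qed

text \<open>The infimum over chains need not be attained; the strict bound leaves room for a chain
  of length below \<open>e\<close>.\<close>

lemma close_lift:
  assumes "p \<in> P ` tube" "q \<in> P ` tube" "d p q < e" "x \<in> tube" "cdot \<psi> x = 1" "P x = p"
  shows "\<exists>y\<in>tube. cdot \<psi> y = 1 \<and> P y = q \<and> close e x y"
proof -
  obtain l0 where "kobayashi_chain X atl p q l0" using chain_exists[OF assms(1,2)] .
  then obtain l where l: "kobayashi_chain X atl p q l" "l < e"
    using kobayashi_distance_less assms(3) unfolding d_def by metis
  obtain y where "y \<in> tube" "cdot \<psi> y = 1" "P y = q" "close l x y" using chain_lift[OF l(1) assms(4-6)] by blast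
  then show ?thesis using close_mono l(2) assms(4) by (metis less_imp_le)
qed

lemma d_nearby:
  assumes z: "z \<in> tube" and e: "e > 0"
  obtains \<delta> where "\<delta> > 0" "\<And>w. dist z w < \<delta> \<Longrightarrow> d (P z) (P w) < e"
proof -
  obtain \<delta> where \<delta>: "\<delta> > 0" "\<And>w. dist z w < \<delta> \<Longrightarrow> \<exists>l<e. kobayashi_chain X atl (P z) (P w) l"
    using chain_nearby[OF assms] by metis
  have "d (P z) (P w) < e" if "dist z w < \<delta>" for w
    using \<delta>(2)[OF that] kobayashi_distance_le unfolding d_def by (metis le_less_trans)
  then show ?thesis using that \<delta>(1) by blast
qed

lemma close_limit:
  assumes lim: "y \<longlonglongrightarrow> l" and l: "l \<in> tube" and cl: "\<forall>\<^sub>F n in sequentially. close e x (y n)"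
  shows "close e x l"
  unfolding close_def
proof (intro ballI allI)
  fix f g s assume fg: "f \<in> dual" "g \<in> dual"
  have ct: "(\<lambda>n. cdot h (y n)) \<longlonglongrightarrow> cdot h l" for h
    unfolding cdot_def by (intro tendsto_intros lim)
  have "(\<lambda>n. cone_ratio f g s (y n)) \<longlonglongrightarrow> cone_ratio f g s l"
    unfolding cone_ratio_def by (intro tendsto_intros ct cone_denominator_nz l fg)
  then have R: "(\<lambda>n. Re (cone_ratio f g s (y n))) \<longlonglongrightarrow> Re (cone_ratio f g s l)" by (rule tendsto_Re)
  let ?R = "\<lambda>z. Re (cone_ratio f g s z)"
  have "?R x \<le> exp e * ?R l"
  proof (rule tendsto_le[OF _ tendsto_mult[OF tendsto_const R] tendsto_const])
    show "\<forall>\<^sub>F n in sequentially. ?R x \<le> exp e * ?R (y n)"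
      using cl by eventually_elim (use fg in \<open>simp add: close_def\<close>)
  qed simp
  moreover have "?R l \<le> exp e * ?R x"
  proof (rule tendsto_le[OF _ tendsto_const R])
    show "\<forall>\<^sub>F n in sequentially. ?R (y n) \<le> exp e * ?R x"
      using cl by eventually_elim (use fg in \<open>simp add: close_def\<close>)
  qed simp
  ultimately show "?R x \<le> exp e * ?R l \<and> ?R l \<le> exp e * ?R x" by blast
qed

text \<open>Lifts \<open>y n\<close> of \<open>q\<close> that are \<open>1 / n\<close>-close to a lift \<open>x\<close> of \<open>p\<close> subconverge to \<open>x\<close>; as \<open>P\<close> is injective
  near \<open>x\<close> on the slice \<open>\<psi> = 1\<close>, they are eventually constant.\<close>

lemma d_zero_imp_eq:
  assumes p: "p \<in> P ` tube" and q: "q \<in> P ` tube" and 0: "d p q = 0"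
  shows "p = q"
proof -
  obtain x0 where x0: "x0 \<in> tube" "p = P x0" using p by blast
  define x where "x = nrm x0"
  have x: "x \<in> tube" "cdot \<psi> x = 1" "P x = p" using x0 nrm_tube cdot_nrm P_nrm by (auto simp: x_def)
  have "\<exists>y\<in>tube. cdot \<psi> y = 1 \<and> P y = q \<and> close (1 / real (Suc n)) x y" for n
    by (rule close_lift[OF p q _ x]) (simp add: 0)
  then obtain y where y: "\<And>n. y n \<in> tube" "\<And>n. cdot \<psi> (y n) = 1" "\<And>n. P (y n) = q"
      "\<And>n. close (1 / real (Suc n)) x (y n)" by metis
  obtain K where K: "compact K" "K \<subseteq> tube" "\<And>w. w \<in> K \<Longrightarrow> cdot \<psi> w = 1"
    "\<And>w. w \<in> tube \<Longrightarrow> cdot \<psi> w = 1 \<Longrightarrow> close 1 x w \<Longrightarrow> w \<in> K"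
    using close_ball_compact[OF x(1), of 1] by metis
  have "y n \<in> K" for n using K(4) y close_mono[OF y(4) _ x(1) y(1), of n 1] by simp
  then obtain l k where l: "l \<in> K" "strict_mono k" "(y \<circ> k) \<longlonglongrightarrow> l"
    using K(1) unfolding compact_def by metis
  have lt: "l \<in> tube" "cdot \<psi> l = 1" using l K by auto
  have "x = l"
  proof (rule close_limit_eq[OF x(1,2) lt])
    fix e :: real assume e: "e > 0"
    obtain N where N: "1 / real (Suc N) < e" using reals_Archimedean[OF e] by (auto simp: inverse_eq_divide)
    have "close e x ((y \<circ> k) n)" if n: "n \<ge> N" for n
    proof -
      have "N \<le> k n" using n seq_suble[OF l(2), of n] by linarith
      then have "1 / real (Suc (k n)) \<le> 1 / real (Suc N)" by (intro divide_left_mono) auto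
      then show ?thesis using close_mono[OF y(4) _ x(1) y(1), of "k n" e] N by simp
    qed
    then show "close e x l" using close_limit[OF l(3) lt(1)] eventually_sequentially by blast
  qed
  obtain V where V: "open V" "x \<in> V" "V \<subseteq> tube" "\<And>c v. c \<noteq> 0 \<Longrightarrow> v \<in> V \<Longrightarrow> c *s v \<in> V"
    "\<And>A v. A \<in> G \<Longrightarrow> v \<in> V \<Longrightarrow> cmat A *v v \<in> V \<Longrightarrow> A \<in> scalars"
    using injective_nhd[OF x(1)] by metis
  have "\<forall>\<^sub>F n in sequentially. (y \<circ> k) n \<in> V"
    using l(3) V(1,2) \<open>x = l\<close> by (metis topological_tendstoD)
  then obtain N where N: "\<And>n. n \<ge> N \<Longrightarrow> y (k n) \<in> V" by (auto simp: eventually_sequentially)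
  have const: "y (k n) = y (k N)" if "n \<ge> N" for n
  proof -
    have "P (y (k N)) = P (y (k n))" using y by simp
    then obtain A c where A: "A \<in> G" "c \<noteq> 0" "y (k n) = c *s (cmat A *v y (k N))" using y(1) by (rule P_eqE)
    have "(1 / c) *s y (k n) \<in> V" using V(4)[of "1 / c" "y (k n)"] N[OF that] A(2) by simp
    then have "cmat A *v y (k N) \<in> V" using A by simp
    then have "A \<in> scalars" using V(5)[OF A(1) N[of N]] by simp
    then obtain b where b: "b \<noteq> 0" "cmat A *v y (k N) = of_real b *s y (k N)" using scalars_G by blast
    then have "y (k n) = (c * of_real b) *s y (k N)" using A by simp
    then have "nrm (y (k n)) = nrm (y (k N))" using nrm_scale[of "c * of_real b"] A(2) b(1) by simp
    then show ?thesis using y(2) by (simp add: nrm_id)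
  qed
  have "(y \<circ> k) \<longlonglongrightarrow> y (k N)"
    by (rule tendsto_eventually) (unfold eventually_sequentially comp_def, use const in blast)
  then have "y (k N) = l" using LIMSEQ_unique l(3) by blast
  then show ?thesis using y(3)[of "k N"] x(3) \<open>x = l\<close> by simp
qed

lemma metric_space_d: "Metric_space (P ` tube) d"
proof
  show "0 \<le> d p q" for p q by (simp add: d_def kobayashi_distance_nonneg)
  show "d p q = d q p" for p q unfolding d_def by (rule kobayashi_distance_commute)
  show "d p q = 0 \<longleftrightarrow> p = q" if "p \<in> P ` tube" "q \<in> P ` tube" for p q
  proof
    show "d p q = 0 \<Longrightarrow> p = q" using d_zero_imp_eq that by blast
    assume "p = q"
    then have "d p q \<le> 0" unfolding d_def
      using that kobayashi_distance_le[OF kobayashi_chain.trivial[of p X atl]] by (simp add: topspace_X)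
    then show "d p q = 0" using kobayashi_distance_nonneg[of X atl p q] by (simp add: d_def)
  qed
  show "d p s \<le> d p q + d q s" if "p \<in> P ` tube" "q \<in> P ` tube" "s \<in> P ` tube" for p q s
    unfolding d_def using kobayashi_distance_triangle chain_exists that by metis
qed

text \<open>A Cauchy sequence is bounded, hence lifts to a sequence in a compact subset of the tube.\<close>

lemma mcomplete_d: "Metric_space.mcomplete (P ` tube) d"
proof -
  interpret M: Metric_space "P ` tube" d by (rule metric_space_d)
  show ?thesis unfolding M.mcomplete_def
  proof (intro allI impI)
    fix \<sigma> assume cau: "M.MCauchy \<sigma>"
    then have ran: "\<sigma> n \<in> P ` tube" for n by (auto simp: M.MCauchy_def)
    obtain N where N: "\<And>n. n \<ge> N \<Longrightarrow> d (\<sigma> N) (\<sigma> n) < 1"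
      using cau unfolding M.MCauchy_def by (metis order_refl zero_less_one)
    obtain x0 where x0: "x0 \<in> tube" "\<sigma> N = P x0" using ran by blast
    define x where "x = nrm x0"
    have x: "x \<in> tube" "cdot \<psi> x = 1" "P x = \<sigma> N" using x0 nrm_tube cdot_nrm P_nrm by (auto simp: x_def)
    have "\<exists>y\<in>tube. cdot \<psi> y = 1 \<and> P y = \<sigma> (N + n) \<and> close 1 x y" for n
      by (rule close_lift[OF ran ran _ x]) (simp add: N)
    then obtain y where y: "\<And>n. y n \<in> tube" "\<And>n. cdot \<psi> (y n) = 1" "\<And>n. P (y n) = \<sigma> (N + n)"
      "\<And>n. close 1 x (y n)" by metis
    obtain K where K: "compact K" "K \<subseteq> tube" "\<And>w. w \<in> tube \<Longrightarrow> cdot \<psi> w = 1 \<Longrightarrow> close 1 x w \<Longrightarrow> w \<in> K"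
      using close_ball_compact[OF x(1), of 1] by metis
    have "y n \<in> K" for n using K(3) y by blast
    then obtain l k where l: "l \<in> K" "strict_mono k" "(y \<circ> k) \<longlonglongrightarrow> l"
      using K(1) unfolding compact_def by metis
    have lt: "l \<in> tube" using l K by blast
    \<comment> \<open>\<open>y n\<close> lifts \<open>\<sigma> (N + n)\<close>, hence the shift by
      \<open>N\<close>.\<close>
    define r' where "r' n = N + k n" for n
    have "strict_mono r'" using l(2) by (simp add: r'_def strict_mono_def)
    moreover have "limitin M.mtopology (\<sigma> \<circ> r') (P l) sequentially"
      unfolding M.limitin_metric
    proof (intro conjI allI impI)
      show "P l \<in> P ` tube" using lt by blast
      fix e :: real assume e: "e > 0"
      obtain \<delta> where \<delta>: "\<delta> > 0" "\<And>w. dist l w < \<delta> \<Longrightarrow> d (P l) (P w) < e" using d_nearby[OF lt e] by metis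
      have "\<forall>\<^sub>F n in sequentially. dist ((y \<circ> k) n) l < \<delta>" using tendstoD[OF l(3) \<delta>(1)] .
      then show "\<forall>\<^sub>F n in sequentially. (\<sigma> \<circ> r') n \<in> P ` tube \<and> d ((\<sigma> \<circ> r') n) (P l) < e"
      proof eventually_elim
        case (elim n)
        then have "d (P l) (P (y (k n))) < e" by (intro \<delta>(2)) (simp add: dist_commute)
        then show ?case using ran by (simp add: r'_def y(3) M.commute)
      qed
    qed
    ultimately show "\<exists>p. limitin M.mtopology \<sigma> p sequentially"
      using M.MCauchy_convergent_subsequence[OF cau] by blast
  qed
qed

end

theorem theorem5p2:
  fixes \<Omega> :: "(real ^ 'n) set set" and \<Gamma> :: "(real ^ 'n ^ 'n) set set"
  assumes "properly_convex \<Omega>"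
    and "openin proj_topology \<Omega>"
    and "subgroup \<Gamma> PGL"
    and "acts_on \<Gamma> \<Omega>"
    and "acts_freely \<Gamma> \<Omega>"
    and "acts_properly_discontinuously \<Gamma> \<Omega>"
  defines "d \<equiv> kobayashi_distance (complexification_topology \<Omega> \<Gamma>) (complexification_atlas \<Omega> \<Gamma>)"
  shows "Metric_space (complexification \<Omega> \<Gamma>) d \<and> Metric_space.mcomplete (complexification \<Omega> \<Gamma>) d"
proof (cases "elliptic_tube \<Omega> = {}")
  \<comment> \<open>This happens for \<open>CARD('n') = 1\<close>, where projective space is one
    point and has no segment with distinct endpoints. Even on the empty carrier,
    \<open>Metric_space\<close> asks for nonnegativity and symmetry at all arguments.\<close>
  case True
  have "Metric_space {} d"
    by standard (simp_all add: d_def kobayashi_distance_nonneg kobayashi_distance_commute)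
  then show ?thesis using True Metric_space.mcomplete_empty_mspace by (auto simp: complexification_def)
next
  case False
  \<comment> \<open>The segment provides the base point \<open>v0\<close> of the cone and also the
    two distinct projective points that \<open>elliptic_tube_eq\<close> asks for.\<close>
  then obtain v0 v1 where v: "v0 \<noteq> 0" "v1 \<noteq> 0" "proj_point v0 \<noteq> proj_point v1"
      "closed_segment_proj v0 v1 \<subseteq> \<Omega>"
    by (auto simp: elliptic_tube_def)
  have "v0 \<in> {w. w \<noteq> 0 \<and> (\<exists>c0 c1 :: real. c0 * c1 \<ge> 0 \<and> w = c0 *s v0 + c1 *s v1)}"
  proof -
    have "(1::real) * 0 \<ge> 0 \<and> v0 = 1 *s v0 + 0 *s v1" by simp
    then show ?thesis using v(1) by blast
  qed
  then have "v0 \<in> lines_union \<Omega>"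
    using v unfolding closed_segment_proj_def lines_union_def by blast
  then obtain C where C: "open C" "convex C" "v0 \<in> C" "\<And>c x. c > 0 \<Longrightarrow> x \<in> C \<Longrightarrow> c *\<^sub>R x \<in> C"
    "lines_union \<Omega> = C \<union> uminus ` C" "\<And>u. u \<in> closure C \<Longrightarrow> - u \<in> closure C \<Longrightarrow> u = 0"
    using lines_union_cone[OF assms(1,2)] by metis
  interpret proper_cone C by standard (use C in auto)
  obtain \<psi> r where "r > 0" "\<And>x. norm x \<le> r \<Longrightarrow> \<psi> + x \<in> dual" using dual_interior by metis
  then interpret based_cone C \<psi> r by unfold_locales
  interpret A: cone_action C \<psi> r \<Omega> \<Gamma>
    by (intro cone_action.intro cone_action_axioms.intro based_cone_axioms assms(3-6) C(5)
        elliptic_tube_eq[OF C(5) v(1-3)])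
  have "d = A.d" by (simp add: d_def A.d_def A.X_def A.atl_def)
  then show ?thesis using A.metric_space_d A.mcomplete_d by (simp add: A.P_image_tube)
qed

end
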